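(* Let $n\ge 2$ be fixed and, for each $p$, let $\bm{X}_1,\ldots,\bm{X}_n$ be i.i.d. random vectors from $N_p(\bm{\mu},\Sigma)$, with $\bm X_i=(X_{i1},\ldots,X_{ip})^T$. For a given $\bm\mu_0=(\mu_{01},\ldots,\mu_{0p})^T$ consider the null hypothesis $H_0:\bm\mu=\bm\mu_0$. Let $\bar X_j=\frac1n\sum_{i=1}^n X_{ij}$, $s_j^2=\frac{1}{n-1}\sum_{i=1}^n (X_{ij}-\bar X_j)^2$, $t_{nj}=\sqrt n(\bar X_j-\mu_{0j})/s_j$, $\nu_1=n-1$, $U_{nj}=n\log(1+t_{nj}^2/\nu_1)$ and $$T_1=\sum_{j=1}^p U_{nj}=n\sum_{j=1}^p\log\Bigl(1+\frac{t_{nj}^2}{\nu_1}\Bigr).$$ Let $\Psi=\Gamma'/\Gamma$ be the digamma function, $D(x)=\Psi\{(x+1)/2\}-\Psi(x/2)$, $m_1=nD(\nu_1)$ and $m_2=n^2\{D^2(\nu_1)-2D'(\nu_1)\}$. Assume the sequence $\{U_{nj}\}_{j\ge1}$ is stationary and satisfies: (C1) with $\alpha(\mathcal F,\mathcal G)=\sup\{|P(A\cap B)-P(A)P(B)|: A\in\mathcal F, B\in\mathcal G\}$, $\mathcal F_a^b=\sigma\{U_{nj}: a\le j\le b\}$ and $\alpha(r)=\sup\{\alpha(\mathcal F_1^k,\mathcal F_{k+r}^p):1\le k\le p-r\}$, we have $\alpha(r)\downarrow 0$ monotonically as $r\to\infty$; (C2) $\sum_{r=1}^\infty \alpha(r)^{\delta/(2+\delta)}<\infty$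 for some $\delta>0$, and for every $k\ge0$ the limit $\gamma(k)=\lim_{p\to\infty}\frac{1}{p-k}\sum_{j=1}^{p-k}\mathrm{Cov}(U_{nj},U_{n,j+k})$ exists. Then under $H_0$, $$\frac{T_1-pm_1}{\tau_1\sqrt p}\xrightarrow{\mathcal D}N(0,1)\quad\text{as }p\to\infty,$$ where $\tau_1^2=m_2-m_1^2+2\sum_{k=1}^\infty\gamma(k)$.
   Context: $\Gamma(x)=\int_0^\infty t^{x-1}e^{-t}\,dt$ is the gamma function; $\xrightarrow{\mathcal D}$ denotes convergence in distribution. $\Sigma$ is not assumed diagonal. *)

theory Defs
  imports "HOL-Probability.Probability"
begin

text \<open>Gaussian process indexed by coordinates j = 1, 2, ... with mean vector mu and
  covariance kernel S: every finite linear combination of coordinates 1..p is normally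
  distributed with the corresponding mean and variance (a degenerate normal, i.e. an
  a.s. constant, when the variance is 0). Restricted to the coordinates 1..p this is
  exactly N_p(mu, Sigma).\<close>
definition gaussian_proc ::
  "'a measure \<Rightarrow> (nat \<Rightarrow> 'a \<Rightarrow> real) \<Rightarrow> (nat \<Rightarrow> real) \<Rightarrow> (nat \<Rightarrow> nat \<Rightarrow> real) \<Rightarrow> bool" where
  "gaussian_proc M Y mu S \<longleftrightarrow>
     (\<forall>j. Y j \<in> borel_measurable M) \<and>
     (\<forall>(p::nat) (c::nat \<Rightarrow> real).
        (let L = (\<lambda>\<omega>. \<Sum>j\<in>{1..p}. c j * Y j \<omega>);
             m = (\<Sum>j\<in>{1..p}. c j * mu j);
             v = (\<Sum>i\<in>{1..p}. \<Sum>j\<in>{1..p}. c i * c j * S i j)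
         in if v > 0 then distributed M lborel L (\<lambda>x. ennreal (normal_density m (sqrt v) x))
            else (AE \<omega> in M. L \<omega> = m)))"

definition pos_def_cov :: "(nat \<Rightarrow> nat \<Rightarrow> real) \<Rightarrow> bool" where
  "pos_def_cov S \<longleftrightarrow> (\<forall>i j. S i j = S j i) \<and>
     (\<forall>(p::nat) (c::nat \<Rightarrow> real). (\<exists>j\<in>{1..p}. c j \<noteq> 0) \<longrightarrow>
        (\<Sum>i\<in>{1..p}. \<Sum>j\<in>{1..p}. c i * c j * S i j) > 0)"

definition xbar :: "(nat \<Rightarrow> nat \<Rightarrow> 'a \<Rightarrow> real) \<Rightarrow> nat \<Rightarrow> nat \<Rightarrow> 'a \<Rightarrow> real" where
  "xbar X n j \<omega> = (\<Sum>i\<in>{1..n}. X i j \<omega>) / real n"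

definition svar :: "(nat \<Rightarrow> nat \<Rightarrow> 'a \<Rightarrow> real) \<Rightarrow> nat \<Rightarrow> nat \<Rightarrow> 'a \<Rightarrow> real" where
  "svar X n j \<omega> = (\<Sum>i\<in>{1..n}. (X i j \<omega> - xbar X n j \<omega>)\<^sup>2) / (real n - 1)"

definition tstat :: "(nat \<Rightarrow> nat \<Rightarrow> 'a \<Rightarrow> real) \<Rightarrow> nat \<Rightarrow> (nat \<Rightarrow> real) \<Rightarrow> nat \<Rightarrow> 'a \<Rightarrow> real" where
  "tstat X n mu0 j \<omega> = sqrt (real n) * (xbar X n j \<omega> - mu0 j) / sqrt (svar X n j \<omega>)"

definition Ustat :: "(nat \<Rightarrow> nat \<Rightarrow> 'a \<Rightarrow> real) \<Rightarrow> nat \<Rightarrow> (nat \<Rightarrow> real) \<Rightarrow> nat \<Rightarrow> 'a \<Rightarrow> real" where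
  "Ustat X n mu0 j \<omega> = real n * ln (1 + (tstat X n mu0 j \<omega>)\<^sup>2 / (real n - 1))"

definition T1stat :: "(nat \<Rightarrow> nat \<Rightarrow> 'a \<Rightarrow> real) \<Rightarrow> nat \<Rightarrow> (nat \<Rightarrow> real) \<Rightarrow> nat \<Rightarrow> 'a \<Rightarrow> real" where
  "T1stat X n mu0 p \<omega> = (\<Sum>j\<in>{1..p}. Ustat X n mu0 j \<omega>)"

definition Dfun :: "real \<Rightarrow> real" where
  "Dfun x = Digamma ((x + 1) / 2) - Digamma (x / 2)"

definition m1 :: "nat \<Rightarrow> real" where
  "m1 n = real n * Dfun (real n - 1)"

definition m2 :: "nat \<Rightarrow> real" where
  "m2 n = (real n)\<^sup>2 * ((Dfun (real n - 1))\<^sup>2 - 2 * deriv Dfun (real n - 1))"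

definition sigma_gen :: "'a measure \<Rightarrow> (nat \<Rightarrow> 'a \<Rightarrow> real) \<Rightarrow> nat set \<Rightarrow> 'a set set" where
  "sigma_gen M U A = sigma_sets (space M) (\<Union>j\<in>A. {U j -` B \<inter> space M | B. B \<in> sets borel})"

definition alpha_dep :: "'a measure \<Rightarrow> 'a set set \<Rightarrow> 'a set set \<Rightarrow> real" where
  "alpha_dep M F G = Sup {\<bar>measure M (A \<inter> B) - measure M A * measure M B\<bar> | A B. A \<in> F \<and> B \<in> G}"

text \<open>alpha(r) = sup over k >= 1 and p >= k + r of alpha(F_1^k, F_{k+r}^p),
  i.e. the paper's alpha_p(r) taken uniformly in p.\<close>
definition alpha_mix :: "'a measure \<Rightarrow> (nat \<Rightarrow> 'a \<Rightarrow> real) \<Rightarrow> nat \<Rightarrow> real" where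
  "alpha_mix M U r = Sup {alpha_dep M (sigma_gen M U {1..k}) (sigma_gen M U {k+r..p}) | k p.
                          1 \<le> k \<and> k + r \<le> p}"

definition stationary_seq :: "'a measure \<Rightarrow> (nat \<Rightarrow> 'a \<Rightarrow> real) \<Rightarrow> bool" where
  "stationary_seq M U \<longleftrightarrow> (\<forall>k m.
     distr M (Pi\<^sub>M {1..m} (\<lambda>_. borel)) (\<lambda>\<omega>. \<lambda>j\<in>{1..m}. U (j + k) \<omega>) =
     distr M (Pi\<^sub>M {1..m} (\<lambda>_. borel)) (\<lambda>\<omega>. \<lambda>j\<in>{1..m}. U j \<omega>))"

definition cov :: "'a measure \<Rightarrow> ('a \<Rightarrow> real) \<Rightarrow> ('a \<Rightarrow> real) \<Rightarrow> real" where
  "cov M Y Z = (\<integral>\<omega>. (Y \<omega> - (\<integral>x. Y x \<partial>M)) * (Z \<omega> - (\<integral>x. Z x \<partial>M)) \<partial>M)"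

end

theory Submission
  imports Defs
begin

text \<open>
  Standardising the observations, \<open>U\<^sub>n\<^sub>j = n ln (1 + A\<^sup>2 / R)\<close> where \<open>A\<close> is the scaled mean and \<open>R\<close> the centred
  sum of squares of \<open>n\<close> independent standard normal variables. As \<open>A\<close> and \<open>R\<close> are independent,
  \<open>E (1 + A\<^sup>2 / R) powr (- s)\<close> is a quotient of Gamma functions; its first two derivatives at \<open>s = 0\<close>
  identify \<open>m1\<close> and \<open>m2\<close> as the first two moments of \<open>U\<^sub>n\<^sub>j\<close>, and its finiteness around 0 gives all moments of \<open>U\<^sub>n\<^sub>j\<close>.

  The central limit theorem is Ibragimov's for stationary strongly mixing sequences. A covariance
  inequality makes the autocovariances absolutely summable, uniformly over all images \<open>h(U\<^sub>n\<^sub>j)\<close> with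
  \<open>\<bar>h x\<bar> \<le> \<bar>x\<bar>\<close>. Hence truncation changes the normalised sums by a small amount in mean square,
  uniformly in \<open>p\<close>, and bounded sequences are handled by comparing the characteristic function
  with that of independent blocks.
\<close>

section \<open>Gamma distributions\<close>

text \<open>The exponent \<open>\<delta>\<close> is dictated by the mixing rate, so moments of
  arbitrarily high order must be available; they come from a Laplace transform that is finite on
  both sides of 0. The interval \<open>\<bar>s\<bar> < 1 / 2\<close> serves every
  \<open>n \<ge> 2\<close>, because \<open>(n - 1) / 2 + s\<close> stays positive on it.
  Distributional identities are stated for nonnegative integrals of arbitrary measurable functions:
  independence and changes of variables then become manipulations of iterated integrals without
  integrability conditions. Truncation precedes blocking because the blocks have length of order
  \<open>sqrt p\<close>. For bounded variables a block sum is at most a multiple of the block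
  length, and its third absolute moment is then controlled by its variance. Characteristic functions
  keep truncations with vanishing long-run variance within the same statement; positivity of the
  variance enters at the final normalisation. Stationarity makes the averaged covariances constant
  in \<open>p\<close>, which identifies \<open>gam k\<close> with the autocovariance at lag
  \<open>k\<close>.\<close>

definition gamma_kernel :: "real \<Rightarrow> real \<Rightarrow> real" where
  "gamma_kernel a x = indicator {0<..} x * (x powr (a - 1) * exp (- x))"

text \<open>The unnormalised beta prime density: the law of the quotient of independent Gamma
  variables of shapes \<open>a\<close> and \<open>b\<close>.\<close>

definition beta_kernel :: "real \<Rightarrow> real \<Rightarrow> real \<Rightarrow> real" where
  "beta_kernel a b x = indicator {0<..} x * (x powr (a - 1) * (1 + x) powr (- (a + b)))"

text \<open>Shape \<open>a\<close>, rate 1. Half a chi-square variable with \<open>k\<close> degrees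
  of freedom has this law for \<open>a = k / 2\<close>, which is why halves of squares appear
  below.\<close>

definition gamma_distr :: "real \<Rightarrow> real measure" where
  "gamma_distr a = density lborel (\<lambda>x. ennreal (gamma_kernel a x / Gamma a))"

lemma gamma_kernel_measurable [measurable]: "gamma_kernel a \<in> borel_measurable borel"
  unfolding gamma_kernel_def by measurable

lemma beta_kernel_measurable [measurable]: "beta_kernel a b \<in> borel_measurable borel"
  unfolding beta_kernel_def by measurable

lemma gamma_kernel_nonneg [simp]: "gamma_kernel a x \<ge> 0"
  by (simp add: gamma_kernel_def)

lemma beta_kernel_nonneg [simp]: "beta_kernel a b x \<ge> 0"
  by (simp add: beta_kernel_def)

lemma sets_gamma_distr [measurable_cong, simp]: "sets (gamma_distr a) = sets borel"
  by (simp add: gamma_distr_def)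

lemma space_gamma_distr [simp]: "space (gamma_distr a) = UNIV"
  by (simp add: gamma_distr_def)

lemma nn_integral_gamma_kernel:
  assumes "a > 0"
  shows "(\<integral>\<^sup>+x. ennreal (gamma_kernel a x) \<partial>lborel) = ennreal (Gamma a)"
proof -
  have "AE x in lborel. ennreal (gamma_kernel a x) = ennreal (indicator {0..} x * x powr (a - 1) / exp x)"
    using AE_lborel_singleton[of 0]
    by eventually_elim (auto simp: gamma_kernel_def exp_minus field_simps split: split_indicator)
  then show ?thesis
    unfolding Gamma_conv_nn_integral_real[OF assms] by (rule nn_integral_cong_AE)
qed

lemma nn_integral_gamma_distr:
  assumes "a > 0" and [measurable]: "h \<in> borel_measurable borel"
  shows "(\<integral>\<^sup>+x. h x \<partial>gamma_distr a) = ennreal (1 / Gamma a) * (\<integral>\<^sup>+x. ennreal (gamma_kernel a x) * h x \<partial>lborel)"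
proof -
  have "ennreal (gamma_kernel a x / Gamma a) = ennreal (1 / Gamma a) * ennreal (gamma_kernel a x)" for x
    using assms(1) Gamma_real_pos[of a] by (subst ennreal_mult[symmetric]) (auto simp: field_simps)
  then show ?thesis
    unfolding gamma_distr_def
    by (subst nn_integral_density) (auto simp: mult.assoc nn_integral_cmult)
qed

lemma prob_space_gamma_distr:
  assumes "a > 0"
  shows "prob_space (gamma_distr a)"
proof
  have "emeasure (gamma_distr a) (space (gamma_distr a)) = (\<integral>\<^sup>+x. 1 \<partial>gamma_distr a)"
    by simp
  also have "\<dots> = ennreal (1 / Gamma a) * ennreal (Gamma a)"
    using assms by (subst nn_integral_gamma_distr) (auto simp: nn_integral_gamma_kernel)
  also have "\<dots> = 1"
    using Gamma_real_pos[OF assms] by (subst ennreal_mult[symmetric]) auto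
  finally show "emeasure (gamma_distr a) (space (gamma_distr a)) = 1" .
qed

lemma AE_gamma_distr_pos: "AE x in gamma_distr a. x > 0"
  unfolding gamma_distr_def
  by (subst AE_density) (auto simp: gamma_kernel_def split: split_indicator)

text \<open>Two linear substitutions, first \<open>r = w x\<close> for fixed \<open>w\<close> and then \<open>v = (1 + x) w\<close>
  for fixed \<open>x\<close>, replace the change of variables to sum and quotient.\<close>

lemma nn_integral_gamma_kernel_sum_quotient:
  assumes "a > 0" "b > 0" and [measurable]: "H \<in> borel_measurable (borel \<Otimes>\<^sub>M borel)"
  shows "(\<integral>\<^sup>+w. \<integral>\<^sup>+r. ennreal (gamma_kernel a r * gamma_kernel b w) * H (r + w, r / w) \<partial>lborel \<partial>lborel)
       = (\<integral>\<^sup>+x. ennreal (beta_kernel a b x) * (\<integral>\<^sup>+v. ennreal (gamma_kernel (a + b) v) * H (v, x) \<partial>lborel) \<partial>lborel)"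
    (is "?L = ?R")
proof -
  \<comment> \<open>The joint kernel in the coordinates \<open>w\<close> and
    \<open>x = r / w\<close>, Jacobian included. Both sides of the identity are brought to it, one
    by each substitution.\<close>
  define K where "K w x = indicator {0<..} w * indicator {0<..} x *
     (w powr (a + b - 1) * x powr (a - 1) * exp (- ((1 + x) * w)))" for w x :: real
  have [measurable]: "case_prod K \<in> borel_measurable (borel \<Otimes>\<^sub>M borel)"
    unfolding K_def by measurable
  have K_nonneg [simp]: "K w x \<ge> 0" for w x by (simp add: K_def)
  have "?L = (\<integral>\<^sup>+w. \<integral>\<^sup>+x. ennreal (K w x) * H ((1 + x) * w, x) \<partial>lborel \<partial>lborel)"
  proof (rule nn_integral_cong)
    fix w :: real
    show "(\<integral>\<^sup>+r. ennreal (gamma_kernel a r * gamma_kernel b w) * H (r + w, r / w) \<partial>lborel)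
       = (\<integral>\<^sup>+x. ennreal (K w x) * H ((1 + x) * w, x) \<partial>lborel)"
    proof (cases "w > 0")
      case True
      have *: "w * (gamma_kernel a (w * x) * gamma_kernel b w) = K w x" for x
      proof (cases "x > 0")
        case x: True
        have "w powr (a + b - 1) = w * w powr (a - 1) * w powr (b - 1)"
          using True by (simp add: powr_add[symmetric] powr_mult_base add.assoc add_diff_eq)
        then show ?thesis
          using True x by (simp add: gamma_kernel_def K_def powr_mult exp_add[symmetric] algebra_simps)
      qed (use True in \<open>auto simp: gamma_kernel_def K_def zero_less_mult_iff\<close>)
      have "(\<integral>\<^sup>+r. ennreal (gamma_kernel a r * gamma_kernel b w) * H (r + w, r / w) \<partial>lborel)
         = ennreal \<bar>w\<bar> * (\<integral>\<^sup>+x. ennreal (gamma_kernel a (0 + w * x) * gamma_kernel b w) * H ((0 + w * x) + w, (0 + w * x) / w) \<partial>lborel)"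
        using True by (subst nn_integral_real_affine[where c = w and t = 0]) auto
      also have "\<dots> = (\<integral>\<^sup>+x. ennreal w * ennreal (gamma_kernel a (w * x) * gamma_kernel b w) * H ((1 + x) * w, x) \<partial>lborel)"
        using True by (subst nn_integral_cmult[symmetric]) (auto simp: algebra_simps)
      also have "\<dots> = (\<integral>\<^sup>+x. ennreal (K w x) * H ((1 + x) * w, x) \<partial>lborel)"
        using True by (subst ennreal_mult[symmetric]) (auto simp: *)
      finally show ?thesis .
    qed (simp add: gamma_kernel_def K_def)
  qed
  also have "\<dots> = (\<integral>\<^sup>+x. \<integral>\<^sup>+w. ennreal (K w x) * H ((1 + x) * w, x) \<partial>lborel \<partial>lborel)"
    by (rule lborel_pair.Fubini') measurable
  also have "\<dots> = ?R"
  proof (rule nn_integral_cong)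
    fix x :: real
    show "(\<integral>\<^sup>+w. ennreal (K w x) * H ((1 + x) * w, x) \<partial>lborel)
        = ennreal (beta_kernel a b x) * (\<integral>\<^sup>+v. ennreal (gamma_kernel (a + b) v) * H (v, x) \<partial>lborel)"
    proof (cases "x > 0")
      case True
      have *: "beta_kernel a b x * ((1 + x) * gamma_kernel (a + b) ((1 + x) * w)) = K w x" for w
      proof (cases "w > 0")
        case w: True
        have "(1 + x) powr (- (a + b)) * ((1 + x) * (1 + x) powr (a + b - 1)) = 1"
          using True by (simp add: powr_mult_base powr_add[symmetric])
        then have "(1 + x) powr (- (a + b)) * (1 + x) * ((1 + x) * w) powr (a + b - 1) = w powr (a + b - 1)"
          using True w by (simp add: powr_mult mult_ac)
        then show ?thesis
          using True w by (simp add: gamma_kernel_def beta_kernel_def K_def mult_ac)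
      next
        case False
        then have "\<not> (1 + x) * w > 0" using True by (simp add: zero_less_mult_iff)
        then show ?thesis using False by (simp add: gamma_kernel_def K_def)
      qed
      have "(\<integral>\<^sup>+v. ennreal (gamma_kernel (a + b) v) * H (v, x) \<partial>lborel) =
          ennreal \<bar>1 + x\<bar> * (\<integral>\<^sup>+w. ennreal (gamma_kernel (a + b) (0 + (1 + x) * w)) * H (0 + (1 + x) * w, x) \<partial>lborel)"
        using True by (subst nn_integral_real_affine[where c = "1 + x" and t = 0]) auto
      then have "ennreal (beta_kernel a b x) * (\<integral>\<^sup>+v. ennreal (gamma_kernel (a + b) v) * H (v, x) \<partial>lborel)
         = (\<integral>\<^sup>+w. ennreal (beta_kernel a b x) * (ennreal (1 + x) * (ennreal (gamma_kernel (a + b) ((1 + x) * w)) * H ((1 + x) * w, x))) \<partial>lborel)"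
        using True by (simp add: nn_integral_cmult)
      also have "\<dots> = (\<integral>\<^sup>+w. ennreal (beta_kernel a b x * ((1 + x) * gamma_kernel (a + b) ((1 + x) * w))) * H ((1 + x) * w, x) \<partial>lborel)"
        using True by (intro nn_integral_cong) (auto simp: ennreal_mult mult.assoc)
      finally show ?thesis by (simp add: *)
    qed (simp add: beta_kernel_def K_def)
  qed
  finally show ?thesis .
qed

text \<open>Euler's Beta integral, read off from the preceding identity with \<open>H = 1\<close>:
  one side factorises into two Gamma integrals, the other contains the factor
  \<open>Gamma (a + b)\<close>.\<close>

lemma nn_integral_beta_kernel:
  assumes "a > 0" "b > 0"
  shows "(\<integral>\<^sup>+x. ennreal (beta_kernel a b x) \<partial>lborel) = ennreal (Gamma a * Gamma b / Gamma (a + b))"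
proof -
  have "ennreal (Gamma a * Gamma b) =
      (\<integral>\<^sup>+w. \<integral>\<^sup>+r. ennreal (gamma_kernel a r * gamma_kernel b w) * 1 \<partial>lborel \<partial>lborel)"
    using assms Gamma_real_pos[of a]
    by (simp add: ennreal_mult nn_integral_multc nn_integral_cmult nn_integral_gamma_kernel mult.commute)
  also have "\<dots> = (\<integral>\<^sup>+x. ennreal (beta_kernel a b x) \<partial>lborel) * ennreal (Gamma (a + b))"
    using assms
    by (subst nn_integral_gamma_kernel_sum_quotient[where H = "\<lambda>_. 1"])
       (auto simp: nn_integral_multc nn_integral_gamma_kernel)
  finally have "ennreal (Gamma a * Gamma b) * ennreal (1 / Gamma (a + b))
      = (\<integral>\<^sup>+x. ennreal (beta_kernel a b x) \<partial>lborel) * (ennreal (Gamma (a + b)) * ennreal (1 / Gamma (a + b)))"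
    by (simp add: mult.assoc)
  moreover have "ennreal (Gamma (a + b)) * ennreal (1 / Gamma (a + b)) = 1"
    using Gamma_real_pos[OF add_pos_pos[OF assms]] by (subst ennreal_mult[symmetric]) auto
  moreover have "ennreal (Gamma a * Gamma b) * ennreal (1 / Gamma (a + b)) = ennreal (Gamma a * Gamma b / Gamma (a + b))"
    using Gamma_real_pos[of "a + b"] Gamma_real_pos[of a] Gamma_real_pos[of b] assms
    by (subst ennreal_mult[symmetric]) auto
  ultimately show ?thesis by simp
qed

text \<open>In probabilistic terms, sum and quotient of independent Gamma variables are independent,
  with a Gamma and a beta prime law.\<close>

lemma nn_integral_gamma_distr_sum_quotient:
  assumes "a > 0" "b > 0" and [measurable]: "H \<in> borel_measurable (borel \<Otimes>\<^sub>M borel)"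
  shows "(\<integral>\<^sup>+w. \<integral>\<^sup>+r. H (r + w, r / w) \<partial>gamma_distr a \<partial>gamma_distr b)
       = ennreal (Gamma (a + b) / (Gamma a * Gamma b)) *
         (\<integral>\<^sup>+x. ennreal (beta_kernel a b x) * (\<integral>\<^sup>+v. H (v, x) \<partial>gamma_distr (a + b)) \<partial>lborel)"
proof -
  have G: "Gamma a > 0" "Gamma b > 0" "Gamma (a + b) > 0"
    using assms by (auto intro: Gamma_real_pos)
  have "(\<integral>\<^sup>+w. \<integral>\<^sup>+r. H (r + w, r / w) \<partial>gamma_distr a \<partial>gamma_distr b)
    = (\<integral>\<^sup>+w. ennreal (1 / Gamma a) * (\<integral>\<^sup>+r. ennreal (gamma_kernel a r) * H (r + w, r / w) \<partial>lborel) \<partial>gamma_distr b)"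
    by (intro nn_integral_cong nn_integral_gamma_distr assms) measurable
  also have "\<dots> = ennreal (1 / Gamma b) *
     (\<integral>\<^sup>+w. ennreal (gamma_kernel b w) * (ennreal (1 / Gamma a) * (\<integral>\<^sup>+r. ennreal (gamma_kernel a r) * H (r + w, r / w) \<partial>lborel)) \<partial>lborel)"
    by (intro nn_integral_gamma_distr assms) measurable
  also have "\<dots> = ennreal (1 / Gamma b) * (ennreal (1 / Gamma a) *
     (\<integral>\<^sup>+w. \<integral>\<^sup>+r. ennreal (gamma_kernel a r * gamma_kernel b w) * H (r + w, r / w) \<partial>lborel \<partial>lborel))"
    by (simp add: nn_integral_cmult[symmetric] ennreal_mult mult_ac)
  also have "\<dots> = ennreal (1 / Gamma b) * (ennreal (1 / Gamma a) *
     (\<integral>\<^sup>+x. ennreal (beta_kernel a b x) * (\<integral>\<^sup>+v. ennreal (gamma_kernel (a + b) v) * H (v, x) \<partial>lborel) \<partial>lborel))"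
    using assms by (subst nn_integral_gamma_kernel_sum_quotient) auto
  also have "\<dots> = ennreal (Gamma (a + b) / (Gamma a * Gamma b)) *
      (\<integral>\<^sup>+x. ennreal (1 / Gamma (a + b)) * (ennreal (beta_kernel a b x) * (\<integral>\<^sup>+v. ennreal (gamma_kernel (a + b) v) * H (v, x) \<partial>lborel)) \<partial>lborel)"
    using G by (subst nn_integral_cmult) (auto simp: ennreal_mult[symmetric] mult.assoc[symmetric] field_simps)
  also have "\<dots> = ennreal (Gamma (a + b) / (Gamma a * Gamma b)) *
      (\<integral>\<^sup>+x. ennreal (beta_kernel a b x) * (\<integral>\<^sup>+v. H (v, x) \<partial>gamma_distr (a + b)) \<partial>lborel)"
    using assms by (subst nn_integral_gamma_distr) (auto simp: mult_ac)
  finally show ?thesis .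
qed

lemma gamma_distr_convolution:
  assumes "a > 0" "b > 0" and [measurable]: "h \<in> borel_measurable borel"
  shows "(\<integral>\<^sup>+w. \<integral>\<^sup>+r. h (r + w) \<partial>gamma_distr a \<partial>gamma_distr b) = (\<integral>\<^sup>+v. h v \<partial>gamma_distr (a + b))"
proof -
  have G: "Gamma a > 0" "Gamma b > 0" "Gamma (a + b) > 0"
    using assms by (auto intro: Gamma_real_pos)
  have "(\<integral>\<^sup>+w. \<integral>\<^sup>+r. h (r + w) \<partial>gamma_distr a \<partial>gamma_distr b) =
     ennreal (Gamma (a + b) / (Gamma a * Gamma b)) *
         (ennreal (Gamma a * Gamma b / Gamma (a + b)) * (\<integral>\<^sup>+v. h v \<partial>gamma_distr (a + b)))"
    using nn_integral_gamma_distr_sum_quotient[OF assms(1,2), of "\<lambda>p. h (fst p)"] assms(1,2)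
    by (simp add: nn_integral_multc nn_integral_beta_kernel)
  also have "\<dots> = (\<integral>\<^sup>+v. h v \<partial>gamma_distr (a + b))"
    using G by (simp add: mult.assoc[symmetric] ennreal_mult[symmetric])
  finally show ?thesis .
qed

text \<open>Since \<open>w / r = 1 / x\<close> and \<open>1 + 1 / x = (1 + x) / x\<close>, the
  factor \<open>(1 + w / r) powr (- s)\<close> merely shifts the first parameter of the beta kernel
  from \<open>a\<close> to \<open>a + s\<close>. Only the normalising constants change, hence a
  quotient of Gamma values.\<close>

lemma gamma_distr_quotient_moment:
  assumes "a > 0" "b > 0" "a + s > 0"
  shows "(\<integral>\<^sup>+w. \<integral>\<^sup>+r. ennreal ((1 + w / r) powr (- s)) \<partial>gamma_distr a \<partial>gamma_distr b)
       = ennreal (Gamma (a + b) / Gamma a * (Gamma (a + s) / Gamma (a + b + s)))"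
proof -
  have G: "Gamma a > 0" "Gamma b > 0" "Gamma (a + b) > 0" "Gamma (a + s) > 0" "Gamma (a + s + b) > 0"
    using assms by (auto intro: Gamma_real_pos)
  interpret prob_space "gamma_distr (a + b)"
    using assms by (intro prob_space_gamma_distr) auto
  have *: "beta_kernel a b x * (1 + 1 / x) powr (- s) = beta_kernel (a + s) b x" for x
  proof (cases "x > 0")
    case True
    have "1 + 1 / x = (1 + x) / x" using True by (simp add: field_simps)
    then show ?thesis
      using True by (simp add: beta_kernel_def powr_divide powr_minus powr_diff powr_add field_simps)
  qed (simp add: beta_kernel_def)
  have "(\<integral>\<^sup>+w. \<integral>\<^sup>+r. ennreal ((1 + w / r) powr (- s)) \<partial>gamma_distr a \<partial>gamma_distr b)
     = ennreal (Gamma (a + b) / (Gamma a * Gamma b)) *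
         (\<integral>\<^sup>+x. ennreal (beta_kernel a b x) * ennreal ((1 + 1 / x) powr (- s)) \<partial>lborel)"
    using nn_integral_gamma_distr_sum_quotient[OF assms(1,2), of "\<lambda>p. ennreal ((1 + 1 / snd p) powr (- s))"]
      emeasure_space_1 by simp
  also have "\<dots> = ennreal (Gamma (a + b) / (Gamma a * Gamma b)) * ennreal (Gamma (a + s) * Gamma b / Gamma (a + s + b))"
    using assms by (simp add: ennreal_mult[symmetric] * nn_integral_beta_kernel)
  also have "\<dots> = ennreal (Gamma (a + b) / Gamma a * (Gamma (a + s) / Gamma (a + s + b)))"
    using G by (subst ennreal_mult[symmetric]) (auto simp: field_simps)
  finally show ?thesis by (simp add: add_ac)
qed

section \<open>Half squares and rotations of standard normal variables\<close>

lemma nn_integral_exhaustion: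
  fixes F :: "real \<Rightarrow> ennreal"
  assumes [measurable]: "F \<in> borel_measurable borel" "\<And>k::nat. A k \<in> sets borel" and "incseq A"
  shows "(\<lambda>k. \<integral>\<^sup>+x. F x * indicator (A k) x \<partial>lborel) \<longlonglongrightarrow> (\<integral>\<^sup>+x. F x * indicator (\<Union>k. A k) x \<partial>lborel)"
  using Lim_emeasure_incseq[of A "density lborel F"] assms
  by (auto simp: emeasure_density image_subset_iff)

text \<open>The substitution \<open>w = z^2 / 2\<close> is available on compact intervals; the
  half-line is reached by exhausting both domains along matching intervals.\<close>

lemma nn_integral_half_square_substitution:
  fixes F :: "real \<Rightarrow> ennreal"
  assumes [measurable]: "F \<in> borel_measurable borel"
  shows "(\<integral>\<^sup>+z. F (z\<^sup>2 / 2) * ennreal z * indicator {0..} z \<partial>lborel) = (\<integral>\<^sup>+w. F w * indicator {0..} w \<partial>lborel)"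
proof -
  define g :: "real \<Rightarrow> real" where "g z = z\<^sup>2 / 2" for z
  have g_mono: "g x \<le> g y" if "0 \<le> x" "x \<le> y" for x y
    using that by (simp add: g_def power_mono)
  have U1: "(\<Union>k. {0..real (Suc k)}) = {0..}"
  proof safe
    fix x :: real assume "0 \<le> x"
    obtain k where "x \<le> real k" using real_arch_simple by blast
    then show "x \<in> (\<Union>k. {0..real (Suc k)})"
      using \<open>0 \<le> x\<close> by (intro UN_I[of k]) auto
  qed auto
  have U2: "(\<Union>k. {0..g (real (Suc k))}) = {0..}"
  proof safe
    fix x :: real assume "0 \<le> x"
    obtain k where "2 * x \<le> real k" using real_arch_simple by blast
    also have "real k \<le> (real (Suc k))\<^sup>2" by (simp add: power2_eq_square algebra_simps)
    finally show "x \<in> (\<Union>k. {0..g (real (Suc k))})"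
      using \<open>0 \<le> x\<close> by (intro UN_I[of k]) (auto simp: g_def)
  qed auto
  \<comment> \<open>The endpoint \<open>real (Suc k)\<close> keeps every interval nondegenerate, as
    the substitution rule requires.\<close>
  have eq: "(\<integral>\<^sup>+w. F w * indicator {0..g (real (Suc k))} w \<partial>lborel) =
     (\<integral>\<^sup>+z. F (g z) * ennreal z * indicator {0..real (Suc k)} z \<partial>lborel)" for k
  proof -
    have "(g has_real_derivative z) (at z)" for z
      unfolding g_def by (auto intro!: derivative_eq_intros)
    then have "(\<integral>\<^sup>+w. F w * indicator {g 0..g (real (Suc k))} w \<partial>lborel) =
        (\<integral>\<^sup>+z. F (g z) * ennreal z * indicator {0..real (Suc k)} z \<partial>lborel)"
      by (intro nn_integral_substitution_aux) auto
    then show ?thesis by (simp add: g_def)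
  qed
  have [measurable]: "g \<in> borel_measurable borel" unfolding g_def by measurable
  have "(\<lambda>k. \<integral>\<^sup>+w. F w * indicator {0..g (real (Suc k))} w \<partial>lborel) \<longlonglongrightarrow>
      (\<integral>\<^sup>+w. F w * indicator (\<Union>k. {0..g (real (Suc k))}) w \<partial>lborel)"
    by (rule nn_integral_exhaustion) (auto simp: incseq_def intro: order_trans[OF _ g_mono])
  moreover have "(\<lambda>k. \<integral>\<^sup>+z. (F (g z) * ennreal z) * indicator {0..real (Suc k)} z \<partial>lborel) \<longlonglongrightarrow>
      (\<integral>\<^sup>+z. (F (g z) * ennreal z) * indicator (\<Union>k. {0..real (Suc k)}) z \<partial>lborel)"
    by (rule nn_integral_exhaustion) (auto simp: incseq_def)
  ultimately have "(\<integral>\<^sup>+z. (F (g z) * ennreal z) * indicator {0..} z \<partial>lborel) = (\<integral>\<^sup>+w. F w * indicator {0..} w \<partial>lborel)"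
    unfolding eq U1 U2 by (rule LIMSEQ_unique[rotated])
  then show ?thesis by (simp add: g_def)
qed

text \<open>The even density is folded onto the positive half-line, which doubles it; after the
  substitution \<open>w = z^2 / 2\<close> the constants agree because
  \<open>Gamma (1 / 2) = sqrt pi\<close>.\<close>

lemma nn_integral_std_normal_half_square:
  assumes [measurable]: "h \<in> borel_measurable borel"
  shows "(\<integral>\<^sup>+z. h (z\<^sup>2 / 2) \<partial>std_normal_distribution) = (\<integral>\<^sup>+w. h w \<partial>gamma_distr (1 / 2))"
proof -
  let ?f = "\<lambda>z. ennreal (std_normal_density z) * h (z\<^sup>2 / 2)"
  have "(\<integral>\<^sup>+z. h (z\<^sup>2 / 2) \<partial>std_normal_distribution) = (\<integral>\<^sup>+z. ?f z \<partial>lborel)"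
    by (simp add: nn_integral_density)
  also have "\<dots> = (\<integral>\<^sup>+z. ?f z * indicator {0..} z + ?f z * indicator {..0} z \<partial>lborel)"
    using AE_lborel_singleton[of 0]
    by (intro nn_integral_cong_AE) (auto elim!: eventually_mono split: split_indicator)
  also have "\<dots> = (\<integral>\<^sup>+z. ?f z * indicator {0..} z \<partial>lborel) + (\<integral>\<^sup>+z. ?f z * indicator {..0} z \<partial>lborel)"
    by (rule nn_integral_add) auto
  also have "(\<integral>\<^sup>+z. ?f z * indicator {..0} z \<partial>lborel) = (\<integral>\<^sup>+z. ?f z * indicator {0..} z \<partial>lborel)"
    by (subst nn_integral_real_affine[where c = "-1" and t = 0])
       (auto simp: std_normal_density_def intro!: nn_integral_cong split: split_indicator)
  also have "(\<integral>\<^sup>+z. ?f z * indicator {0..} z \<partial>lborel) + (\<integral>\<^sup>+z. ?f z * indicator {0..} z \<partial>lborel)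
     = (\<integral>\<^sup>+z. ?f z * indicator {0..} z + ?f z * indicator {0..} z \<partial>lborel)"
    by (rule nn_integral_add[symmetric]) auto
  also have "\<dots> = (\<integral>\<^sup>+z. (ennreal (gamma_kernel (1 / 2) (z\<^sup>2 / 2) / Gamma (1 / 2)) * h (z\<^sup>2 / 2)) * ennreal z * indicator {0..} z \<partial>lborel)"
  proof (rule nn_integral_cong_AE, use AE_lborel_singleton[of 0] in eventually_elim)
    fix z :: real assume z: "z \<noteq> 0"
    show "?f z * indicator {0..} z + ?f z * indicator {0..} z =
      (ennreal (gamma_kernel (1 / 2) (z\<^sup>2 / 2) / Gamma (1 / 2)) * h (z\<^sup>2 / 2)) * ennreal z * indicator {0..} z"
    proof (cases "z > 0")
      case True
      have "(z\<^sup>2 / 2) powr (- (1 / 2)) = sqrt 2 / z"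
        using True by (simp add: powr_minus powr_half_sqrt real_sqrt_divide field_simps)
      then have "gamma_kernel (1 / 2) (z\<^sup>2 / 2) / Gamma (1 / 2) * z = (sqrt 2 / sqrt pi) * exp (- z\<^sup>2 / 2)"
        using True by (simp add: gamma_kernel_def Gamma_one_half_real)
      also have "\<dots> = 2 * std_normal_density z"
        by (simp add: std_normal_density_def real_sqrt_mult real_div_sqrt field_simps)
      finally have "gamma_kernel (1 / 2) (z\<^sup>2 / 2) / Gamma (1 / 2) * z = 2 * std_normal_density z" .
      then have *: "ennreal (gamma_kernel (1 / 2) (z\<^sup>2 / 2) / Gamma (1 / 2)) * ennreal z = ennreal (std_normal_density z) + ennreal (std_normal_density z)"
        using True by (subst ennreal_mult[symmetric]) (auto simp: Gamma_one_half_real simp flip: ennreal_plus)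
      then have "?f z + ?f z = (ennreal (gamma_kernel (1 / 2) (z\<^sup>2 / 2) / Gamma (1 / 2)) * h (z\<^sup>2 / 2)) * ennreal z"
        by (simp only: distrib_right[symmetric] *[symmetric]) (simp only: mult_ac)
      then show ?thesis using True by simp
    qed (use z in auto)
  qed
  also have "\<dots> = (\<integral>\<^sup>+w. (ennreal (gamma_kernel (1 / 2) w / Gamma (1 / 2)) * h w) * indicator {0..} w \<partial>lborel)"
    by (rule nn_integral_half_square_substitution) measurable
  also have "\<dots> = (\<integral>\<^sup>+w. ennreal (gamma_kernel (1 / 2) w / Gamma (1 / 2)) * h w \<partial>lborel)"
    by (intro nn_integral_cong) (auto simp: gamma_kernel_def split: split_indicator)
  also have "\<dots> = (\<integral>\<^sup>+w. h w \<partial>gamma_distr (1 / 2))"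
    unfolding gamma_distr_def by (subst nn_integral_density) auto
  finally show ?thesis .
qed

text \<open>The rotation is split into two affine substitutions in one variable each, with Fubini in
  between. Their Jacobians \<open>1 / c\<close> and \<open>c\<close> cancel, and \<open>rot\<close>
  is the invariance of the Euclidean norm in the exponent.\<close>

lemma nn_integral_std_normal_rotation:
  fixes c s :: real
  assumes cs: "c\<^sup>2 + s\<^sup>2 = 1" "c > 0" and [measurable]: "H \<in> borel_measurable (borel \<Otimes>\<^sub>M borel)"
  shows "(\<integral>\<^sup>+z. \<integral>\<^sup>+a. H (c * a + s * z, c * z - s * a) \<partial>std_normal_distribution \<partial>std_normal_distribution)
       = (\<integral>\<^sup>+a. \<integral>\<^sup>+b. H (a, b) \<partial>std_normal_distribution \<partial>std_normal_distribution)"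
proof -
  define \<phi> where "\<phi> = std_normal_density"
  have [measurable]: "\<phi> \<in> borel_measurable borel" by (simp add: \<phi>_def)
  have [simp]: "\<phi> x \<ge> 0" for x by (simp add: \<phi>_def)
  have rot: "\<phi> ((u - s * z) / c) * \<phi> z = \<phi> u * \<phi> ((z - s * u) / c)" for u z
  proof -
    have "((u - s * z) / c)\<^sup>2 + z\<^sup>2 = u\<^sup>2 + ((z - s * u) / c)\<^sup>2"
    proof -
      have "c\<^sup>2 * (((u - s * z) / c)\<^sup>2 + z\<^sup>2) = (u - s * z)\<^sup>2 + c\<^sup>2 * z\<^sup>2"
        using cs(2) by (simp add: power_divide distrib_left)
      also have "\<dots> = c\<^sup>2 * u\<^sup>2 + (z - s * u)\<^sup>2"
        using cs(1) by algebra
      also have "\<dots> = c\<^sup>2 * (u\<^sup>2 + ((z - s * u) / c)\<^sup>2)"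
        using cs(2) by (simp add: power_divide distrib_left)
      finally show ?thesis using cs(2) by simp
    qed
    then show ?thesis
      by (simp add: \<phi>_def std_normal_density_def exp_add[symmetric] add_divide_distrib[symmetric])
  qed
  have "(\<integral>\<^sup>+z. \<integral>\<^sup>+a. H (c * a + s * z, c * z - s * a) \<partial>std_normal_distribution \<partial>std_normal_distribution)
      = (\<integral>\<^sup>+z. \<integral>\<^sup>+a. ennreal (\<phi> a * \<phi> z) * H (c * a + s * z, c * z - s * a) \<partial>lborel \<partial>lborel)"
    by (simp add: nn_integral_density \<phi>_def nn_integral_cmult[symmetric] ennreal_mult mult_ac)
  also have "\<dots> = (\<integral>\<^sup>+z. \<integral>\<^sup>+u. ennreal (1 / c) * (ennreal (\<phi> u * \<phi> ((z - s * u) / c)) * H (u, (z - s * u) / c)) \<partial>lborel \<partial>lborel)"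
  proof (rule nn_integral_cong)
    fix z :: real
    have *: "c * (u / c - s * z / c) + s * z = u" "c * z - s * (u / c - s * z / c) = (z - s * u) / c" for u
    proof -
      have "c * z - s * (u / c - s * z / c) = (z * (c\<^sup>2 + s\<^sup>2) - s * u) / c"
        using cs(2) by (simp add: field_simps power2_eq_square)
      then show "c * z - s * (u / c - s * z / c) = (z - s * u) / c"
        by (simp add: cs(1))
    qed (use cs in \<open>simp add: field_simps\<close>)
    have "(\<integral>\<^sup>+a. ennreal (\<phi> a * \<phi> z) * H (c * a + s * z, c * z - s * a) \<partial>lborel) =
      ennreal \<bar>1 / c\<bar> * (\<integral>\<^sup>+u. ennreal (\<phi> (- s * z / c + 1 / c * u) * \<phi> z) *
           H (c * (- s * z / c + 1 / c * u) + s * z, c * z - s * (- s * z / c + 1 / c * u)) \<partial>lborel)"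
      using cs(2) by (subst nn_integral_real_affine[where c = "1 / c" and t = "- s * z / c"]) auto
    also have "\<dots> = ennreal (1 / c) * (\<integral>\<^sup>+u. ennreal (\<phi> u * \<phi> ((z - s * u) / c)) * H (u, (z - s * u) / c) \<partial>lborel)"
      using cs(2) rot[unfolded diff_divide_distrib] by (simp add: * diff_divide_distrib)
    also have "\<dots> = (\<integral>\<^sup>+u. ennreal (1 / c) * (ennreal (\<phi> u * \<phi> ((z - s * u) / c)) * H (u, (z - s * u) / c)) \<partial>lborel)"
      by (rule nn_integral_cmult[symmetric]) measurable
    finally show "(\<integral>\<^sup>+a. ennreal (\<phi> a * \<phi> z) * H (c * a + s * z, c * z - s * a) \<partial>lborel) = \<dots>" .
  qed
  also have "\<dots> = (\<integral>\<^sup>+u. \<integral>\<^sup>+z. ennreal (1 / c) * (ennreal (\<phi> u * \<phi> ((z - s * u) / c)) * H (u, (z - s * u) / c)) \<partial>lborel \<partial>lborel)"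
    by (rule lborel_pair.Fubini') measurable
  also have "\<dots> = (\<integral>\<^sup>+u. \<integral>\<^sup>+b. ennreal (\<phi> u * \<phi> b) * H (u, b) \<partial>lborel \<partial>lborel)"
  proof (rule nn_integral_cong)
    fix u :: real
    have "(\<integral>\<^sup>+z. ennreal (1 / c) * (ennreal (\<phi> u * \<phi> ((z - s * u) / c)) * H (u, (z - s * u) / c)) \<partial>lborel)
      = ennreal (1 / c) * (\<integral>\<^sup>+z. ennreal (\<phi> u * \<phi> ((z - s * u) / c)) * H (u, (z - s * u) / c) \<partial>lborel)"
      by (rule nn_integral_cmult) measurable
    also have "\<dots> = ennreal (1 / c) * (ennreal \<bar>c\<bar> * (\<integral>\<^sup>+b. ennreal (\<phi> u * \<phi> b) * H (u, b) \<partial>lborel))"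
      using cs(2) by (subst nn_integral_real_affine[where c = c and t = "s * u"]) auto
    also have "\<dots> = (\<integral>\<^sup>+b. ennreal (\<phi> u * \<phi> b) * H (u, b) \<partial>lborel)"
      using cs(2) by (simp add: mult.assoc[symmetric] ennreal_mult[symmetric])
    finally show "(\<integral>\<^sup>+z. ennreal (1 / c) * (ennreal (\<phi> u * \<phi> ((z - s * u) / c)) * H (u, (z - s * u) / c)) \<partial>lborel) = \<dots>" .
  qed
  also have "\<dots> = (\<integral>\<^sup>+a. \<integral>\<^sup>+b. H (a, b) \<partial>std_normal_distribution \<partial>std_normal_distribution)"
    by (simp add: nn_integral_density \<phi>_def nn_integral_cmult[symmetric] ennreal_mult mult_ac)
  finally show ?thesis .
qed

section \<open>The distribution of the test statistic\<close>

definition scaled_mean :: "nat \<Rightarrow> (nat \<Rightarrow> real) \<Rightarrow> real" where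
  "scaled_mean n z = (\<Sum>i\<in>{1..n}. z i) / sqrt (real n)"

text \<open>This is the sum of squared deviations from the sample mean, written so that its
  recursion in \<open>n\<close> is a polynomial identity.\<close>

definition centred_sq_sum :: "nat \<Rightarrow> (nat \<Rightarrow> real) \<Rightarrow> real" where
  "centred_sq_sum n z = (\<Sum>i\<in>{1..n}. (z i)\<^sup>2) - (scaled_mean n z)\<^sup>2"

lemma scaled_mean_measurable [measurable]:
  "scaled_mean n \<in> borel_measurable (Pi\<^sub>M {1..n} (\<lambda>_. borel))"
  unfolding scaled_mean_def by measurable

lemma centred_sq_sum_measurable [measurable]:
  "centred_sq_sum n \<in> borel_measurable (Pi\<^sub>M {1..n} (\<lambda>_. borel))"
  unfolding centred_sq_sum_def by measurable

lemma scaled_mean_Suc: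
  assumes "n \<ge> 1"
  shows "scaled_mean (Suc n) (x(Suc n := y)) =
    sqrt (real n / real (Suc n)) * scaled_mean n x + sqrt (1 / real (Suc n)) * y"
  using assms by (simp add: scaled_mean_def real_sqrt_divide field_simps)

text \<open>One step of Helmert's transformation: with \<open>m\<close> the old scaled mean,
  \<open>(c * m + s * y)^2 + (c * y - s * m)^2 = m^2 + y^2\<close>, so the increment is a perfect
  square.\<close>

lemma centred_sq_sum_Suc:
  assumes "n \<ge> 1"
  shows "centred_sq_sum (Suc n) (x(Suc n := y)) = centred_sq_sum n x +
    (sqrt (real n / real (Suc n)) * y - sqrt (1 / real (Suc n)) * scaled_mean n x)\<^sup>2"
proof -
  define c s where "c = sqrt (real n / real (Suc n))" and "s = sqrt (1 / real (Suc n))"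
  have cs: "c\<^sup>2 + s\<^sup>2 = 1"
    by (simp add: c_def s_def add_divide_distrib[symmetric] del: of_nat_Suc)
  have "centred_sq_sum (Suc n) (x(Suc n := y)) =
      (\<Sum>i\<in>{1..n}. (x i)\<^sup>2) + y\<^sup>2 - (c * scaled_mean n x + s * y)\<^sup>2"
    unfolding centred_sq_sum_def scaled_mean_Suc[OF assms] by (simp add: c_def s_def)
  also have "\<dots> = centred_sq_sum n x + (c * y - s * scaled_mean n x)\<^sup>2"
    unfolding centred_sq_sum_def using cs by algebra
  finally show ?thesis by (simp only: c_def s_def)
qed

interpretation std_normal: prob_space std_normal_distribution
  by (rule prob_space_normal_density) simp

interpretation std_normal_product: product_sigma_finite "\<lambda>_ :: nat. std_normal_distribution"
  by unfold_locales

lemma sets_PiM_std_normal [measurable_cong]: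
  "sets (Pi\<^sub>M I (\<lambda>_ :: nat. std_normal_distribution)) = sets (Pi\<^sub>M I (\<lambda>_. borel))"
  by (rule sets_PiM_cong) auto

text \<open>The law \<open>G\<close> of half the centred sum of squares is a parameter, so that one
  step serves both the point mass at sample size 1 and the Gamma laws afterwards. The added
  independent half square contributes \<open>gamma_distr (1 / 2)\<close>.\<close>

lemma nn_integral_sample_step:
  fixes G :: "real measure"
  assumes "n \<ge> 1" "sigma_finite_measure G" and [measurable_cong]: "sets G = sets borel"
    and IH: "\<And>h. h \<in> borel_measurable (borel \<Otimes>\<^sub>M borel) \<Longrightarrow>
      (\<integral>\<^sup>+z. h (scaled_mean n z, centred_sq_sum n z / 2) \<partial>Pi\<^sub>M {1..n} (\<lambda>_. std_normal_distribution)) =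
      (\<integral>\<^sup>+a. \<integral>\<^sup>+r. h (a, r) \<partial>G \<partial>std_normal_distribution)"
    and [measurable]: "h \<in> borel_measurable (borel \<Otimes>\<^sub>M borel)"
  shows "(\<integral>\<^sup>+z. h (scaled_mean (Suc n) z, centred_sq_sum (Suc n) z / 2) \<partial>Pi\<^sub>M {1..Suc n} (\<lambda>_. std_normal_distribution)) =
      (\<integral>\<^sup>+a. \<integral>\<^sup>+w. \<integral>\<^sup>+r. h (a, r + w) \<partial>G \<partial>gamma_distr (1 / 2) \<partial>std_normal_distribution)"
proof -
  interpret G: sigma_finite_measure G by fact
  define c s where "c = sqrt (real n / real (Suc n))" and "s = sqrt (1 / real (Suc n))"
  have cs: "c\<^sup>2 + s\<^sup>2 = 1" "c > 0"
    using assms(1) by (simp_all add: c_def s_def add_divide_distrib[symmetric] del: of_nat_Suc)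
  have ins: "{1..Suc n} = insert (Suc n) {1..n}" by auto
  have "(\<integral>\<^sup>+z. h (scaled_mean (Suc n) z, centred_sq_sum (Suc n) z / 2) \<partial>Pi\<^sub>M {1..Suc n} (\<lambda>_. std_normal_distribution))
     = (\<integral>\<^sup>+y. \<integral>\<^sup>+x. h (scaled_mean (Suc n) (x(Suc n := y)), centred_sq_sum (Suc n) (x(Suc n := y)) / 2)
          \<partial>Pi\<^sub>M {1..n} (\<lambda>_. std_normal_distribution) \<partial>std_normal_distribution)"
    unfolding ins
  proof (rule std_normal_product.product_nn_integral_insert_rev)
    show "(\<lambda>z. h (scaled_mean (Suc n) z, centred_sq_sum (Suc n) z / 2))
        \<in> borel_measurable (Pi\<^sub>M (insert (Suc n) {1..n}) (\<lambda>_. std_normal_distribution))"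
      unfolding ins[symmetric] by measurable
  qed auto
  also have "\<dots> = (\<integral>\<^sup>+y. \<integral>\<^sup>+x. (\<lambda>p. h (c * fst p + s * y, snd p + (c * y - s * fst p)\<^sup>2 / 2)) (scaled_mean n x, centred_sq_sum n x / 2)
          \<partial>Pi\<^sub>M {1..n} (\<lambda>_. std_normal_distribution) \<partial>std_normal_distribution)"
    unfolding scaled_mean_Suc[OF assms(1)] centred_sq_sum_Suc[OF assms(1)]
    by (simp add: c_def s_def add_divide_distrib del: of_nat_Suc)
  also have "\<dots> = (\<integral>\<^sup>+y. \<integral>\<^sup>+a. \<integral>\<^sup>+r. h (c * a + s * y, r + (c * y - s * a)\<^sup>2 / 2) \<partial>G \<partial>std_normal_distribution \<partial>std_normal_distribution)"
    by (rule nn_integral_cong, subst IH) simp_all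
  also have "\<dots> = (\<integral>\<^sup>+y. \<integral>\<^sup>+a. (\<lambda>p. \<integral>\<^sup>+r. h (fst p, r + (snd p)\<^sup>2 / 2) \<partial>G) (c * a + s * y, c * y - s * a) \<partial>std_normal_distribution \<partial>std_normal_distribution)"
    by simp
  also have "\<dots> = (\<integral>\<^sup>+a. \<integral>\<^sup>+b. (\<lambda>p. \<integral>\<^sup>+r. h (fst p, r + (snd p)\<^sup>2 / 2) \<partial>G) (a, b) \<partial>std_normal_distribution \<partial>std_normal_distribution)"
    by (rule nn_integral_std_normal_rotation[OF cs]) measurable
  also have "\<dots> = (\<integral>\<^sup>+a. \<integral>\<^sup>+b. (\<lambda>w. \<integral>\<^sup>+r. h (a, r + w) \<partial>G) (b\<^sup>2 / 2) \<partial>std_normal_distribution \<partial>std_normal_distribution)"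
    by simp
  also have "\<dots> = (\<integral>\<^sup>+a. \<integral>\<^sup>+w. \<integral>\<^sup>+r. h (a, r + w) \<partial>G \<partial>gamma_distr (1 / 2) \<partial>std_normal_distribution)"
    by (intro nn_integral_cong nn_integral_std_normal_half_square) measurable
  finally show ?thesis .
qed

text \<open>The rank-one case of Cochran's theorem, by induction on the sample size: a rotation of the
  scaled mean and the new observation yields the new scaled mean and the increment of the sum of squares.\<close>

lemma nn_integral_sample:
  assumes "n \<ge> 2" and "h \<in> borel_measurable (borel \<Otimes>\<^sub>M borel)"
  shows "(\<integral>\<^sup>+z. h (scaled_mean n z, centred_sq_sum n z / 2) \<partial>Pi\<^sub>M {1..n} (\<lambda>_. std_normal_distribution)) =
      (\<integral>\<^sup>+a. \<integral>\<^sup>+r. h (a, r) \<partial>gamma_distr ((real n - 1) / 2) \<partial>std_normal_distribution)"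
  using assms
proof (induction n arbitrary: h rule: nat_induct_at_least)
  case base
  \<comment> \<open>For a single observation the scaled mean is the observation itself and the
    centred sum of squares is 0; one step from there gives shape \<open>1 / 2\<close> at sample size
    2.\<close>
  have "(\<integral>\<^sup>+z. h (scaled_mean 1 z, centred_sq_sum 1 z / 2) \<partial>Pi\<^sub>M {1..1} (\<lambda>_. std_normal_distribution)) =
      (\<integral>\<^sup>+a. \<integral>\<^sup>+r. h (a, r) \<partial>return borel 0 \<partial>std_normal_distribution)"
    if [measurable]: "h \<in> borel_measurable (borel \<Otimes>\<^sub>M borel)" for h
    by (simp add: scaled_mean_def centred_sq_sum_def nn_integral_return
        std_normal_product.product_nn_integral_singleton[where f = "\<lambda>x. h (x, 0)"])
  moreover have "sigma_finite_measure (return borel (0 :: real))"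
    by (intro prob_space_imp_sigma_finite prob_space_return) auto
  ultimately show ?case
    using nn_integral_sample_step[of 1 "return borel 0" h] base
    by (simp add: nn_integral_return numeral_2_eq_2)
next
  case (Suc n)
  note [measurable] = Suc.prems
  have "prob_space (gamma_distr ((real n - 1) / 2))"
    using Suc.hyps by (intro prob_space_gamma_distr) auto
  then have "(\<integral>\<^sup>+z. h (scaled_mean (Suc n) z, centred_sq_sum (Suc n) z / 2) \<partial>Pi\<^sub>M {1..Suc n} (\<lambda>_. std_normal_distribution)) =
      (\<integral>\<^sup>+a. \<integral>\<^sup>+w. \<integral>\<^sup>+r. h (a, r + w) \<partial>gamma_distr ((real n - 1) / 2) \<partial>gamma_distr (1 / 2) \<partial>std_normal_distribution)"
    using Suc by (intro nn_integral_sample_step prob_space_imp_sigma_finite) auto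
  also have "\<dots> = (\<integral>\<^sup>+a. \<integral>\<^sup>+v. h (a, v) \<partial>gamma_distr ((real n - 1) / 2 + 1 / 2) \<partial>std_normal_distribution)"
    using Suc.hyps by (intro nn_integral_cong gamma_distr_convolution) auto
  finally show ?case by (simp add: diff_divide_distrib add_divide_distrib)
qed

text \<open>Mean and scale cancel, and the two factors \<open>n - 1\<close> cancel each other. In a
  degenerate sample with zero variance both sides equal 0, since division by 0 yields 0.\<close>

lemma Ustat_standardized:
  assumes "n \<ge> 2" "\<sigma> > 0" and z: "\<And>i. z i = (X i j \<omega> - mu0 j) / \<sigma>"
  shows "Ustat X n mu0 j \<omega> = real n * ln (1 + (scaled_mean n z)\<^sup>2 / centred_sq_sum n z)"
proof -
  define S where "S = (\<Sum>i\<in>{1..n}. z i)"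
  have X: "X i j \<omega> = mu0 j + \<sigma> * z i" for i
    using assms(2) by (simp add: z)
  have xb: "xbar X n j \<omega> = mu0 j + \<sigma> * (S / real n)"
    using assms(1) by (simp add: xbar_def X sum.distrib S_def sum_distrib_left[symmetric] add_divide_distrib)
  have "(\<Sum>i\<in>{1..n}. (X i j \<omega> - xbar X n j \<omega>)\<^sup>2) = \<sigma>\<^sup>2 * (\<Sum>i\<in>{1..n}. (z i - S / real n)\<^sup>2)"
    unfolding sum_distrib_left
    by (intro sum.cong refl) (simp add: X xb power_mult_distrib[symmetric] algebra_simps)
  also have "(\<Sum>i\<in>{1..n}. (z i - S / real n)\<^sup>2) = (\<Sum>i\<in>{1..n}. (z i)\<^sup>2) - S\<^sup>2 / real n"
    using assms(1)
    by (simp add: power2_diff sum.distrib sum_subtractf sum_distrib_left[symmetric] sum_distrib_right[symmetric]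
          S_def[symmetric] sum_divide_distrib[symmetric] power_divide del: One_nat_def)
       (simp add: field_simps power2_eq_square)
  also have "\<dots> = centred_sq_sum n z"
    by (simp add: centred_sq_sum_def scaled_mean_def S_def power_divide)
  finally have sv: "svar X n j \<omega> = \<sigma>\<^sup>2 * centred_sq_sum n z / (real n - 1)"
    by (simp add: svar_def)
  have "svar X n j \<omega> \<ge> 0"
    using assms(1) by (auto simp: svar_def intro!: divide_nonneg_nonneg sum_nonneg)
  then have "(tstat X n mu0 j \<omega>)\<^sup>2 = real n * (\<sigma> * (S / real n))\<^sup>2 / svar X n j \<omega>"
    by (simp add: tstat_def xb power_divide power_mult_distrib)
  also have "\<dots> / (real n - 1) = (scaled_mean n z)\<^sup>2 / centred_sq_sum n z"
    using assms(1,2)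
    by (simp add: sv scaled_mean_def S_def[symmetric] power_divide power_mult_distrib power2_eq_square del: One_nat_def)
  finally show ?thesis
    by (simp add: Ustat_def)
qed

lemma (in prob_space) nn_integral_Ustat:
  assumes n: "n \<ge> 2" and "\<sigma> > 0"
    and ind: "indep_vars (\<lambda>_. borel) (\<lambda>i. X i j) {1..n}"
    and X: "\<And>i. i \<in> {1..n} \<Longrightarrow> distributed M lborel (X i j) (\<lambda>x. ennreal (normal_density (mu0 j) \<sigma> x))"
    and [measurable]: "F \<in> borel_measurable borel"
  shows "(\<integral>\<^sup>+\<omega>. F (Ustat X n mu0 j \<omega>) \<partial>M) =
    (\<integral>\<^sup>+w. \<integral>\<^sup>+r. F (real n * ln (1 + w / r)) \<partial>gamma_distr ((real n - 1) / 2) \<partial>gamma_distr (1 / 2))"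
proof -
  interpret gam: prob_space "gamma_distr ((real n - 1) / 2)"
    using n by (intro prob_space_gamma_distr) auto
  define Z where "Z i \<omega> = (X i j \<omega> - mu0 j) / \<sigma>" for i \<omega>
  have indZ: "indep_vars (\<lambda>_. borel) Z {1..n}"
    using indep_vars_compose2[OF ind, of "\<lambda>_ x. (x - mu0 j) / \<sigma>" "\<lambda>_. borel"] by (simp add: Z_def[abs_def])
  then have [measurable]: "i \<in> {1..n} \<Longrightarrow> Z i \<in> borel_measurable M" for i
    by (auto simp: indep_vars_def2)
  have "distr M borel (Z i) = std_normal_distribution" if "i \<in> {1..n}" for i
  proof -
    have "distributed M lborel (Z i) std_normal_density"
      unfolding Z_def[abs_def]
      using X[OF that] \<open>\<sigma> > 0\<close> normal_standard_normal_convert[of \<sigma> "X i j" "mu0 j"] by simp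
    then show ?thesis
      by (metis distributed_distr_eq_density distr_cong sets_lborel)
  qed
  then have "distr M (Pi\<^sub>M {1..n} (\<lambda>_. borel)) (\<lambda>\<omega>. \<lambda>i\<in>{1..n}. Z i \<omega>) = Pi\<^sub>M {1..n} (\<lambda>_. std_normal_distribution)"
    using indZ n by (subst (asm) indep_vars_iff_distr_eq_PiM') (auto intro!: PiM_cong)
  note distr_Z = this
  \<comment> \<open>The second component stands for half the centred sum of squares, hence the 2 in
    the denominator; dividing \<open>a^2\<close> by it leaves the quotient of two half
    squares.\<close>
  define h where "h p = F (real n * ln (1 + (fst p)\<^sup>2 / (2 * snd p)))" for p :: "real \<times> real"
  have [measurable]: "h \<in> borel_measurable (borel \<Otimes>\<^sub>M borel)" unfolding h_def by measurable
  have "(\<integral>\<^sup>+\<omega>. F (Ustat X n mu0 j \<omega>) \<partial>M) =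
     (\<integral>\<^sup>+\<omega>. (\<lambda>z. h (scaled_mean n z, centred_sq_sum n z / 2)) (\<lambda>i\<in>{1..n}. Z i \<omega>) \<partial>M)"
  proof (rule nn_integral_cong)
    fix \<omega>
    have "scaled_mean n (\<lambda>i\<in>{1..n}. Z i \<omega>) = scaled_mean n (\<lambda>i. Z i \<omega>)"
         "centred_sq_sum n (\<lambda>i\<in>{1..n}. Z i \<omega>) = centred_sq_sum n (\<lambda>i. Z i \<omega>)"
      by (simp_all add: scaled_mean_def centred_sq_sum_def)
    then show "F (Ustat X n mu0 j \<omega>) = (\<lambda>z. h (scaled_mean n z, centred_sq_sum n z / 2)) (\<lambda>i\<in>{1..n}. Z i \<omega>)"
      using Ustat_standardized[of n \<sigma> "\<lambda>i. Z i \<omega>" X j \<omega> mu0] assms by (simp add: h_def Z_def)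
  qed
  also have "\<dots> = (\<integral>\<^sup>+z. h (scaled_mean n z, centred_sq_sum n z / 2) \<partial>distr M (Pi\<^sub>M {1..n} (\<lambda>_. borel)) (\<lambda>\<omega>. \<lambda>i\<in>{1..n}. Z i \<omega>))"
  proof (rule nn_integral_distr[symmetric])
    show "(\<lambda>\<omega>. \<lambda>i\<in>{1..n}. Z i \<omega>) \<in> M \<rightarrow>\<^sub>M Pi\<^sub>M {1..n} (\<lambda>_. borel)"
      by (rule measurable_restrict) measurable
  qed measurable
  also have "\<dots> = (\<integral>\<^sup>+a. \<integral>\<^sup>+r. h (a, r) \<partial>gamma_distr ((real n - 1) / 2) \<partial>std_normal_distribution)"
    unfolding distr_Z by (rule nn_integral_sample[OF n]) measurable
  also have "\<dots> = (\<integral>\<^sup>+a. (\<lambda>w. \<integral>\<^sup>+r. F (real n * ln (1 + w / r)) \<partial>gamma_distr ((real n - 1) / 2)) (a\<^sup>2 / 2) \<partial>std_normal_distribution)"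
    by (simp add: h_def)
  also have "\<dots> = (\<integral>\<^sup>+w. \<integral>\<^sup>+r. F (real n * ln (1 + w / r)) \<partial>gamma_distr ((real n - 1) / 2) \<partial>gamma_distr (1 / 2))"
    by (rule nn_integral_std_normal_half_square) measurable
  finally show ?thesis .
qed

section \<open>Moments from the Laplace transform\<close>

lemma powr_le_exp:
  fixes x p \<eta> :: real
  assumes "x \<ge> 0" "p > 0" "\<eta> > 0"
  shows "x powr p \<le> (p / \<eta>) powr p * exp (\<eta> * x)"
proof -
  have "\<eta> * x / p \<le> exp (\<eta> * x / p)"
    using exp_ge_add_one_self[of "\<eta> * x / p"] by linarith
  then have "(\<eta> * x / p) powr p \<le> exp (\<eta> * x / p) powr p"
    using assms by (intro powr_mono2) auto
  also have "\<dots> = exp (\<eta> * x)"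
    using assms by (simp add: powr_def)
  finally have "(p / \<eta>) powr p * (\<eta> * x / p) powr p \<le> (p / \<eta>) powr p * exp (\<eta> * x)"
    by (intro mult_left_mono) auto
  moreover have "(p / \<eta>) powr p * (\<eta> * x / p) powr p = x powr p"
    using assms by (simp add: powr_mult[symmetric])
  ultimately show ?thesis by simp
qed

lemma power_le_exp:
  fixes \<eta> :: real
  assumes "\<eta> > 0"
  shows "\<exists>C. \<forall>x\<ge>0. x ^ k \<le> C * exp (\<eta> * x)"
proof (cases "k = 0")
  case False
  have "x ^ k \<le> (real k / \<eta>) powr real k * exp (\<eta> * x)" if "x \<ge> 0" for x :: real
    using powr_le_exp[OF that, of "real k" \<eta>] assms that False
    by (cases "x = 0") (auto simp: powr_realpow)
  then show ?thesis by blast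
qed (use assms in \<open>auto intro!: exI[of _ 1] mult_nonneg_nonneg\<close>)

text \<open>Supplies the majorant for differentiating under the expectation. Convexity of the
  exponential gives \<open>exp v - exp u \<le> (v - u) * exp v\<close>, and both exponents are at
  most \<open>(\<bar>a\<bar> + \<bar>h\<bar>) * x\<close>.\<close>

lemma exp_diff_quotient_le:
  fixes a h x :: real
  assumes "h \<noteq> 0" "x \<ge> 0"
  shows "\<bar>(exp (- (a + h) * x) - exp (- a * x)) / h\<bar> \<le> x * exp ((\<bar>a\<bar> + \<bar>h\<bar>) * x)"
proof -
  have le: "exp v - exp u \<le> (v - u) * exp v" if "u \<le> v" for u v :: real
  proof -
    have "1 - (v - u) \<le> exp (- (v - u))" using exp_ge_add_one_self[of "- (v - u)"] by linarith
    then have "exp v * (1 - (v - u)) \<le> exp v * exp (- (v - u))" by (intro mult_left_mono) auto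
    also have "\<dots> = exp u" by (simp add: exp_add[symmetric])
    finally show ?thesis by (simp add: algebra_simps)
  qed
  have abs_le: "\<bar>exp v - exp u\<bar> \<le> \<bar>v - u\<bar> * exp (max u v)" for u v :: real
    using le[of u v] le[of v u] by (cases "u \<le> v") (auto simp: max_def)
  have "\<bar>exp (- (a + h) * x) - exp (- a * x)\<bar> \<le> \<bar>(- (a + h) * x) - (- a * x)\<bar> * exp (max (- a * x) (- (a + h) * x))"
    by (rule abs_le)
  also have "\<bar>(- (a + h) * x) - (- a * x)\<bar> = \<bar>h\<bar> * x"
    using assms by (simp add: algebra_simps abs_mult)
  also have "\<bar>h\<bar> * x * exp (max (- a * x) (- (a + h) * x)) \<le> \<bar>h\<bar> * x * exp ((\<bar>a\<bar> + \<bar>h\<bar>) * x)"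
  proof (rule mult_left_mono)
    have "- a * x \<le> (\<bar>a\<bar> + \<bar>h\<bar>) * x" "- (a + h) * x \<le> (\<bar>a\<bar> + \<bar>h\<bar>) * x"
      using assms(2) by (intro mult_right_mono; simp)+
    then show "exp (max (- a * x) (- (a + h) * x)) \<le> exp ((\<bar>a\<bar> + \<bar>h\<bar>) * x)" by simp
  qed (use assms in simp)
  finally show ?thesis
    using assms by (simp add: field_simps)
qed

text \<open>Half of the spare room \<open>\<delta> - \<bar>s\<bar>\<close> is spent on absorbing the
  power of \<open>L\<close> into an exponential; the total exponent
  \<open>\<bar>s\<bar> + \<eta>\<close> is still below \<open>\<delta>\<close>.\<close>

lemma (in prob_space) laplace_moment_integrable:
  assumes [measurable]: "L \<in> borel_measurable M" and L: "\<And>\<omega>. L \<omega> \<ge> (0 :: real)"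
    and int: "\<And>s. \<bar>s\<bar> < \<delta> \<Longrightarrow> integrable M (\<lambda>\<omega>. exp (- s * L \<omega>))"
    and s: "\<bar>s\<bar> < \<delta>"
  shows "integrable M (\<lambda>\<omega>. L \<omega> ^ k * exp (s * L \<omega>))"
proof -
  define \<eta> where "\<eta> = (\<delta> - \<bar>s\<bar>) / 2"
  have "\<eta> > 0" using s by (simp add: \<eta>_def)
  obtain C where C: "\<And>x. x \<ge> 0 \<Longrightarrow> x ^ k \<le> C * exp (\<eta> * x)"
    using power_le_exp[of \<eta> k] \<open>\<eta> > 0\<close> by auto
  have "integrable M (\<lambda>\<omega>. C * exp (- (- (\<eta> + \<bar>s\<bar>)) * L \<omega>))"
    using s by (intro integrable_mult_right int) (auto simp: \<eta>_def field_simps)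
  then show ?thesis
  proof (rule Bochner_Integration.integrable_bound)
    show "AE \<omega> in M. norm (L \<omega> ^ k * exp (s * L \<omega>)) \<le> norm (C * exp (- (- (\<eta> + \<bar>s\<bar>)) * L \<omega>))"
    proof (rule AE_I2)
      fix \<omega>
      have "L \<omega> ^ k * exp (s * L \<omega>) \<le> (C * exp (\<eta> * L \<omega>)) * exp (\<bar>s\<bar> * L \<omega>)"
        using C[OF L] L order_trans[OF zero_le_power[OF L] C[OF L]]
        by (intro mult_mono) (auto intro!: mult_right_mono)
      also have "\<dots> = C * exp (- (- (\<eta> + \<bar>s\<bar>)) * L \<omega>)"
        by (simp add: exp_add[symmetric] algebra_simps)
      finally show "norm (L \<omega> ^ k * exp (s * L \<omega>)) \<le> norm (C * exp (- (- (\<eta> + \<bar>s\<bar>)) * L \<omega>))"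
        using L by auto
    qed
  qed measurable
qed

text \<open>Dominated convergence along sequences of increments, discarding the finitely many that
  exceed \<open>\<eta>\<close> so that one majorant serves the rest. The power \<open>k\<close> is
  free because the lemma is applied first with 0 and then with 1.\<close>

lemma (in prob_space) has_real_derivative_laplace:
  assumes [measurable]: "L \<in> borel_measurable M" and L: "\<And>\<omega>. L \<omega> \<ge> (0 :: real)"
    and int: "\<And>s. \<bar>s\<bar> < \<delta> \<Longrightarrow> integrable M (\<lambda>\<omega>. exp (- s * L \<omega>))"
    and s: "\<bar>s\<bar> < \<delta>"
  shows "((\<lambda>s. expectation (\<lambda>\<omega>. L \<omega> ^ k * exp (- s * L \<omega>))) has_real_derivative
          - expectation (\<lambda>\<omega>. L \<omega> ^ Suc k * exp (- s * L \<omega>))) (at s)"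
proof -
  define \<eta> where "\<eta> = (\<delta> - \<bar>s\<bar>) / 2"
  have "\<eta> > 0" using s by (simp add: \<eta>_def)
  let ?q = "\<lambda>h \<omega>. L \<omega> ^ k * ((exp (- (s + h) * L \<omega>) - exp (- s * L \<omega>)) / h)"
  have "((\<lambda>h. expectation (?q h)) \<longlongrightarrow> expectation (\<lambda>\<omega>. L \<omega> ^ k * (- L \<omega> * exp (- s * L \<omega>)))) (at 0)"
    unfolding tendsto_at_iff_sequentially comp_def
  proof safe
    fix X :: "nat \<Rightarrow> real" assume X: "\<forall>i. X i \<in> UNIV - {0}" "X \<longlonglongrightarrow> 0"
    have "\<forall>\<^sub>F i in sequentially. dist (X i) 0 < \<eta>"
      using tendstoD[OF X(2) \<open>\<eta> > 0\<close>] .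
    then obtain N where N: "\<And>i. i \<ge> N \<Longrightarrow> \<bar>X i\<bar> < \<eta>"
      by (auto simp: eventually_sequentially)
    have "(\<lambda>i. expectation (?q (X (i + N)))) \<longlonglongrightarrow> expectation (\<lambda>\<omega>. L \<omega> ^ k * (- L \<omega> * exp (- s * L \<omega>)))"
    proof (rule integral_dominated_convergence)
      show "integrable M (\<lambda>\<omega>. L \<omega> ^ Suc k * exp ((\<bar>s\<bar> + \<eta>) * L \<omega>))"
        using s \<open>\<eta> > 0\<close> by (intro laplace_moment_integrable[where \<delta> = \<delta>] int L) (auto simp: \<eta>_def field_simps)
      show "AE \<omega> in M. (\<lambda>i. ?q (X (i + N)) \<omega>) \<longlonglongrightarrow> L \<omega> ^ k * (- L \<omega> * exp (- s * L \<omega>))"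
      proof (rule AE_I2)
        fix \<omega>
        have "((\<lambda>s. exp (- s * L \<omega>)) has_real_derivative - L \<omega> * exp (- s * L \<omega>)) (at s)"
          by (auto intro!: derivative_eq_intros)
        then have "((\<lambda>h. (exp (- (s + h) * L \<omega>) - exp (- s * L \<omega>)) / h) \<longlongrightarrow> - L \<omega> * exp (- s * L \<omega>)) (at 0)"
          by (simp only: DERIV_def)
        then have "(\<lambda>i. (exp (- (s + X i) * L \<omega>) - exp (- s * L \<omega>)) / X i) \<longlonglongrightarrow> - L \<omega> * exp (- s * L \<omega>)"
          using X unfolding tendsto_at_iff_sequentially comp_def by auto
        then show "(\<lambda>i. ?q (X (i + N)) \<omega>) \<longlonglongrightarrow> L \<omega> ^ k * (- L \<omega> * exp (- s * L \<omega>))"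
          by (intro tendsto_mult tendsto_const LIMSEQ_ignore_initial_segment)
      qed
      show "AE \<omega> in M. norm (?q (X (i + N)) \<omega>) \<le> L \<omega> ^ Suc k * exp ((\<bar>s\<bar> + \<eta>) * L \<omega>)" for i
      proof (rule AE_I2)
        fix \<omega>
        have "norm (?q (X (i + N)) \<omega>) = L \<omega> ^ k * \<bar>(exp (- (s + X (i + N)) * L \<omega>) - exp (- s * L \<omega>)) / X (i + N)\<bar>"
          using L by (simp add: abs_mult)
        also have "\<dots> \<le> L \<omega> ^ k * (L \<omega> * exp ((\<bar>s\<bar> + \<bar>X (i + N)\<bar>) * L \<omega>))"
          using X(1) L by (intro mult_left_mono exp_diff_quotient_le) auto
        also have "\<dots> \<le> L \<omega> ^ k * (L \<omega> * exp ((\<bar>s\<bar> + \<eta>) * L \<omega>))"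
          using N[of "i + N"] L by (intro mult_left_mono) (auto intro!: mult_right_mono)
        finally show "norm (?q (X (i + N)) \<omega>) \<le> L \<omega> ^ Suc k * exp ((\<bar>s\<bar> + \<eta>) * L \<omega>)"
          by (simp add: mult_ac)
      qed
    qed measurable
    then show "(\<lambda>i. expectation (?q (X i))) \<longlonglongrightarrow> expectation (\<lambda>\<omega>. L \<omega> ^ k * (- L \<omega> * exp (- s * L \<omega>)))"
      by (rule LIMSEQ_offset)
  qed
  also have "expectation (\<lambda>\<omega>. L \<omega> ^ k * (- L \<omega> * exp (- s * L \<omega>))) = - expectation (\<lambda>\<omega>. L \<omega> ^ Suc k * exp (- s * L \<omega>))"
    by (simp add: mult_ac flip: Bochner_Integration.integral_minus)
  finally have lim: "((\<lambda>h. expectation (?q h)) \<longlongrightarrow> - expectation (\<lambda>\<omega>. L \<omega> ^ Suc k * exp (- s * L \<omega>))) (at 0)" .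
  have "((\<lambda>h. (expectation (\<lambda>\<omega>. L \<omega> ^ k * exp (- (s + h) * L \<omega>)) - expectation (\<lambda>\<omega>. L \<omega> ^ k * exp (- s * L \<omega>))) / h)
      \<longlongrightarrow> - expectation (\<lambda>\<omega>. L \<omega> ^ Suc k * exp (- s * L \<omega>))) (at 0)"
  proof (rule Lim_transform_eventually[OF lim])
    have "\<forall>\<^sub>F h in at 0. dist h 0 < \<eta>"
      using \<open>\<eta> > 0\<close> by (auto simp: eventually_at)
    then show "\<forall>\<^sub>F h in at 0. expectation (?q h) = (expectation (\<lambda>\<omega>. L \<omega> ^ k * exp (- (s + h) * L \<omega>)) - expectation (\<lambda>\<omega>. L \<omega> ^ k * exp (- s * L \<omega>))) / h"
    proof eventually_elim
      case (elim h)
      have "integrable M (\<lambda>\<omega>. L \<omega> ^ k * exp (- (s + h) * L \<omega>))" "integrable M (\<lambda>\<omega>. L \<omega> ^ k * exp (- s * L \<omega>))"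
        using elim s by (intro laplace_moment_integrable[where \<delta> = \<delta>] int L; auto simp: \<eta>_def field_simps)+
      then show ?case
        by (simp add: right_diff_distrib flip: Bochner_Integration.integral_diff)
    qed
  qed
  then show ?thesis by (simp only: DERIV_def)
qed

text \<open>The identity for nonnegative integrals supplies both finiteness and the value of the
  transform. The derivative \<open>g1\<close> is given on a whole neighbourhood because it is
  differentiated once more, at 0.\<close>

lemma (in prob_space) laplace_moments:
  assumes [measurable]: "L \<in> borel_measurable M" and L: "\<And>\<omega>. L \<omega> \<ge> (0 :: real)" and "\<delta> > 0"
    and g: "\<And>s. \<bar>s\<bar> < \<delta> \<Longrightarrow> (\<integral>\<^sup>+\<omega>. ennreal (exp (- s * L \<omega>)) \<partial>M) = ennreal (g s)"
    and g_nonneg: "\<And>s. \<bar>s\<bar> < \<delta> \<Longrightarrow> g s \<ge> 0"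
    and g1: "\<And>s. \<bar>s\<bar> < \<delta> \<Longrightarrow> (g has_real_derivative g1 s) (at s)"
    and g2: "(g1 has_real_derivative g2) (at 0)"
  shows "expectation L = - g1 0" "expectation (\<lambda>\<omega>. (L \<omega>)\<^sup>2) = g2"
proof -
  have int: "integrable M (\<lambda>\<omega>. exp (- s * L \<omega>))" if "\<bar>s\<bar> < \<delta>" for s
    using g[OF that] by (intro integrableI_bounded) auto
  have nhd: "\<forall>\<^sub>F s in nhds (s0 :: real). \<bar>s\<bar> < \<delta>" if "\<bar>s0\<bar> < \<delta>" for s0
    using that by (intro eventually_nhds_in_open[of "{s. \<bar>s\<bar> < \<delta>}", simplified] open_Collect_less continuous_intros) auto
  have E0: "expectation (\<lambda>\<omega>. exp (- s * L \<omega>)) = g s" if "\<bar>s\<bar> < \<delta>" for s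
    using g[OF that] g_nonneg[OF that] by (intro integral_eq_nn_integral[THEN trans]) auto
  have E1: "expectation (\<lambda>\<omega>. L \<omega> * exp (- s * L \<omega>)) = - g1 s" if "\<bar>s\<bar> < \<delta>" for s
  proof -
    have "((\<lambda>s. expectation (\<lambda>\<omega>. exp (- s * L \<omega>))) has_real_derivative
          - expectation (\<lambda>\<omega>. L \<omega> * exp (- s * L \<omega>))) (at s)"
      using has_real_derivative_laplace[OF assms(1) L int that, of 0] by simp
    moreover have "((\<lambda>s. expectation (\<lambda>\<omega>. exp (- s * L \<omega>))) has_real_derivative g1 s) (at s)"
      by (rule DERIV_cong_ev[OF refl eventually_mono[OF nhd[OF that] E0] refl, THEN iffD2, OF _ g1[OF that]])
    ultimately have "- expectation (\<lambda>\<omega>. L \<omega> * exp (- s * L \<omega>)) = g1 s" by (rule DERIV_unique)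
    then show ?thesis by simp
  qed
  show "expectation L = - g1 0" using E1[of 0] \<open>\<delta> > 0\<close> by simp
  have "((\<lambda>s. expectation (\<lambda>\<omega>. L \<omega> * exp (- s * L \<omega>))) has_real_derivative
          - expectation (\<lambda>\<omega>. (L \<omega>)\<^sup>2)) (at 0)"
    using has_real_derivative_laplace[OF assms(1) L int, where s = 0 and k = 1] \<open>\<delta> > 0\<close> by (simp add: power2_eq_square)
  moreover have "((\<lambda>s. expectation (\<lambda>\<omega>. L \<omega> * exp (- s * L \<omega>))) has_real_derivative - g2) (at 0)"
    by (rule DERIV_cong_ev[OF refl eventually_mono[OF nhd E1] refl, THEN iffD2, OF _ _ DERIV_minus[OF g2]])
       (use \<open>\<delta> > 0\<close> in auto)
  ultimately show "expectation (\<lambda>\<omega>. (L \<omega>)\<^sup>2) = g2"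
    using DERIV_unique by force
qed

text \<open>The logarithmic derivative of \<open>g\<close> is a difference of Digamma values. At 0
  the normalisation \<open>g 0 = 1\<close> turns the second derivative into the square of that
  difference plus a difference of trigamma values.\<close>

lemma Gamma_quotient_derivs:
  fixes a b :: real
  assumes "a > 0" "b > 0" "a + s > 0"
  defines "g \<equiv> \<lambda>s. Gamma (a + b) / Gamma a * (Gamma (a + s) / Gamma (a + b + s))"
  shows "(g has_real_derivative g s * (Digamma (a + s) - Digamma (a + b + s))) (at s)"
    and "((\<lambda>s. g s * (Digamma (a + s) - Digamma (a + b + s))) has_real_derivative
      ((Digamma a - Digamma (a + b))\<^sup>2 + (Polygamma 1 a - Polygamma 1 (a + b)))) (at 0)"
proof -
  have D: "(g has_real_derivative g s * (Digamma (a + s) - Digamma (a + b + s))) (at s)" if "a + s > 0" for s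
  proof -
    have pos: "a + b + s > 0" using that assms(2) by simp
    have "a + s \<notin> \<int>\<^sub>\<le>\<^sub>0" "a + b + s \<notin> \<int>\<^sub>\<le>\<^sub>0"
      using that pos by (auto dest: nonpos_Ints_nonpos)
    moreover have "Gamma (a + b + s) \<noteq> 0" "Gamma a \<noteq> 0"
      using less_imp_neq[OF Gamma_real_pos[OF pos]] less_imp_neq[OF Gamma_real_pos[OF assms(1)]] by simp_all
    ultimately show ?thesis
      unfolding g_def by (auto intro!: derivative_eq_intros simp: field_simps)
  qed
  show "(g has_real_derivative g s * (Digamma (a + s) - Digamma (a + b + s))) (at s)"
    by (rule D) fact
  have nz: "a \<notin> \<int>\<^sub>\<le>\<^sub>0" "a + b \<notin> \<int>\<^sub>\<le>\<^sub>0"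
    using assms(1,2) by (auto dest: nonpos_Ints_nonpos)
  have "g 0 = 1"
    using less_imp_neq[OF Gamma_real_pos[of a]] less_imp_neq[OF Gamma_real_pos[of "a + b"]] assms(1,2) by (simp add: g_def)
  then show "((\<lambda>s. g s * (Digamma (a + s) - Digamma (a + b + s))) has_real_derivative
      ((Digamma a - Digamma (a + b))\<^sup>2 + (Polygamma 1 a - Polygamma 1 (a + b)))) (at 0)"
    using D[of 0] nz assms(1) by (auto intro!: derivative_eq_intros simp: power2_eq_square)
qed

text \<open>Matches \<open>Dfun\<close> with the derivatives of the Gamma quotient for
  \<open>b = 1 / 2\<close>: the chain rule halves the trigamma values, and the factor 2 in
  \<open>m2\<close> undoes this.\<close>

lemma Dfun_moments:
  assumes "n \<ge> 2"
  defines "a \<equiv> (real n - 1) / 2"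
  shows "Dfun (real n - 1) = - (Digamma a - Digamma (a + 1 / 2))"
    and "(Dfun (real n - 1))\<^sup>2 - 2 * deriv Dfun (real n - 1) =
       (Digamma a - Digamma (a + 1 / 2))\<^sup>2 + (Polygamma 1 a - Polygamma 1 (a + 1 / 2))"
proof -
  have a: "(real n - 1 + 1) / 2 = a + 1 / 2" "(real n - 1) / 2 = a" "a > 0"
    using assms by (simp_all add: a_def field_simps)
  show D: "Dfun (real n - 1) = - (Digamma a - Digamma (a + 1 / 2))"
    unfolding Dfun_def a by simp
  have "(Dfun has_real_derivative (Polygamma 1 ((x + 1) / 2) / 2 - Polygamma 1 (x / 2) / 2)) (at x)" if "x > 0" for x
  proof -
    have nz: "x / 2 \<notin> \<int>\<^sub>\<le>\<^sub>0" "(x + 1) / 2 \<notin> \<int>\<^sub>\<le>\<^sub>0"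
      using that by (auto dest: nonpos_Ints_nonpos)
    then show ?thesis
      unfolding Dfun_def[abs_def] by (auto intro!: derivative_eq_intros)
  qed
  from this[of "real n - 1"] have "(Dfun has_real_derivative (Polygamma 1 (a + 1 / 2) / 2 - Polygamma 1 a / 2)) (at (real n - 1))"
    using assms(1) unfolding a by simp
  then have "deriv Dfun (real n - 1) = Polygamma 1 (a + 1 / 2) / 2 - Polygamma 1 a / 2"
    by (rule DERIV_imp_deriv)
  then show "(Dfun (real n - 1))\<^sup>2 - 2 * deriv Dfun (real n - 1) =
       (Digamma a - Digamma (a + 1 / 2))\<^sup>2 + (Polygamma 1 a - Polygamma 1 (a + 1 / 2))"
    by (simp add: D power2_eq_square algebra_simps)
qed

lemma Ustat_nonneg:
  assumes "n \<ge> 2"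
  shows "Ustat X n mu0 j \<omega> \<ge> 0"
  using assms by (simp add: Ustat_def)

text \<open>After division by \<open>n\<close> the exponential of the logarithm is a plain power of
  \<open>1 + w / r\<close>, a moment of the Gamma quotient. The range of \<open>s\<close> is
  admissible since \<open>a \<ge> 1 / 2\<close>.\<close>

lemma (in prob_space) Ustat_laplace:
  assumes n: "n \<ge> 2" and "\<sigma> > 0"
    and ind: "indep_vars (\<lambda>_. borel) (\<lambda>i. X i j) {1..n}"
    and X: "\<And>i. i \<in> {1..n} \<Longrightarrow> distributed M lborel (X i j) (\<lambda>x. ennreal (normal_density (mu0 j) \<sigma> x))"
    and s: "\<bar>s\<bar> < 1 / 2"
  defines "a \<equiv> (real n - 1) / 2"
  shows "(\<integral>\<^sup>+\<omega>. ennreal (exp (- s * (Ustat X n mu0 j \<omega> / real n))) \<partial>M) =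
     ennreal (Gamma (a + 1 / 2) / Gamma a * (Gamma (a + s) / Gamma (a + 1 / 2 + s)))"
proof -
  have a: "a \<ge> 1 / 2" using n by (simp add: a_def)
  have "(\<integral>\<^sup>+\<omega>. ennreal (exp (- s * (Ustat X n mu0 j \<omega> / real n))) \<partial>M) =
     (\<integral>\<^sup>+w. \<integral>\<^sup>+r. ennreal (exp (- s * (real n * ln (1 + w / r) / real n))) \<partial>gamma_distr a \<partial>gamma_distr (1 / 2))"
    unfolding a_def by (rule nn_integral_Ustat[where \<sigma> = \<sigma>]) (use assms in auto)
  also have "\<dots> = (\<integral>\<^sup>+w. \<integral>\<^sup>+r. ennreal ((1 + w / r) powr (- s)) \<partial>gamma_distr a \<partial>gamma_distr (1 / 2))"
  proof (rule nn_integral_cong_AE, use AE_gamma_distr_pos in eventually_elim, rule nn_integral_cong_AE, use AE_gamma_distr_pos in eventually_elim)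
    fix w r :: real assume "w > 0" "r > 0"
    then have "1 + w / r > 0" by (simp add: add_pos_pos)
    then show "ennreal (exp (- s * (real n * ln (1 + w / r) / real n))) = ennreal ((1 + w / r) powr (- s))"
      using n by (simp add: powr_def)
  qed
  also have "\<dots> = ennreal (Gamma (a + 1 / 2) / Gamma a * (Gamma (a + s) / Gamma (a + 1 / 2 + s)))"
    using a s by (intro gamma_distr_quotient_moment) auto
  finally show ?thesis .
qed

lemma (in prob_space) Ustat_moments:
  assumes n: "n \<ge> 2" and "\<sigma> > 0"
    and ind: "indep_vars (\<lambda>_. borel) (\<lambda>i. X i j) {1..n}"
    and X: "\<And>i. i \<in> {1..n} \<Longrightarrow> distributed M lborel (X i j) (\<lambda>x. ennreal (normal_density (mu0 j) \<sigma> x))"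
    and U [measurable]: "Ustat X n mu0 j \<in> borel_measurable M"
  shows "expectation (Ustat X n mu0 j) = m1 n"
    and "expectation (\<lambda>\<omega>. (Ustat X n mu0 j \<omega>)\<^sup>2) = m2 n"
    and "p > 0 \<Longrightarrow> integrable M (\<lambda>\<omega>. \<bar>Ustat X n mu0 j \<omega>\<bar> powr p)"
proof -
  define a where "a = (real n - 1) / 2"
  define L where "L \<omega> = Ustat X n mu0 j \<omega> / real n" for \<omega>
  define g where "g s = Gamma (a + 1 / 2) / Gamma a * (Gamma (a + s) / Gamma (a + 1 / 2 + s))" for s
  have a: "a \<ge> 1 / 2" using n by (simp add: a_def)
  have UL: "Ustat X n mu0 j \<omega> = real n * L \<omega>" for \<omega> using n by (simp add: L_def)
  have [measurable]: "L \<in> borel_measurable M" unfolding L_def by measurable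
  have L: "L \<omega> \<ge> 0" for \<omega> unfolding L_def using Ustat_nonneg[OF n] by (auto intro!: divide_nonneg_nonneg)
  have nn: "(\<integral>\<^sup>+\<omega>. ennreal (exp (- s * L \<omega>)) \<partial>M) = ennreal (g s)" if "\<bar>s\<bar> < 1 / 2" for s
    unfolding L_def g_def a_def by (rule Ustat_laplace[where \<sigma> = \<sigma>]) (use assms that in auto)
  have g_nonneg: "g s \<ge> 0" if "\<bar>s\<bar> < 1 / 2" for s
    using a that unfolding g_def by (intro mult_nonneg_nonneg divide_nonneg_nonneg less_imp_le[OF Gamma_real_pos]) auto
  have d: "(g has_real_derivative g s * (Digamma (a + s) - Digamma (a + 1 / 2 + s))) (at s)" if "\<bar>s\<bar> < 1 / 2" for s
    unfolding g_def using a that by (intro Gamma_quotient_derivs(1)) auto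
  have d2: "((\<lambda>s. g s * (Digamma (a + s) - Digamma (a + 1 / 2 + s))) has_real_derivative
      ((Digamma a - Digamma (a + 1 / 2))\<^sup>2 + (Polygamma 1 a - Polygamma 1 (a + 1 / 2)))) (at 0)"
    unfolding g_def using a by (intro Gamma_quotient_derivs(2)[where s = 0]) auto
  have "g 0 = 1"
    using less_imp_neq[OF Gamma_real_pos[of a]] less_imp_neq[OF Gamma_real_pos[of "a + 1 / 2"]] a by (simp add: g_def)
  note moments = laplace_moments[of L "1 / 2" g, OF _ L _ nn g_nonneg d d2]
  have "expectation L = Dfun (real n - 1)"
    using moments(1) \<open>g 0 = 1\<close> Dfun_moments(1)[OF n] by (simp add: a_def)
  then show "expectation (Ustat X n mu0 j) = m1 n"
    by (simp add: UL[abs_def] m1_def)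
  have "expectation (\<lambda>\<omega>. (L \<omega>)\<^sup>2) = (Dfun (real n - 1))\<^sup>2 - 2 * deriv Dfun (real n - 1)"
    using moments(2) Dfun_moments(2)[OF n] by (simp add: a_def)
  then show "expectation (\<lambda>\<omega>. (Ustat X n mu0 j \<omega>)\<^sup>2) = m2 n"
    by (simp add: UL[abs_def] m2_def power_mult_distrib)
  show "integrable M (\<lambda>\<omega>. \<bar>Ustat X n mu0 j \<omega>\<bar> powr p)" if "p > 0"
  proof -
    \<comment> \<open>Any point of the open interval from \<open>-1 / 2\<close> to 0 would do: a
      negative argument is a positive exponential moment of \<open>L\<close>, and that dominates
      every power.\<close>
    have "integrable M (\<lambda>\<omega>. exp (- (- (1 / 4)) * L \<omega>))"
      using nn[of "- (1 / 4)"] by (intro integrableI_bounded) auto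
    then have "integrable M (\<lambda>\<omega>. real n powr p * ((p / (1 / 4)) powr p * exp (1 / 4 * L \<omega>)))"
      by (intro integrable_mult_right) simp
    then show ?thesis
    proof (rule Bochner_Integration.integrable_bound)
      show "AE \<omega> in M. norm (\<bar>Ustat X n mu0 j \<omega>\<bar> powr p) \<le> norm (real n powr p * ((p / (1 / 4)) powr p * exp (1 / 4 * L \<omega>)))"
        using powr_le_exp[OF L that, of "1 / 4"] L
        by (auto simp: UL abs_mult powr_mult intro!: mult_left_mono)
    qed measurable
  qed
qed

section \<open>Covariance inequalities under mixing\<close>

text \<open>Rounding a variable down to multiples of \<open>1 / n\<close> writes it as the average
  of the indicators of \<open>k / n \<le> Z\<close>. The covariance of two such averages is the mean
  of \<open>n^2\<close> covariances of events, each at most \<open>a\<close>, so no constant is lost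
  in the limit.\<close>

lemma (in prob_space) covariance_unit_interval:
  assumes F: "subalgebra M F" and G: "subalgebra M G"
    and dep: "\<And>A B. A \<in> sets F \<Longrightarrow> B \<in> sets G \<Longrightarrow> \<bar>prob (A \<inter> B) - prob A * prob B\<bar> \<le> a"
    and X [measurable]: "X \<in> borel_measurable F" and Y [measurable]: "Y \<in> borel_measurable G"
    and X01: "\<And>\<omega>. X \<omega> \<in> {0..1}" and Y01: "\<And>\<omega>. Y \<omega> \<in> {0..1 :: real}"
  shows "\<bar>expectation (\<lambda>\<omega>. X \<omega> * Y \<omega>) - expectation X * expectation Y\<bar> \<le> a"
proof -
  define A where "A Z n k = {\<omega> \<in> space M. real k / real n \<le> Z \<omega>}" for Z :: "'a \<Rightarrow> real" and n k :: nat
  define S where "S Z n \<omega> = (\<Sum>k\<in>{1..n}. indicator (A Z n k) \<omega>) / real n" for Z n and \<omega> :: 'a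
  have spF: "space F = space M" "sets F \<subseteq> sets M" and spG: "space G = space M" "sets G \<subseteq> sets M"
    using F G by (auto simp: subalgebra_def)
  have [measurable]: "X \<in> borel_measurable M" "Y \<in> borel_measurable M"
    using measurable_from_subalg[OF F X] measurable_from_subalg[OF G Y] .
  have AF: "A X n k \<in> sets F" for n k
    unfolding A_def spF(1)[symmetric] by measurable
  have AG: "A Y n k \<in> sets G" for n k
    unfolding A_def spG(1)[symmetric] by measurable
  have AM [measurable]: "A X n k \<in> events" "A Y n k \<in> events" for n k
    using AF AG spF spG by blast+
  have S_eq: "S Z n \<omega> = real_of_int \<lfloor>real n * Z \<omega>\<rfloor> / real n"
    if "n > 0" "Z \<omega> \<in> {0..1}" "\<omega> \<in> space M" for Z n \<omega>
  proof -
    have "(\<Sum>k\<in>{1..n}. indicator (A Z n k) \<omega>) = real (card {k \<in> {1..n}. real k / real n \<le> Z \<omega>})"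
      using that(3) by (simp add: A_def indicator_def sum.If_cases Int_def)
    also have "{k \<in> {1..n}. real k / real n \<le> Z \<omega>} = {1..nat \<lfloor>real n * Z \<omega>\<rfloor>}"
    proof -
      have "real n * Z \<omega> \<le> real n" "0 \<le> real n * Z \<omega>" using that by (simp_all add: mult_left_le)
      then have "k \<le> nat \<lfloor>real n * Z \<omega>\<rfloor> \<longleftrightarrow> real k / real n \<le> Z \<omega> \<and> k \<le> n" for k
      proof -
        have "k \<le> nat \<lfloor>real n * Z \<omega>\<rfloor> \<longleftrightarrow> real k \<le> real n * Z \<omega>"
          using \<open>0 \<le> real n * Z \<omega>\<close> by (simp add: le_nat_iff le_floor_iff)
        moreover have "real k \<le> real n * Z \<omega> \<longleftrightarrow> real k / real n \<le> Z \<omega>"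
          using that by (simp add: field_simps)
        moreover have "k \<le> n" if "real k \<le> real n * Z \<omega>"
          using order_trans[OF that \<open>real n * Z \<omega> \<le> real n\<close>] by simp
        ultimately show ?thesis by blast
      qed
      then show ?thesis by (intro set_eqI) (simp only: mem_Collect_eq atLeastAtMost_iff, blast)
    qed
    finally show ?thesis using that by (simp add: S_def)
  qed
  have S_approx: "\<bar>Z \<omega> - S Z n \<omega>\<bar> \<le> 1 / real n" and S01: "S Z n \<omega> \<in> {0..1}"
    if "n > 0" "Z \<omega> \<in> {0..1}" "\<omega> \<in> space M" for Z n \<omega>
  proof -
    have "Z \<omega> - S Z n \<omega> = (real n * Z \<omega> - real_of_int \<lfloor>real n * Z \<omega>\<rfloor>) / real n"
      using that by (simp add: S_eq diff_divide_distrib)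
    moreover have "\<bar>real n * Z \<omega> - real_of_int \<lfloor>real n * Z \<omega>\<rfloor>\<bar> \<le> 1" by linarith
    ultimately show "\<bar>Z \<omega> - S Z n \<omega>\<bar> \<le> 1 / real n" by (simp add: divide_right_mono)
    have "0 \<le> \<lfloor>real n * Z \<omega>\<rfloor>" "real n * Z \<omega> \<le> real n" using that by (auto simp: mult_left_le)
    then have "0 \<le> real_of_int \<lfloor>real n * Z \<omega>\<rfloor>" "real_of_int \<lfloor>real n * Z \<omega>\<rfloor> \<le> real n" by linarith+
    then show "S Z n \<omega> \<in> {0..1}" using that by (simp add: S_eq)
  qed
  \<comment> \<open>The rounding error is \<open>2 / n\<close> for the expectation of the product
    and \<open>2 / n\<close> for the product of the expectations.\<close>
  have main: "\<bar>expectation (\<lambda>\<omega>. X \<omega> * Y \<omega>) - expectation X * expectation Y\<bar> \<le> a + 4 / real n" if n: "n > 0" for n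
  proof -
    have [measurable]: "S X n \<in> borel_measurable M" "S Y n \<in> borel_measurable M"
      unfolding S_def[abs_def] by measurable
    have int: "integrable M X" "integrable M Y" "integrable M (S X n)" "integrable M (S Y n)"
      "integrable M (\<lambda>\<omega>. X \<omega> * Y \<omega>)" "integrable M (\<lambda>\<omega>. S X n \<omega> * S Y n \<omega>)"
      using X01 Y01 S01[OF n X01] S01[OF n Y01]
      by (auto intro!: integrable_const_bound[where B = 1] AE_I2 mult_le_one simp: abs_mult)
    have EX: "\<bar>expectation X - expectation (S X n)\<bar> \<le> 1 / real n"
    proof -
      have "\<bar>expectation (\<lambda>\<omega>. X \<omega> - S X n \<omega>)\<bar> \<le> expectation (\<lambda>\<omega>. 1 / real n)"
        using int S_approx[OF n X01] by (intro integral_abs_bound[THEN order_trans] integral_mono) auto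
      then show ?thesis using int by (simp add: prob_space)
    qed
    have EY: "\<bar>expectation Y - expectation (S Y n)\<bar> \<le> 1 / real n"
    proof -
      have "\<bar>expectation (\<lambda>\<omega>. Y \<omega> - S Y n \<omega>)\<bar> \<le> expectation (\<lambda>\<omega>. 1 / real n)"
        using int S_approx[OF n Y01] by (intro integral_abs_bound[THEN order_trans] integral_mono) auto
      then show ?thesis using int by (simp add: prob_space)
    qed
    have prod: "\<bar>x * y - x' * y'\<bar> \<le> 2 * e"
      if "\<bar>x - x'\<bar> \<le> e" "\<bar>y - y'\<bar> \<le> e" "0 \<le> y" "y \<le> 1" "0 \<le> x'" "x' \<le> 1" for x y x' y' e :: real
    proof -
      have "x * y - x' * y' = (x - x') * y + x' * (y - y')" by (simp add: algebra_simps)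
      moreover have "\<bar>(x - x') * y\<bar> \<le> e * 1" unfolding abs_mult using that by (intro mult_mono) auto
      moreover have "\<bar>x' * (y - y')\<bar> \<le> 1 * e" unfolding abs_mult using that by (intro mult_mono) auto
      ultimately show ?thesis by linarith
    qed
    have EXY: "\<bar>expectation (\<lambda>\<omega>. X \<omega> * Y \<omega>) - expectation (\<lambda>\<omega>. S X n \<omega> * S Y n \<omega>)\<bar> \<le> 2 / real n"
    proof -
      have "\<bar>expectation (\<lambda>\<omega>. X \<omega> * Y \<omega> - S X n \<omega> * S Y n \<omega>)\<bar> \<le> expectation (\<lambda>\<omega>. 2 * (1 / real n))"
        using int S_approx[OF n X01] S_approx[OF n Y01] S01[OF n X01] X01 Y01
        by (intro integral_abs_bound[THEN order_trans] integral_mono prod) auto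
      then show ?thesis using int by (simp add: prob_space)
    qed
    have EXEY: "\<bar>expectation X * expectation Y - expectation (S X n) * expectation (S Y n)\<bar> \<le> 2 * (1 / real n)"
    proof (rule prod[OF EX EY])
      show "0 \<le> expectation Y" "expectation Y \<le> 1"
        using Y01 int by (auto intro!: integral_nonneg_AE integral_le_const)
      show "0 \<le> expectation (S X n)" "expectation (S X n) \<le> 1"
        using S01[OF n X01] int by (auto intro!: integral_nonneg_AE integral_le_const)
    qed
    have "expectation (\<lambda>\<omega>. S X n \<omega> * S Y n \<omega>) = (\<Sum>k\<in>{1..n}. \<Sum>l\<in>{1..n}. prob (A X n k \<inter> A Y n l)) / (real n * real n)"
    proof -
      have "expectation (\<lambda>\<omega>. S X n \<omega> * S Y n \<omega>) =
          expectation (\<lambda>\<omega>. (\<Sum>k\<in>{1..n}. \<Sum>l\<in>{1..n}. indicator (A X n k \<inter> A Y n l) \<omega>) / (real n * real n))"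
        by (simp add: S_def sum_product indicator_inter_arith)
      also have "\<dots> = (\<Sum>k\<in>{1..n}. \<Sum>l\<in>{1..n}. prob (A X n k \<inter> A Y n l)) / (real n * real n)"
        by (simp add: integrable_real_indicator emeasure_eq_measure)
      finally show ?thesis .
    qed
    moreover have "expectation (S Z n) = (\<Sum>k\<in>{1..n}. prob (A Z n k)) / real n"
      if "\<And>k. A Z n k \<in> events" for Z
      unfolding S_def[abs_def] using that by (simp add: emeasure_eq_measure)
    ultimately have "\<bar>expectation (\<lambda>\<omega>. S X n \<omega> * S Y n \<omega>) - expectation (S X n) * expectation (S Y n)\<bar>
       = \<bar>\<Sum>k\<in>{1..n}. \<Sum>l\<in>{1..n}. prob (A X n k \<inter> A Y n l) - prob (A X n k) * prob (A Y n l)\<bar> / (real n * real n)"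
      by (simp add: sum_product sum_subtractf diff_divide_distrib[symmetric] AM)
    also have "\<dots> \<le> (\<Sum>k\<in>{1..n}. \<Sum>l\<in>{1..n}. a) / (real n * real n)"
      by (intro divide_right_mono order_trans[OF sum_abs] sum_mono dep AF AG) auto
    also have "\<dots> = a" using n by simp
    finally show ?thesis using EXY EXEY by linarith
  qed
  have "(\<lambda>n. a + 4 / real (Suc n)) \<longlonglongrightarrow> a + 0"
    by (intro tendsto_add tendsto_const) real_asymp
  then have "\<bar>expectation (\<lambda>\<omega>. X \<omega> * Y \<omega>) - expectation X * expectation Y\<bar> \<le> a + 0"
    by (rule LIMSEQ_le_const) (use main[OF zero_less_Suc] in blast)
  then show ?thesis by simp
qed

text \<open>An affine map takes the range from \<open>- K\<close> to \<open>K\<close> onto the unit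
  interval; covariances scale by \<open>(2 * K)^2\<close>.\<close>

lemma (in prob_space) covariance_bounded:
  assumes F: "subalgebra M F" and G: "subalgebra M G"
    and dep: "\<And>A B. A \<in> sets F \<Longrightarrow> B \<in> sets G \<Longrightarrow> \<bar>prob (A \<inter> B) - prob A * prob B\<bar> \<le> a"
    and X: "X \<in> borel_measurable F" and Y: "Y \<in> borel_measurable G"
    and Xb: "\<And>\<omega>. \<bar>X \<omega>\<bar> \<le> K" and Yb: "\<And>\<omega>. \<bar>Y \<omega>\<bar> \<le> (K :: real)" and "K > 0"
  shows "\<bar>expectation (\<lambda>\<omega>. X \<omega> * Y \<omega>) - expectation X * expectation Y\<bar> \<le> 4 * K\<^sup>2 * a"
proof -
  define X' where "X' \<omega> = (X \<omega> + K) / (2 * K)" for \<omega>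
  define Y' where "Y' \<omega> = (Y \<omega> + K) / (2 * K)" for \<omega>
  have [measurable]: "X \<in> borel_measurable M" "Y \<in> borel_measurable M"
    using measurable_from_subalg[OF F X] measurable_from_subalg[OF G Y] .
  have [measurable]: "X' \<in> borel_measurable F" "Y' \<in> borel_measurable G"
    using X Y unfolding X'_def Y'_def by measurable
  have [measurable]: "X' \<in> borel_measurable M" "Y' \<in> borel_measurable M"
    unfolding X'_def Y'_def by measurable
  have 01: "X' \<omega> \<in> {0..1}" "Y' \<omega> \<in> {0..1}" for \<omega>
    using Xb[of \<omega>] Yb[of \<omega>] \<open>K > 0\<close> by (auto simp: X'_def Y'_def field_simps abs_le_iff)
  have int: "integrable M X'" "integrable M Y'" "integrable M (\<lambda>\<omega>. X' \<omega> * Y' \<omega>)"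
    using 01 by (auto intro!: integrable_const_bound[where B = 1] AE_I2 mult_le_one simp: abs_mult)
  have eqs: "X = (\<lambda>\<omega>. 2 * K * X' \<omega> - K)" "Y = (\<lambda>\<omega>. 2 * K * Y' \<omega> - K)"
    using \<open>K > 0\<close> by (auto simp: X'_def Y'_def)
  have EX: "expectation X = 2 * K * expectation X' - K" "expectation Y = 2 * K * expectation Y' - K"
    unfolding eqs using int by (simp_all add: prob_space)
  have "expectation (\<lambda>\<omega>. X \<omega> * Y \<omega>) =
      expectation (\<lambda>\<omega>. 4 * K\<^sup>2 * (X' \<omega> * Y' \<omega>) - 2 * K\<^sup>2 * X' \<omega> - 2 * K\<^sup>2 * Y' \<omega> + K\<^sup>2)"
    unfolding eqs by (intro Bochner_Integration.integral_cong refl) (simp add: algebra_simps power2_eq_square)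
  also have "\<dots> = 4 * K\<^sup>2 * expectation (\<lambda>\<omega>. X' \<omega> * Y' \<omega>) - 2 * K\<^sup>2 * expectation X' - 2 * K\<^sup>2 * expectation Y' + K\<^sup>2"
    using int by (simp add: prob_space)
  finally have "expectation (\<lambda>\<omega>. X \<omega> * Y \<omega>) - expectation X * expectation Y =
      4 * K\<^sup>2 * (expectation (\<lambda>\<omega>. X' \<omega> * Y' \<omega>) - expectation X' * expectation Y')"
    unfolding EX by (simp add: algebra_simps power2_eq_square)
  moreover have "\<bar>expectation (\<lambda>\<omega>. X' \<omega> * Y' \<omega>) - expectation X' * expectation Y'\<bar> \<le> a"
    by (rule covariance_unit_interval[OF F G dep]) (use 01 in auto)
  ultimately show ?thesis
    using \<open>K > 0\<close> by (simp add: abs_mult mult_left_mono)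
qed

text \<open>The constant is 16 because four covariances of real and imaginary parts occur, each at
  most \<open>4 * a\<close>.\<close>

lemma (in prob_space) covariance_complex:
  assumes F: "subalgebra M F" and G: "subalgebra M G"
    and dep: "\<And>A B. A \<in> sets F \<Longrightarrow> B \<in> sets G \<Longrightarrow> \<bar>prob (A \<inter> B) - prob A * prob B\<bar> \<le> a"
    and X: "X \<in> borel_measurable F" and Y: "Y \<in> borel_measurable G"
    and Xb: "\<And>\<omega>. cmod (X \<omega>) \<le> 1" and Yb: "\<And>\<omega>. cmod (Y \<omega>) \<le> 1"
  shows "cmod (expectation (\<lambda>\<omega>. X \<omega> * Y \<omega>) - expectation X * expectation Y) \<le> 16 * a"
proof -
  have [measurable]: "X \<in> borel_measurable M" "Y \<in> borel_measurable M"
    using measurable_from_subalg[OF F X] measurable_from_subalg[OF G Y] .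
  have int: "integrable M X" "integrable M Y" "integrable M (\<lambda>\<omega>. X \<omega> * Y \<omega>)"
    using Xb Yb by (auto intro!: integrable_const_bound[where B = 1] AE_I2 mult_le_one simp: norm_mult)
  have b: "\<bar>Re (X \<omega>)\<bar> \<le> 1" "\<bar>Im (X \<omega>)\<bar> \<le> 1" "\<bar>Re (Y \<omega>)\<bar> \<le> 1" "\<bar>Im (Y \<omega>)\<bar> \<le> 1" for \<omega>
    using Xb[of \<omega>] Yb[of \<omega>] abs_Re_le_cmod abs_Im_le_cmod order_trans by blast+
  have intp: "integrable M (\<lambda>\<omega>. f (X \<omega>) * g (Y \<omega>))" if "f \<in> {Re, Im}" "g \<in> {Re, Im}" for f g
    using that b by (auto intro!: integrable_const_bound[where B = 1] AE_I2 mult_le_one simp: abs_mult)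
  define c where "c f g = expectation (\<lambda>\<omega>. f (X \<omega>) * g (Y \<omega>)) - expectation (\<lambda>\<omega>. f (X \<omega>)) * expectation (\<lambda>\<omega>. g (Y \<omega>))"
    for f g :: "complex \<Rightarrow> real"
  have cb: "\<bar>c f g\<bar> \<le> 4 * a" if "f \<in> {Re, Im}" "g \<in> {Re, Im}" for f g
  proof -
    have "\<bar>c f g\<bar> \<le> 4 * 1\<^sup>2 * a"
      unfolding c_def using that X Y b by (intro covariance_bounded[OF F G dep]) auto
    then show ?thesis by simp
  qed
  have "expectation (\<lambda>\<omega>. X \<omega> * Y \<omega>) - expectation X * expectation Y
      = Complex (c Re Re - c Im Im) (c Re Im + c Im Re)"
    using int intp by (simp add: complex_eq_iff c_def flip: integral_Re integral_Im)
  also have "cmod \<dots> \<le> \<bar>c Re Re - c Im Im\<bar> + \<bar>c Re Im + c Im Re\<bar>"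
    using cmod_le[of "Complex (c Re Re - c Im Im) (c Re Im + c Im Re)"] by simp
  also have "\<dots> \<le> 16 * a"
    using cb[of Re Re] cb[of Im Im] cb[of Re Im] cb[of Im Re] by simp
  finally show ?thesis .
qed

text \<open>Davydov's inequality, up to the value of the constant: truncate both variables
  at the level \<open>a powr (- 1 / (2 + \<delta>))\<close>.\<close>

lemma (in prob_space) covariance_moment:
  assumes F: "subalgebra M F" and G: "subalgebra M G"
    and dep: "\<And>A B. A \<in> sets F \<Longrightarrow> B \<in> sets G \<Longrightarrow> \<bar>prob (A \<inter> B) - prob A * prob B\<bar> \<le> a"
    and X: "X \<in> borel_measurable F" and Y: "Y \<in> borel_measurable G"
    and "\<delta> > 0" "0 < a" "a \<le> 1"
    and Xi: "integrable M (\<lambda>\<omega>. \<bar>X \<omega>\<bar> powr (2 + \<delta>))" and Yi: "integrable M (\<lambda>\<omega>. \<bar>Y \<omega>\<bar> powr (2 + \<delta>))"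
    and Xm: "expectation (\<lambda>\<omega>. \<bar>X \<omega>\<bar> powr (2 + \<delta>)) \<le> B" and Ym: "expectation (\<lambda>\<omega>. \<bar>Y \<omega> :: real\<bar> powr (2 + \<delta>)) \<le> B"
  shows "\<bar>expectation (\<lambda>\<omega>. X \<omega> * Y \<omega>) - expectation X * expectation Y\<bar> \<le> (4 + 5 * B + B\<^sup>2) * a powr (\<delta> / (2 + \<delta>))"
proof -
  \<comment> \<open>This level equates the two costs: the clipped parts contribute a multiple of
    \<open>N^2 * a\<close> and the tails a multiple of \<open>N powr (- \<delta>)\<close>, and both
    equal \<open>e\<close>.\<close>
  define N where "N = a powr (- 1 / (2 + \<delta>))"
  define e where "e = a powr (\<delta> / (2 + \<delta>))"
  have N: "N \<ge> 1" "N > 0"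
    using assms(6-8) powr_mono'[of "- 1 / (2 + \<delta>)" 0 a] by (auto simp: N_def)
  have N_sq: "N\<^sup>2 * a = e"
  proof -
    have "N\<^sup>2 * a = a powr (2 * (- 1 / (2 + \<delta>))) * a powr 1"
      using assms(7) by (simp add: N_def powr_realpow[symmetric] powr_powr)
    also have "\<dots> = a powr (2 * (- 1 / (2 + \<delta>)) + 1)"
      by (simp only: powr_add)
    also have "2 * (- 1 / (2 + \<delta>)) + 1 = \<delta> / (2 + \<delta>)"
      using assms(6) by (simp add: field_simps)
    also have "a powr (\<delta> / (2 + \<delta>)) = e" by (simp add: e_def)
    finally show ?thesis .
  qed
  have N_del: "N powr (- \<delta>) = e"
    by (simp add: N_def e_def powr_powr)
  have e: "e > 0" using assms(7) by (simp add: e_def)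
  have B: "B \<ge> 0" using Xm by (rule order_trans[rotated]) (auto intro!: integral_nonneg_AE)
  have tail: "\<bar>x\<bar> ^ 2 \<le> e * \<bar>x\<bar> powr (2 + \<delta>)" "N * \<bar>x\<bar> \<le> e * \<bar>x\<bar> powr (2 + \<delta>)" if "\<bar>x\<bar> > N" for x :: real
  proof -
    have x: "\<bar>x\<bar> > 0" using that N by simp
    have "\<bar>x\<bar> powr (- \<delta>) \<le> N powr (- \<delta>)"
      using that N assms(6) by (intro powr_mono2') auto
    then have "\<bar>x\<bar> powr (- \<delta>) * \<bar>x\<bar> powr (2 + \<delta>) \<le> e * \<bar>x\<bar> powr (2 + \<delta>)"
      unfolding N_del by (intro mult_right_mono) auto
    moreover have "\<bar>x\<bar> powr (- \<delta>) * \<bar>x\<bar> powr (2 + \<delta>) = \<bar>x\<bar> ^ 2"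
      using x by (simp add: powr_add[symmetric] powr_realpow[symmetric])
    ultimately show 1: "\<bar>x\<bar> ^ 2 \<le> e * \<bar>x\<bar> powr (2 + \<delta>)" by simp
    have "N * \<bar>x\<bar> \<le> \<bar>x\<bar> ^ 2"
      using that unfolding power2_eq_square by (intro mult_right_mono) auto
    with 1 show "N * \<bar>x\<bar> \<le> e * \<bar>x\<bar> powr (2 + \<delta>)" by linarith
  qed
  have le1: "\<bar>x\<bar> \<le> 1 + \<bar>x\<bar> powr (2 + \<delta>)" "\<bar>x\<bar> ^ 2 \<le> 1 + \<bar>x\<bar> powr (2 + \<delta>)" for x :: real
  proof -
    show "\<bar>x\<bar> \<le> 1 + \<bar>x\<bar> powr (2 + \<delta>)"
      using powr_mono[of 1 "2 + \<delta>" "\<bar>x\<bar>"] assms(6) powr_ge_zero[of "\<bar>x\<bar>" "2 + \<delta>"]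
      by (cases "\<bar>x\<bar> \<ge> 1") (simp, linarith)
    show "\<bar>x\<bar> ^ 2 \<le> 1 + \<bar>x\<bar> powr (2 + \<delta>)"
    proof (cases "\<bar>x\<bar> \<ge> 1")
      case True
      then have "\<bar>x\<bar> ^ 2 = \<bar>x\<bar> powr 2" by (subst powr_realpow[symmetric]) auto
      then show ?thesis using True powr_mono[of 2 "2 + \<delta>" "\<bar>x\<bar>"] assms(6) by linarith
    next
      case False
      then show ?thesis
        using power_le_one[of "\<bar>x\<bar>" 2] powr_ge_zero[of "\<bar>x\<bar>" "2 + \<delta>"] by linarith
    qed
  qed
  define T where "T x = max (- N) (min N x)" for x
  have T: "\<bar>T x\<bar> \<le> N" "\<bar>T x\<bar> \<le> \<bar>x\<bar>" "\<bar>x - T x\<bar> \<le> \<bar>x\<bar>" "\<bar>x\<bar> \<le> N \<Longrightarrow> T x = x" for x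
    using N by (auto simp: T_def)
  have [measurable]: "T \<in> borel_measurable borel" unfolding T_def by measurable
  note [measurable] = X Y
  have XY [measurable]: "X \<in> borel_measurable M" "Y \<in> borel_measurable M"
    using measurable_from_subalg[OF F X] measurable_from_subalg[OF G Y] .
  have dom: "integrable M f" if [measurable]: "f \<in> borel_measurable M"
    and "\<And>\<omega>. \<bar>f \<omega>\<bar> \<le> 2 + \<bar>X \<omega>\<bar> powr (2 + \<delta>) + \<bar>Y \<omega>\<bar> powr (2 + \<delta>)" for f
  proof (rule Bochner_Integration.integrable_bound)
    show "integrable M (\<lambda>\<omega>. 2 + \<bar>X \<omega>\<bar> powr (2 + \<delta>) + \<bar>Y \<omega>\<bar> powr (2 + \<delta>))" using Xi Yi by simp
    show "AE \<omega> in M. norm (f \<omega>) \<le> norm (2 + \<bar>X \<omega>\<bar> powr (2 + \<delta>) + \<bar>Y \<omega>\<bar> powr (2 + \<delta>))"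
      using order_trans[OF that(2) abs_ge_self] by simp
  qed measurable
  have lin: "\<bar>z\<bar> \<le> 2 + \<bar>X \<omega>\<bar> powr (2 + \<delta>) + \<bar>Y \<omega>\<bar> powr (2 + \<delta>)"
    if "\<bar>z\<bar> \<le> \<bar>X \<omega>\<bar> \<or> \<bar>z\<bar> \<le> \<bar>Y \<omega>\<bar> \<or> \<bar>z\<bar> \<le> \<bar>X \<omega>\<bar> * \<bar>Y \<omega>\<bar>" for z \<omega>
  proof -
    have "\<bar>X \<omega>\<bar> * \<bar>Y \<omega>\<bar> \<le> \<bar>X \<omega>\<bar> ^ 2 + \<bar>Y \<omega>\<bar> ^ 2"
      using sum_squares_bound[of "\<bar>X \<omega>\<bar>" "\<bar>Y \<omega>\<bar>"] mult_nonneg_nonneg[of "\<bar>X \<omega>\<bar>" "\<bar>Y \<omega>\<bar>"] by linarith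
    then show ?thesis
      using that le1[of "X \<omega>"] le1[of "Y \<omega>"] powr_ge_zero[of "\<bar>X \<omega>\<bar>" "2 + \<delta>"] powr_ge_zero[of "\<bar>Y \<omega>\<bar>" "2 + \<delta>"]
      by linarith
  qed
  have intX: "integrable M X" "integrable M Y" "integrable M (\<lambda>\<omega>. T (X \<omega>))" "integrable M (\<lambda>\<omega>. T (Y \<omega>))"
    "integrable M (\<lambda>\<omega>. X \<omega> - T (X \<omega>))" "integrable M (\<lambda>\<omega>. Y \<omega> - T (Y \<omega>))"
    by (rule dom, measurable, rule lin, use T in blast)+
  have intP: "integrable M (\<lambda>\<omega>. X \<omega> * Y \<omega>)" "integrable M (\<lambda>\<omega>. T (X \<omega>) * T (Y \<omega>))"
    "integrable M (\<lambda>\<omega>. T (X \<omega>) * (Y \<omega> - T (Y \<omega>)))" "integrable M (\<lambda>\<omega>. (X \<omega> - T (X \<omega>)) * Y \<omega>)"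
    by (rule dom, measurable, rule lin, intro disjI2, unfold abs_mult, intro mult_mono T abs_ge_zero order_refl)+
  have tailE: "N * expectation (\<lambda>\<omega>. \<bar>Z \<omega> - T (Z \<omega>)\<bar>) \<le> e * B"
    if "integrable M (\<lambda>\<omega>. Z \<omega> - T (Z \<omega>))" "integrable M (\<lambda>\<omega>. \<bar>Z \<omega>\<bar> powr (2 + \<delta>))"
       "expectation (\<lambda>\<omega>. \<bar>Z \<omega>\<bar> powr (2 + \<delta>)) \<le> B" for Z
  proof -
    have "N * expectation (\<lambda>\<omega>. \<bar>Z \<omega> - T (Z \<omega>)\<bar>) = expectation (\<lambda>\<omega>. N * \<bar>Z \<omega> - T (Z \<omega>)\<bar>)" by simp
    also have "\<dots> \<le> expectation (\<lambda>\<omega>. e * \<bar>Z \<omega>\<bar> powr (2 + \<delta>))"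
    proof (rule integral_mono)
      show "N * \<bar>Z \<omega> - T (Z \<omega>)\<bar> \<le> e * \<bar>Z \<omega>\<bar> powr (2 + \<delta>)" for \<omega>
        using tail(2)[of "Z \<omega>"] T(3,4)[of "Z \<omega>"] N e
        by (cases "\<bar>Z \<omega>\<bar> \<le> N") (auto intro: order_trans[OF mult_left_mono[of _ "\<bar>Z \<omega>\<bar>" N]])
    qed (use that in auto)
    also have "\<dots> \<le> e * B" using that(3) e by simp
    finally show ?thesis .
  qed
  have tail1: "expectation (\<lambda>\<omega>. \<bar>Z \<omega> - T (Z \<omega>)\<bar>) \<le> N * expectation (\<lambda>\<omega>. \<bar>Z \<omega> - T (Z \<omega>)\<bar>)" for Z :: "'a \<Rightarrow> real"
    using N mult_right_mono[of 1 N "expectation (\<lambda>\<omega>. \<bar>Z \<omega> - T (Z \<omega>)\<bar>)"] by simp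
  note tX = tailE[OF intX(5) Xi Xm] and tY = tailE[OF intX(6) Yi Ym]
  have EYle: "expectation (\<lambda>\<omega>. \<bar>Y \<omega>\<bar>) \<le> 1 + B"
  proof -
    have "expectation (\<lambda>\<omega>. \<bar>Y \<omega>\<bar>) \<le> expectation (\<lambda>\<omega>. 1 + \<bar>Y \<omega>\<bar> powr (2 + \<delta>))"
      using intX Yi le1 by (intro integral_mono) auto
    also have "\<dots> \<le> 1 + B" using Yi Ym by (simp add: prob_space)
    finally show ?thesis .
  qed
  have c1: "\<bar>expectation (\<lambda>\<omega>. T (X \<omega>) * T (Y \<omega>)) - expectation (\<lambda>\<omega>. T (X \<omega>)) * expectation (\<lambda>\<omega>. T (Y \<omega>))\<bar> \<le> 4 * e"
  proof -
    have "\<bar>expectation (\<lambda>\<omega>. T (X \<omega>) * T (Y \<omega>)) - expectation (\<lambda>\<omega>. T (X \<omega>)) * expectation (\<lambda>\<omega>. T (Y \<omega>))\<bar> \<le> 4 * N\<^sup>2 * a"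
      using T N by (intro covariance_bounded[OF F G dep]) auto
    then show ?thesis using N_sq by simp
  qed
  have c2: "\<bar>expectation (\<lambda>\<omega>. T (X \<omega>) * (Y \<omega> - T (Y \<omega>)))\<bar> \<le> e * B"
  proof -
    have "\<bar>expectation (\<lambda>\<omega>. T (X \<omega>) * (Y \<omega> - T (Y \<omega>)))\<bar> \<le> expectation (\<lambda>\<omega>. N * \<bar>Y \<omega> - T (Y \<omega>)\<bar>)"
    proof (intro integral_abs_bound[THEN order_trans] integral_mono)
      show "\<bar>T (X \<omega>) * (Y \<omega> - T (Y \<omega>))\<bar> \<le> N * \<bar>Y \<omega> - T (Y \<omega>)\<bar>" for \<omega>
        unfolding abs_mult by (intro mult_right_mono T) auto
    qed (use intP intX in auto)
    also have "\<dots> \<le> e * B" using tY by simp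
    finally show ?thesis .
  qed
  have c3: "\<bar>expectation (\<lambda>\<omega>. T (X \<omega>)) * expectation (\<lambda>\<omega>. Y \<omega> - T (Y \<omega>))\<bar> \<le> e * B"
  proof -
    have "\<bar>expectation (\<lambda>\<omega>. T (X \<omega>))\<bar> \<le> N"
      using T intX by (intro integral_abs_bound[THEN order_trans] integral_le_const) auto
    moreover have "\<bar>expectation (\<lambda>\<omega>. Y \<omega> - T (Y \<omega>))\<bar> \<le> expectation (\<lambda>\<omega>. \<bar>Y \<omega> - T (Y \<omega>)\<bar>)"
      by (rule integral_abs_bound)
    ultimately have "\<bar>expectation (\<lambda>\<omega>. T (X \<omega>)) * expectation (\<lambda>\<omega>. Y \<omega> - T (Y \<omega>))\<bar> \<le> N * expectation (\<lambda>\<omega>. \<bar>Y \<omega> - T (Y \<omega>)\<bar>)"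
      using N unfolding abs_mult by (intro mult_mono) auto
    then show ?thesis using tY by linarith
  qed
  have c4: "\<bar>expectation (\<lambda>\<omega>. (X \<omega> - T (X \<omega>)) * Y \<omega>)\<bar> \<le> 2 * (e * B)"
  proof -
    have "\<bar>expectation (\<lambda>\<omega>. (X \<omega> - T (X \<omega>)) * Y \<omega>)\<bar> \<le>
        expectation (\<lambda>\<omega>. e * \<bar>X \<omega>\<bar> powr (2 + \<delta>) + e * \<bar>Y \<omega>\<bar> powr (2 + \<delta>))"
    proof (intro integral_abs_bound[THEN order_trans] integral_mono)
      fix \<omega>
      show "\<bar>(X \<omega> - T (X \<omega>)) * Y \<omega>\<bar> \<le> e * \<bar>X \<omega>\<bar> powr (2 + \<delta>) + e * \<bar>Y \<omega>\<bar> powr (2 + \<delta>)"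
      \<comment> \<open>Where \<open>X\<close> is not clipped the product is 0. Otherwise the larger
        of \<open>\<bar>X \<omega>\<bar>\<close> and \<open>\<bar>Y \<omega>\<bar>\<close> exceeds
        \<open>N\<close>, and its square dominates the product.\<close>
      proof (cases "\<bar>X \<omega>\<bar> \<le> N")
        case False
        have nn: "0 \<le> e * \<bar>X \<omega>\<bar> powr (2 + \<delta>)" "0 \<le> e * \<bar>Y \<omega>\<bar> powr (2 + \<delta>)"
          using e by simp_all
        have le: "\<bar>(X \<omega> - T (X \<omega>)) * Y \<omega>\<bar> \<le> \<bar>X \<omega>\<bar> * \<bar>Y \<omega>\<bar>"
          unfolding abs_mult by (intro mult_right_mono T) auto
        show ?thesis
        proof (cases "\<bar>Y \<omega>\<bar> \<le> \<bar>X \<omega>\<bar>")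
          case True
          then have "\<bar>X \<omega>\<bar> * \<bar>Y \<omega>\<bar> \<le> \<bar>X \<omega>\<bar> ^ 2"
            unfolding power2_eq_square by (intro mult_left_mono) auto
          then show ?thesis
            using tail(1)[of "X \<omega>"] False le nn by linarith
        next
          case 2: False
          then have "\<bar>X \<omega>\<bar> * \<bar>Y \<omega>\<bar> \<le> \<bar>Y \<omega>\<bar> ^ 2"
            unfolding power2_eq_square by (intro mult_right_mono) auto
          then show ?thesis
            using tail(1)[of "Y \<omega>"] False 2 le nn by linarith
        qed
      qed (use T e in auto)
    qed (use intP Xi Yi in auto)
    also have "\<dots> = e * expectation (\<lambda>\<omega>. \<bar>X \<omega>\<bar> powr (2 + \<delta>)) + e * expectation (\<lambda>\<omega>. \<bar>Y \<omega>\<bar> powr (2 + \<delta>))"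
      using Xi Yi by simp
    also have "\<dots> \<le> e * B + e * B"
      using Xm Ym e by (intro add_mono mult_left_mono) auto
    finally show ?thesis by (simp only: mult_2)
  qed
  have c5: "\<bar>expectation (\<lambda>\<omega>. X \<omega> - T (X \<omega>)) * expectation Y\<bar> \<le> e * B * (1 + B)"
  proof -
    have "\<bar>expectation (\<lambda>\<omega>. X \<omega> - T (X \<omega>))\<bar> \<le> expectation (\<lambda>\<omega>. \<bar>X \<omega> - T (X \<omega>)\<bar>)"
      "\<bar>expectation Y\<bar> \<le> expectation (\<lambda>\<omega>. \<bar>Y \<omega>\<bar>)"
      by (rule integral_abs_bound)+
    then have "\<bar>expectation (\<lambda>\<omega>. X \<omega> - T (X \<omega>))\<bar> \<le> e * B" "\<bar>expectation Y\<bar> \<le> 1 + B"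
      using tX tail1[of X] EYle by linarith+
    then show ?thesis unfolding abs_mult using e B by (intro mult_mono) auto
  qed
  have "expectation (\<lambda>\<omega>. X \<omega> * Y \<omega>) = expectation (\<lambda>\<omega>. T (X \<omega>) * T (Y \<omega>) + T (X \<omega>) * (Y \<omega> - T (Y \<omega>)) + (X \<omega> - T (X \<omega>)) * Y \<omega>)"
    by (simp add: algebra_simps)
  also have "\<dots> = expectation (\<lambda>\<omega>. T (X \<omega>) * T (Y \<omega>)) + expectation (\<lambda>\<omega>. T (X \<omega>) * (Y \<omega> - T (Y \<omega>))) + expectation (\<lambda>\<omega>. (X \<omega> - T (X \<omega>)) * Y \<omega>)"
    using intP by (simp only: Bochner_Integration.integral_add Bochner_Integration.integrable_add)
  finally have E1: "expectation (\<lambda>\<omega>. X \<omega> * Y \<omega>) = \<dots>" .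
  have "x * y = a * c + a * d + b * y" if "x = a + b" "y = c + d" for a b c d x y :: real
    using that by (simp add: algebra_simps)
  note E2 = this[of "expectation X" "expectation (\<lambda>\<omega>. T (X \<omega>))" "expectation (\<lambda>\<omega>. X \<omega> - T (X \<omega>))"
      "expectation Y" "expectation (\<lambda>\<omega>. T (Y \<omega>))" "expectation (\<lambda>\<omega>. Y \<omega> - T (Y \<omega>))"]
  have E2: "expectation X * expectation Y = expectation (\<lambda>\<omega>. T (X \<omega>)) * expectation (\<lambda>\<omega>. T (Y \<omega>)) +
      expectation (\<lambda>\<omega>. T (X \<omega>)) * expectation (\<lambda>\<omega>. Y \<omega> - T (Y \<omega>)) + expectation (\<lambda>\<omega>. X \<omega> - T (X \<omega>)) * expectation Y"
    by (rule E2) (use intX in simp_all)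
  \<comment> \<open>In units of \<open>e\<close>: 4 from the clipped covariance, \<open>B\<close>
    from each of \<open>c2\<close> and \<open>c3\<close>, \<open>2 * B\<close> from
    \<open>c4\<close>, and \<open>B * (1 + B)\<close> from \<open>c5\<close>.\<close>
  have "\<bar>expectation (\<lambda>\<omega>. X \<omega> * Y \<omega>) - expectation X * expectation Y\<bar> \<le> 4 * e + e * B + e * B + 2 * (e * B) + e * B * (1 + B)"
    unfolding E1 E2 using c1 c2 c3 c4 c5 by linarith
  also have "\<dots> = (4 + 5 * B + B\<^sup>2) * e" by (simp add: algebra_simps power2_eq_square)
  finally show ?thesis by (simp add: e_def)
qed

section \<open>Stationary mixing sequences\<close>

lemma cesaro_mean:
  fixes d :: "nat \<Rightarrow> real"
  assumes "d \<longlonglongrightarrow> l"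
  shows "(\<lambda>n. (\<Sum>k<n. d k) / real n) \<longlonglongrightarrow> l"
proof (rule LIMSEQ_I)
  fix \<epsilon> :: real assume "\<epsilon> > 0"
  then obtain N where N: "\<And>k. k \<ge> N \<Longrightarrow> \<bar>d k - l\<bar> < \<epsilon> / 2"
    using LIMSEQ_D[OF assms, of "\<epsilon> / 2"] by auto
  define C where "C = (\<Sum>k<N. \<bar>d k - l\<bar>)"
  have C: "C \<ge> 0" by (simp add: C_def sum_nonneg)
  obtain n0 :: nat where n0: "real n0 > 2 * C / \<epsilon>" using reals_Archimedean2 by blast
  show "\<exists>no. \<forall>n\<ge>no. norm ((\<Sum>k<n. d k) / real n - l) < \<epsilon>"
  proof (intro exI[of _ "max (Suc N) (Suc n0)"] allI impI)
    fix n assume n: "n \<ge> max (Suc N) (Suc n0)"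
    have "\<bar>\<Sum>k<n. d k - l\<bar> \<le> (\<Sum>k<n. \<bar>d k - l\<bar>)" by (rule sum_abs)
    also have "\<dots> = C + (\<Sum>k\<in>{N..<n}. \<bar>d k - l\<bar>)"
      using n unfolding C_def by (simp add: sum.atLeastLessThan_concat lessThan_atLeast0)
    also have "(\<Sum>k\<in>{N..<n}. \<bar>d k - l\<bar>) \<le> (\<Sum>k\<in>{N..<n}. \<epsilon> / 2)"
      using N by (intro sum_mono) (auto intro: less_imp_le)
    also have "\<dots> \<le> real n * (\<epsilon> / 2)"
      using \<open>\<epsilon> > 0\<close> by (simp add: mult_right_mono)
    finally have "\<bar>\<Sum>k<n. d k - l\<bar> \<le> C + real n * (\<epsilon> / 2)" by simp
    moreover have "C < real n * (\<epsilon> / 2)"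
    proof -
      have "2 * C / \<epsilon> < real n" using n0 n by linarith
      then show ?thesis using \<open>\<epsilon> > 0\<close> by (simp add: field_simps)
    qed
    moreover have "(\<Sum>k<n. d k) / real n - l = (\<Sum>k<n. d k - l) / real n"
      using n by (simp add: sum_subtractf field_simps)
    ultimately show "norm ((\<Sum>k<n. d k) / real n - l) < \<epsilon>"
      using n by (simp add: field_simps)
  qed
qed

text \<open>The Abel-Olivier-Pringsheim argument: at least half of the first \<open>n\<close>
  indices lie between \<open>n div 2\<close> and \<open>n\<close>, their terms are at least
  \<open>a n\<close>, and their sum is a Cauchy tail.\<close>

lemma decreasing_summable_imp_little_o:
  fixes a :: "nat \<Rightarrow> real"
  assumes "summable a" and a0: "\<And>n. a n \<ge> 0" and dec: "\<And>m n. m \<le> n \<Longrightarrow> a n \<le> a m"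
  shows "(\<lambda>n. real n * a n) \<longlonglongrightarrow> 0"
proof (rule LIMSEQ_I)
  fix \<epsilon> :: real assume "\<epsilon> > 0"
  then obtain N where N: "\<And>m n. m \<ge> N \<Longrightarrow> norm (sum a {m..<n}) < \<epsilon> / 4"
    using assms(1) unfolding summable_Cauchy by (metis divide_pos_pos zero_less_numeral)
  show "\<exists>no. \<forall>n\<ge>no. norm (real n * a n - 0) < \<epsilon>"
  proof (intro exI[of _ "2 * N + 2"] allI impI)
    fix n assume n: "n \<ge> 2 * N + 2"
    define m where "m = n div 2"
    have m: "m \<ge> N" "m \<le> n" "n \<le> 2 * (n - m)" "n - m \<ge> 1" using n by (auto simp: m_def)
    have "real (n - m) * a n = (\<Sum>k\<in>{m..<n}. a n)" by simp
    also have "\<dots> \<le> sum a {m..<n}" by (intro sum_mono dec) auto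
    also have "\<dots> < \<epsilon> / 4" using N[OF m(1), of n] by simp
    finally have "2 * real (n - m) * a n < \<epsilon> / 2" by simp
    moreover have "real n * a n \<le> 2 * real (n - m) * a n"
      using m(3) a0 by (intro mult_right_mono) linarith+
    ultimately show "norm (real n * a n - 0) < \<epsilon>" using a0[of n] \<open>\<epsilon> > 0\<close> by simp
  qed
qed

text \<open>Stationarity concerns the indices from 1 on, which is the source of the conditions
  \<open>i \<ge> 1\<close> and \<open>0 \<notin> R\<close> below; it also spreads the moment bound
  from \<open>U 1\<close> to all of them.\<close>

locale stationary_mixing = prob_space M for M :: "'a measure" +
  fixes U :: "nat \<Rightarrow> 'a \<Rightarrow> real" and \<delta> :: real
  assumes U_measurable [measurable]: "U j \<in> borel_measurable M"
    and stationary: "stationary_seq M U"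
    and \<delta>_pos: "\<delta> > 0"
    and alpha_decreasing: "r \<ge> 1 \<Longrightarrow> alpha_mix M U (r + 1) \<le> alpha_mix M U r"
    and alpha_powr_summable: "summable (\<lambda>r. alpha_mix M U (r + 1) powr (\<delta> / (2 + \<delta>)))"
    and moment: "integrable M (\<lambda>\<omega>. \<bar>U 1 \<omega>\<bar> powr (2 + \<delta>))"
begin

text \<open>Packages \<open>sigma_gen\<close> as a measure so that measurability and
  \<open>subalgebra\<close> can be expressed; only its sets matter.\<close>

definition gen :: "nat set \<Rightarrow> 'a measure" where
  "gen J = sigma (space M) (\<Union>j\<in>J. {U j -` B \<inter> space M | B. B \<in> sets borel})"

lemma sets_gen: "sets (gen J) = sigma_gen M U J"
  unfolding gen_def sigma_gen_def by (rule sets_measure_of) auto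

lemma space_gen [simp]: "space (gen J) = space M"
  by (simp add: gen_def space_measure_of_conv)

lemma subalgebra_gen: "subalgebra M (gen J)"
  unfolding subalgebra_def
proof
  have "(\<Union>j\<in>J. {U j -` B \<inter> space M | B. B \<in> sets borel}) \<subseteq> events"
    by (auto intro!: measurable_sets)
  then show "sets (gen J) \<subseteq> events"
    unfolding sets_gen sigma_gen_def by (rule sets.sigma_sets_subset)
qed simp

lemma U_measurable_gen: "j \<in> J \<Longrightarrow> U j \<in> borel_measurable (gen J)"
  by (rule measurableI) (auto simp: sets_gen sigma_gen_def intro!: sigma_sets.Basic)

lemma block_measurable_gen:
  fixes h :: "real \<Rightarrow> real"
  assumes "R \<subseteq> J" and "h \<in> borel_measurable borel"
  shows "(\<lambda>\<omega>. \<Sum>j\<in>R. h (U j \<omega>)) \<in> borel_measurable (gen J)"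
proof (rule borel_measurable_sum)
  show "(\<lambda>\<omega>. h (U j \<omega>)) \<in> borel_measurable (gen J)" if "j \<in> R" for j
    using assms(1) that by (intro measurable_compose[OF U_measurable_gen assms(2)]) auto
qed

text \<open>Makes the sets under both suprema bounded above, so that \<open>Sup\<close> has its
  intended meaning.\<close>

lemma dependence_le_1:
  assumes "A \<in> events" "B \<in> events"
  shows "\<bar>prob (A \<inter> B) - prob A * prob B\<bar> \<le> 1"
proof -
  have "0 \<le> prob (A \<inter> B)" "prob (A \<inter> B) \<le> 1" "0 \<le> prob A * prob B" "prob A * prob B \<le> 1"
    by (auto intro: mult_le_one)
  then show ?thesis by linarith
qed

lemma alpha_dep_le_alpha_mix:
  assumes "1 \<le> k" "k + r \<le> p"
  shows "alpha_dep M (sigma_gen M U {1..k}) (sigma_gen M U {k + r..p}) \<le> alpha_mix M U r"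
    and "0 \<le> alpha_mix M U r" and "alpha_mix M U r \<le> 1"
    and "A \<in> sets (gen {1..k}) \<Longrightarrow> B \<in> sets (gen {k + r..p}) \<Longrightarrow>
      \<bar>prob (A \<inter> B) - prob A * prob B\<bar> \<le> alpha_mix M U r"
proof -
  have ev: "sigma_gen M U J \<subseteq> events" for J
    using subalgebra_gen[of J] by (simp add: subalgebra_def sets_gen)
  have le: "\<bar>prob (A \<inter> B) - prob A * prob B\<bar> \<le> alpha_dep M (sigma_gen M U I) (sigma_gen M U J)"
    if "A \<in> sigma_gen M U I" "B \<in> sigma_gen M U J" for A B I J
    unfolding alpha_dep_def
    by (intro cSup_upper bdd_aboveI[of _ 1]) (use that ev dependence_le_1 in blast)+
  \<comment> \<open>The empty event shows that the sets under the suprema are nonempty, and that the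
    coefficients are nonnegative.\<close>
  have emp: "{} \<in> sigma_gen M U J" for J
    by (simp add: sigma_gen_def sigma_sets.Empty)
  have le1: "alpha_dep M (sigma_gen M U I) (sigma_gen M U J) \<le> 1" for I J
    unfolding alpha_dep_def
    by (intro cSup_least) (use emp ev dependence_le_1 in blast)+
  show 1: "alpha_dep M (sigma_gen M U {1..k}) (sigma_gen M U {k + r..p}) \<le> alpha_mix M U r"
    unfolding alpha_mix_def by (intro cSup_upper bdd_aboveI[of _ 1]) (use assms le1 in blast)+
  show "alpha_mix M U r \<le> 1"
    unfolding alpha_mix_def by (intro cSup_least) (use assms le1 in blast)+
  show "0 \<le> alpha_mix M U r"
    using 1 le[OF emp emp, of "{1..k}" "{k + r..p}"] by simp
  show "\<bar>prob (A \<inter> B) - prob A * prob B\<bar> \<le> alpha_mix M U r"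
    if "A \<in> sets (gen {1..k})" "B \<in> sets (gen {k + r..p})"
    using le[of A "{1..k}" B "{k + r..p}"] 1 that by (simp add: sets_gen)
qed

lemmas alpha_nonneg = alpha_dep_le_alpha_mix(2)[OF order_refl order_refl]
lemmas alpha_le_1 = alpha_dep_le_alpha_mix(3)[OF order_refl order_refl]

text \<open>The coefficients are at most 1 and the exponent \<open>\<delta> / (2 + \<delta>)\<close>
  is below 1, so the summability of the powers passes to the coefficients themselves; monotonicity
  does the rest.\<close>

lemma alpha_little_o: "(\<lambda>r. real r * alpha_mix M U (r + 1)) \<longlonglongrightarrow> 0"
proof (rule decreasing_summable_imp_little_o)
  show "summable (\<lambda>r. alpha_mix M U (r + 1))"
  proof (rule summable_comparison_test[OF _ alpha_powr_summable], intro exI allI impI)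
    fix r
    have "alpha_mix M U (r + 1) powr 1 \<le> alpha_mix M U (r + 1) powr (\<delta> / (2 + \<delta>))"
      using alpha_nonneg[of "r + 1"] alpha_le_1[of "r + 1"] \<delta>_pos by (intro powr_mono') auto
    then show "norm (alpha_mix M U (r + 1)) \<le> alpha_mix M U (r + 1) powr (\<delta> / (2 + \<delta>))"
      using alpha_nonneg[of "r + 1"] by simp
  qed
  show "alpha_mix M U (n + 1) \<le> alpha_mix M U (m + 1)" if "m \<le> n" for m n
    by (rule lift_Suc_antimono_le[OF _ that]) (use alpha_decreasing in auto)
qed (rule alpha_nonneg)

lemma
  fixes F :: "(nat \<Rightarrow> real) \<Rightarrow> 'b :: {banach, second_countable_topology}"
  assumes [measurable]: "F \<in> borel_measurable (Pi\<^sub>M {1..m} (\<lambda>_. borel))"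
  shows integral_shift: "expectation (\<lambda>\<omega>. F (\<lambda>j\<in>{1..m}. U (j + k) \<omega>)) = expectation (\<lambda>\<omega>. F (\<lambda>j\<in>{1..m}. U j \<omega>))"
    and integrable_shift: "integrable M (\<lambda>\<omega>. F (\<lambda>j\<in>{1..m}. U (j + k) \<omega>)) \<longleftrightarrow> integrable M (\<lambda>\<omega>. F (\<lambda>j\<in>{1..m}. U j \<omega>))"
proof -
  have [measurable]: "(\<lambda>\<omega>. \<lambda>j\<in>{1..m}. U (j + k) \<omega>) \<in> M \<rightarrow>\<^sub>M Pi\<^sub>M {1..m} (\<lambda>_. borel)" for k
    by (rule measurable_restrict) measurable
  have m0: "(\<lambda>\<omega>. \<lambda>j\<in>{1..m}. U j \<omega>) \<in> M \<rightarrow>\<^sub>M Pi\<^sub>M {1..m} (\<lambda>_. borel)"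
    by (rule measurable_restrict) measurable
  have eq: "distr M (Pi\<^sub>M {1..m} (\<lambda>_. borel)) (\<lambda>\<omega>. \<lambda>j\<in>{1..m}. U (j + k) \<omega>) =
        distr M (Pi\<^sub>M {1..m} (\<lambda>_. borel)) (\<lambda>\<omega>. \<lambda>j\<in>{1..m}. U j \<omega>)"
    using stationary unfolding stationary_seq_def by blast
  show "expectation (\<lambda>\<omega>. F (\<lambda>j\<in>{1..m}. U (j + k) \<omega>)) = expectation (\<lambda>\<omega>. F (\<lambda>j\<in>{1..m}. U j \<omega>))"
    using arg_cong[OF eq, of "\<lambda>N. integral\<^sup>L N F"] by (simp add: integral_distr m0 del: One_nat_def)
  show "integrable M (\<lambda>\<omega>. F (\<lambda>j\<in>{1..m}. U (j + k) \<omega>)) \<longleftrightarrow> integrable M (\<lambda>\<omega>. F (\<lambda>j\<in>{1..m}. U j \<omega>))"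
    using arg_cong[OF eq, of "\<lambda>N. integrable N F"] by (simp add: integrable_distr_eq m0 del: One_nat_def)
qed

text \<open>A pair at distance \<open>k\<close> is a function of a segment of length
  \<open>1 + k\<close> shifted by \<open>i - 1\<close>. The case \<open>k = 0\<close> covers single
  variables.\<close>

lemma
  fixes h :: "real \<Rightarrow> real \<Rightarrow> real"
  assumes [measurable]: "case_prod h \<in> borel_measurable (borel \<Otimes>\<^sub>M borel)" and "i \<ge> 1"
  shows expectation_pair: "expectation (\<lambda>\<omega>. h (U i \<omega>) (U (i + k) \<omega>)) = expectation (\<lambda>\<omega>. h (U 1 \<omega>) (U (1 + k) \<omega>))"
    and integrable_pair: "integrable M (\<lambda>\<omega>. h (U i \<omega>) (U (i + k) \<omega>)) \<longleftrightarrow> integrable M (\<lambda>\<omega>. h (U 1 \<omega>) (U (1 + k) \<omega>))"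
proof -
  define F where "F x = h (x 1) (x (1 + k))" for x :: "nat \<Rightarrow> real"
  have F: "F \<in> borel_measurable (Pi\<^sub>M {1..1 + k} (\<lambda>_. borel))"
    unfolding F_def by measurable
  have i: "1 + (i - 1) = i" "1 + k + (i - 1) = i + k" using assms(2) by auto
  show "expectation (\<lambda>\<omega>. h (U i \<omega>) (U (i + k) \<omega>)) = expectation (\<lambda>\<omega>. h (U 1 \<omega>) (U (1 + k) \<omega>))"
    using integral_shift[OF F, of "i - 1"] i by (simp add: F_def add.commute)
  show "integrable M (\<lambda>\<omega>. h (U i \<omega>) (U (i + k) \<omega>)) \<longleftrightarrow> integrable M (\<lambda>\<omega>. h (U 1 \<omega>) (U (1 + k) \<omega>))"
    using integrable_shift[OF F, of "i - 1"] i by (simp add: F_def add.commute)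
qed

section \<open>Autocovariances and second moments of centred sums\<close>

definition mean :: "(real \<Rightarrow> real) \<Rightarrow> real" where
  "mean h = expectation (\<lambda>\<omega>. h (U 1 \<omega>))"

definition acov :: "(real \<Rightarrow> real) \<Rightarrow> nat \<Rightarrow> real" where
  "acov h k = expectation (\<lambda>\<omega>. h (U 1 \<omega>) * h (U (1 + k) \<omega>)) - (mean h)\<^sup>2"

text \<open>The long-run variance, a sum over all integer lags folded by symmetry.\<close>

definition acov_sum :: "(real \<Rightarrow> real) \<Rightarrow> real" where
  "acov_sum h = acov h 0 + 2 * (\<Sum>k. acov h (k + 1))"

definition acov_abs_sum :: "(real \<Rightarrow> real) \<Rightarrow> real" where
  "acov_abs_sum h = \<bar>acov h 0\<bar> + 2 * (\<Sum>k. \<bar>acov h (k + 1)\<bar>)"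

text \<open>One class containing the identity, its truncations, the remainders and 0, so that every
  bound in terms of moments of \<open>U 1\<close> holds for all of them with the same
  constant.\<close>

definition id_dominated :: "(real \<Rightarrow> real) \<Rightarrow> bool" where
  "id_dominated h \<longleftrightarrow> h \<in> borel_measurable borel \<and> (\<forall>x. \<bar>h x\<bar> \<le> \<bar>x\<bar>)"

lemma moment_U:
  assumes "i \<ge> 1"
  shows "integrable M (\<lambda>\<omega>. \<bar>U i \<omega>\<bar> powr (2 + \<delta>))"
    and "expectation (\<lambda>\<omega>. \<bar>U i \<omega>\<bar> powr (2 + \<delta>)) = expectation (\<lambda>\<omega>. \<bar>U 1 \<omega>\<bar> powr (2 + \<delta>))"
proof -
  have m: "(\<lambda>(x, y :: real). \<bar>x\<bar> powr (2 + \<delta>)) \<in> borel_measurable (borel \<Otimes>\<^sub>M borel)"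
    by measurable
  show "integrable M (\<lambda>\<omega>. \<bar>U i \<omega>\<bar> powr (2 + \<delta>))"
    using integrable_pair[OF m assms] moment by simp
  show "expectation (\<lambda>\<omega>. \<bar>U i \<omega>\<bar> powr (2 + \<delta>)) = expectation (\<lambda>\<omega>. \<bar>U 1 \<omega>\<bar> powr (2 + \<delta>))"
    using expectation_pair[OF m assms] by simp
qed

lemma U_sq_integrable:
  assumes "i \<ge> 1"
  shows "integrable M (\<lambda>\<omega>. (U i \<omega>)\<^sup>2)"
proof (rule Bochner_Integration.integrable_bound)
  show "integrable M (\<lambda>\<omega>. 1 + \<bar>U i \<omega>\<bar> powr (2 + \<delta>))" using moment_U[OF assms] by simp
  have "x\<^sup>2 \<le> 1 + \<bar>x\<bar> powr (2 + \<delta>)" for x :: real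
  proof (cases "\<bar>x\<bar> \<ge> 1")
    case True
    then have "\<bar>x\<bar> ^ 2 = \<bar>x\<bar> powr 2" by (subst powr_realpow[symmetric]) auto
    then show ?thesis using True powr_mono[of 2 "2 + \<delta>" "\<bar>x\<bar>"] \<delta>_pos by simp
  next
    case False
    then have "x\<^sup>2 \<le> 1" by (simp add: abs_square_le_1)
    then show ?thesis using powr_ge_zero[of "\<bar>x\<bar>" "2 + \<delta>"] by linarith
  qed
  then show "AE \<omega> in M. norm ((U i \<omega>)\<^sup>2) \<le> norm (1 + \<bar>U i \<omega>\<bar> powr (2 + \<delta>))"
    by (auto intro: order_trans[OF _ abs_ge_self])
qed measurable

lemma product_integrable:
  assumes "id_dominated g" "id_dominated h" "i \<ge> 1" "j \<ge> 1"
  shows "integrable M (\<lambda>\<omega>. g (U i \<omega>) * h (U j \<omega>))"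
proof (rule Bochner_Integration.integrable_bound)
  have [measurable]: "g \<in> borel_measurable borel" "h \<in> borel_measurable borel"
    and gh: "\<And>x. \<bar>g x\<bar> \<le> \<bar>x\<bar>" "\<And>x. \<bar>h x\<bar> \<le> \<bar>x\<bar>"
    using assms by (auto simp: id_dominated_def)
  show "integrable M (\<lambda>\<omega>. (U i \<omega>)\<^sup>2 + (U j \<omega>)\<^sup>2)"
    using U_sq_integrable assms by simp
  have "\<bar>g x * h y\<bar> \<le> x\<^sup>2 + y\<^sup>2" for x y
  proof -
    have "\<bar>g x * h y\<bar> \<le> \<bar>x\<bar> * \<bar>y\<bar>"
      unfolding abs_mult by (intro mult_mono gh) auto
    moreover have "2 * (\<bar>x\<bar> * \<bar>y\<bar>) \<le> x\<^sup>2 + y\<^sup>2"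
      using sum_squares_bound[of "\<bar>x\<bar>" "\<bar>y\<bar>"] by simp
    moreover have "0 \<le> \<bar>x\<bar> * \<bar>y\<bar>" by simp
    ultimately show ?thesis by linarith
  qed
  then show "AE \<omega> in M. norm (g (U i \<omega>) * h (U j \<omega>)) \<le> norm ((U i \<omega>)\<^sup>2 + (U j \<omega>)\<^sup>2)"
    by simp
  show "(\<lambda>\<omega>. g (U i \<omega>) * h (U j \<omega>)) \<in> borel_measurable M" by measurable
qed

lemma id_dominated_integrable:
  assumes "id_dominated h" "i \<ge> 1"
  shows "integrable M (\<lambda>\<omega>. h (U i \<omega>))"
proof (rule square_integrable_imp_integrable)
  have [measurable]: "h \<in> borel_measurable borel"
    using assms(1) by (simp add: id_dominated_def)
  show "(\<lambda>\<omega>. h (U i \<omega>)) \<in> borel_measurable M" by measurable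
  show "integrable M (\<lambda>\<omega>. (h (U i \<omega>))\<^sup>2)"
    unfolding power2_eq_square by (rule product_integrable[OF assms(1,1,2,2)])
qed

lemma mean_eq:
  assumes "id_dominated h" "i \<ge> 1"
  shows "expectation (\<lambda>\<omega>. h (U i \<omega>)) = mean h"
proof -
  have [measurable]: "h \<in> borel_measurable borel"
    using assms(1) by (simp add: id_dominated_def)
  have "(\<lambda>(x, y). h x) \<in> borel_measurable (borel \<Otimes>\<^sub>M (borel :: real measure))"
    by measurable
  then show ?thesis
    using expectation_pair[OF _ assms(2), of "\<lambda>x y. h x" 0] by (simp add: mean_def)
qed

text \<open>On the natural numbers, \<open>(i - j) + (j - i)\<close> is the distance of \<open>i\<close> and \<open>j\<close>.\<close>

lemma product_expectation:
  assumes "id_dominated h" "i \<ge> 1" "j \<ge> 1"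
  shows "expectation (\<lambda>\<omega>. (h (U i \<omega>) - mean h) * (h (U j \<omega>) - mean h)) = acov h ((i - j) + (j - i))"
proof -
  have [measurable]: "h \<in> borel_measurable borel"
    using assms(1) by (simp add: id_dominated_def)
  have *: "expectation (\<lambda>\<omega>. h (U i \<omega>) * h (U j \<omega>)) - (mean h)\<^sup>2 = acov h (j - i)" if "1 \<le> i" "i \<le> j" for i j
    using expectation_pair[of "\<lambda>x y. h x * h y" i "j - i"] that by (simp add: acov_def)
  have "expectation (\<lambda>\<omega>. h (U i \<omega>) * h (U j \<omega>)) - (mean h)\<^sup>2 = acov h ((i - j) + (j - i))"
    using *[of i j] *[of j i] assms by (cases "i \<le> j") (auto simp: mult.commute)
  moreover have "expectation (\<lambda>\<omega>. (h (U i \<omega>) - mean h) * (h (U j \<omega>) - mean h)) =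
      expectation (\<lambda>\<omega>. h (U i \<omega>) * h (U j \<omega>) - mean h * h (U i \<omega>) - mean h * h (U j \<omega>) + (mean h)\<^sup>2)"
    by (intro Bochner_Integration.integral_cong refl) (simp add: algebra_simps power2_eq_square)
  moreover have "\<dots> = expectation (\<lambda>\<omega>. h (U i \<omega>) * h (U j \<omega>)) - (mean h)\<^sup>2"
    using product_integrable[OF assms(1,1,2,3)] id_dominated_integrable[OF assms(1,2)] id_dominated_integrable[OF assms(1,3)]
      mean_eq[OF assms(1,2)] mean_eq[OF assms(1,3)] by (simp add: prob_space power2_eq_square)
  ultimately show ?thesis by simp
qed

definition mixing_const :: real where
  "mixing_const = (let B = expectation (\<lambda>\<omega>. \<bar>U 1 \<omega>\<bar> powr (2 + \<delta>)) in 4 + 5 * B + B\<^sup>2)"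

text \<open>The bound depends on \<open>h\<close> only through the domination by the identity; this
  uniformity later provides the summable majorant for truncation limits.\<close>

lemma acov_bound:
  assumes "id_dominated h"
  shows "\<bar>acov h (k + 1)\<bar> \<le> mixing_const * alpha_mix M U (k + 1) powr (\<delta> / (2 + \<delta>))"
proof -
  define B where "B = expectation (\<lambda>\<omega>. \<bar>U 1 \<omega>\<bar> powr (2 + \<delta>))"
  have [measurable]: "h \<in> borel_measurable borel" and h: "\<And>x. \<bar>h x\<bar> \<le> \<bar>x\<bar>"
    using assms by (auto simp: id_dominated_def)
  have mom: "integrable M (\<lambda>\<omega>. \<bar>h (U i \<omega>)\<bar> powr (2 + \<delta>))" "expectation (\<lambda>\<omega>. \<bar>h (U i \<omega>)\<bar> powr (2 + \<delta>)) \<le> B"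
    if "i \<ge> 1" for i
  proof -
    have le: "\<bar>h x\<bar> powr (2 + \<delta>) \<le> \<bar>x\<bar> powr (2 + \<delta>)" for x
      using h \<delta>_pos by (intro powr_mono2) auto
    show 1: "integrable M (\<lambda>\<omega>. \<bar>h (U i \<omega>)\<bar> powr (2 + \<delta>))"
      using le by (intro Bochner_Integration.integrable_bound[OF moment_U(1)[OF that]]) auto
    show "expectation (\<lambda>\<omega>. \<bar>h (U i \<omega>)\<bar> powr (2 + \<delta>)) \<le> B"
      unfolding B_def moment_U(2)[OF that, symmetric]
      by (intro integral_mono 1 moment_U[OF that] le)
  qed
  have *: "\<bar>acov h (k + 1)\<bar> \<le> mixing_const * a powr (\<delta> / (2 + \<delta>))"
    if a: "alpha_mix M U (k + 1) \<le> a" "0 < a" "a \<le> 1" for a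
  proof -
    have "\<bar>expectation (\<lambda>\<omega>. h (U 1 \<omega>) * h (U (1 + (k + 1)) \<omega>)) - expectation (\<lambda>\<omega>. h (U 1 \<omega>)) * expectation (\<lambda>\<omega>. h (U (1 + (k + 1)) \<omega>))\<bar>
       \<le> (4 + 5 * B + B\<^sup>2) * a powr (\<delta> / (2 + \<delta>))"
    proof (rule covariance_moment[OF subalgebra_gen subalgebra_gen])
      show "\<bar>prob (A \<inter> B) - prob A * prob B\<bar> \<le> a"
        if "A \<in> sets (gen {1..1})" "B \<in> sets (gen {1 + (k + 1)..1 + (k + 1)})" for A B
        using alpha_dep_le_alpha_mix(4)[OF order_refl order_refl that] a(1) by linarith
      show "(\<lambda>\<omega>. h (U 1 \<omega>)) \<in> borel_measurable (gen {1..1})"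
        "(\<lambda>\<omega>. h (U (1 + (k + 1)) \<omega>)) \<in> borel_measurable (gen {1 + (k + 1)..1 + (k + 1)})"
        by (rule measurable_compose[OF U_measurable_gen]; simp)+
    qed (use a \<delta>_pos mom in auto)
    then show ?thesis
      using mean_eq[OF assms, of "1 + (k + 1)"] mean_eq[OF assms, of 1]
      by (simp add: acov_def mixing_const_def B_def Let_def power2_eq_square)
  qed
  show ?thesis
  proof (cases "alpha_mix M U (k + 1) = 0")
    case True
    \<comment> \<open>The covariance inequality asks for a positive level \<open>a\<close>. A
      vanishing coefficient is therefore replaced by \<open>1 / (n + 1)\<close>, which then tends to
      0.\<close>
    have "(\<lambda>n. mixing_const * (1 / real (Suc n)) powr (\<delta> / (2 + \<delta>))) \<longlonglongrightarrow> mixing_const * 0"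
    proof (intro tendsto_mult tendsto_const)
      have "(\<lambda>n. 1 / real (Suc n)) \<longlonglongrightarrow> 0" by real_asymp
      then show "(\<lambda>n. (1 / real (Suc n)) powr (\<delta> / (2 + \<delta>))) \<longlonglongrightarrow> 0"
        using \<delta>_pos by (intro tendsto_zero_powrI[OF _ tendsto_const]) (auto intro!: always_eventually)
    qed
    then have "\<bar>acov h (k + 1)\<bar> \<le> mixing_const * 0"
      by (rule LIMSEQ_le_const) (use * True in auto)
    then show ?thesis using True by simp
  next
    case False
    then show ?thesis using *[of "alpha_mix M U (k + 1)"] alpha_nonneg[of "k + 1"] alpha_le_1[of "k + 1"] by simp
  qed
qed

lemma mixing_bound_summable: "summable (\<lambda>k. mixing_const * alpha_mix M U (k + 1) powr (\<delta> / (2 + \<delta>)))"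
  by (intro summable_mult alpha_powr_summable)

lemma acov_summable:
  assumes "id_dominated h"
  shows "summable (\<lambda>k. \<bar>acov h (k + 1)\<bar>)" "summable (\<lambda>k. acov h (k + 1))"
proof -
  show "summable (\<lambda>k. \<bar>acov h (k + 1)\<bar>)"
    by (rule summable_comparison_test[OF _ mixing_bound_summable]) (use acov_bound[OF assms] in auto)
  then show "summable (\<lambda>k. acov h (k + 1))" by (rule summable_rabs_cancel)
qed

definition csum :: "(real \<Rightarrow> real) \<Rightarrow> nat set \<Rightarrow> 'a \<Rightarrow> real" where
  "csum h R \<omega> = (\<Sum>j\<in>R. h (U j \<omega>) - mean h)"

lemma csum_sq:
  assumes "id_dominated h" "finite R" "0 \<notin> R"
  shows "integrable M (\<lambda>\<omega>. (csum h R \<omega>)\<^sup>2)"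
    and "expectation (\<lambda>\<omega>. (csum h R \<omega>)\<^sup>2) = (\<Sum>i\<in>R. \<Sum>j\<in>R. acov h ((i - j) + (j - i)))"
proof -
  have R: "i \<ge> 1" if "i \<in> R" for i using that assms(3) by (cases i) auto
  have int: "integrable M (\<lambda>\<omega>. (h (U i \<omega>) - mean h) * (h (U j \<omega>) - mean h))" if "i \<in> R" "j \<in> R" for i j
  proof -
    have "integrable M (\<lambda>\<omega>. h (U i \<omega>) * h (U j \<omega>) - mean h * h (U i \<omega>) - mean h * h (U j \<omega>) + (mean h)\<^sup>2)"
      using product_integrable[OF assms(1,1) R[OF that(1)] R[OF that(2)]]
        id_dominated_integrable[OF assms(1) R[OF that(1)]] id_dominated_integrable[OF assms(1) R[OF that(2)]] by simp
    then show ?thesis by (rule Bochner_Integration.integrable_cong[THEN iffD1, rotated -1]) (simp_all add: algebra_simps power2_eq_square)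
  qed
  have sq: "(csum h R \<omega>)\<^sup>2 = (\<Sum>i\<in>R. \<Sum>j\<in>R. (h (U i \<omega>) - mean h) * (h (U j \<omega>) - mean h))" for \<omega>
    by (simp add: csum_def power2_eq_square sum_product)
  show "integrable M (\<lambda>\<omega>. (csum h R \<omega>)\<^sup>2)"
    unfolding sq by (intro Bochner_Integration.integrable_sum int)
  show "expectation (\<lambda>\<omega>. (csum h R \<omega>)\<^sup>2) = (\<Sum>i\<in>R. \<Sum>j\<in>R. acov h ((i - j) + (j - i)))"
    unfolding sq using int product_expectation[OF assms(1) R R]
    by (simp add: Bochner_Integration.integral_sum Bochner_Integration.integrable_sum)
qed

text \<open>For fixed \<open>i\<close>, the distances to the indices on its left are pairwise
  different, and likewise on its right, so each row of the covariance matrix is bounded by the full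
  sum. The set \<open>R\<close> may have any shape, which is needed for the discarded gaps.\<close>

lemma csum_sq_bound:
  assumes "id_dominated h" "finite R" "0 \<notin> R"
  shows "expectation (\<lambda>\<omega>. (csum h R \<omega>)\<^sup>2) \<le> real (card R) * acov_abs_sum h"
proof -
  define s where "s = (\<Sum>k. \<bar>acov h (k + 1)\<bar>)"
  have part: "(\<Sum>j\<in>J. \<bar>acov h (d j)\<bar>) \<le> s"
    if "J \<subseteq> R" "inj_on d J" "\<And>j. j \<in> J \<Longrightarrow> d j \<ge> 1" for J d
  proof -
    have "(\<Sum>j\<in>J. \<bar>acov h (d j)\<bar>) = (\<Sum>j\<in>J. \<bar>acov h ((d j - 1) + 1)\<bar>)"
    proof (intro sum.cong refl)
      fix j assume "j \<in> J"
      then have "d j - 1 + 1 = d j" using that(3)[of j] by linarith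
      then show "\<bar>acov h (d j)\<bar> = \<bar>acov h ((d j - 1) + 1)\<bar>" by (rule arg_cong[symmetric])
    qed
    also have "\<dots> = (\<Sum>k\<in>(\<lambda>j. d j - 1) ` J. \<bar>acov h (k + 1)\<bar>)"
    proof (rule sum.reindex[symmetric, unfolded comp_def])
      show "inj_on (\<lambda>j. d j - 1) J"
      proof (rule inj_onI)
        fix x y assume "x \<in> J" "y \<in> J" "d x - 1 = d y - 1"
        then have "d x = d y" using that(3)[of x] that(3)[of y] by linarith
        then show "x = y" using that(2) \<open>x \<in> J\<close> \<open>y \<in> J\<close> by (auto dest: inj_onD)
      qed
    qed
    also have "\<dots> \<le> s"
      unfolding s_def
      by (intro sum_le_suminf acov_summable[OF assms(1)]) (use finite_subset[OF that(1) assms(2)] in auto)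
    finally show ?thesis .
  qed
  have "(\<Sum>j\<in>R. acov h ((i - j) + (j - i))) \<le> acov_abs_sum h" if "i \<in> R" for i
  proof -
    have "R = insert i ({j \<in> R. j < i} \<union> {j \<in> R. i < j})" using that by auto
    then have "(\<Sum>j\<in>R. acov h ((i - j) + (j - i))) =
       (\<Sum>j\<in>insert i ({j \<in> R. j < i} \<union> {j \<in> R. i < j}). acov h ((i - j) + (j - i)))" by simp
    also have "\<dots> = acov h 0 + ((\<Sum>j\<in>{j \<in> R. j < i}. acov h ((i - j) + (j - i))) + (\<Sum>j\<in>{j \<in> R. i < j}. acov h ((i - j) + (j - i))))"
      using assms(2) by (subst sum.insert, simp, simp, subst sum.union_disjoint) auto
    also have "\<dots> \<le> \<bar>acov h 0\<bar> + ((\<Sum>j\<in>{j \<in> R. j < i}. \<bar>acov h (i - j)\<bar>) + (\<Sum>j\<in>{j \<in> R. i < j}. \<bar>acov h (j - i)\<bar>))"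
      by (intro add_mono sum_mono) auto
    also have "\<dots> \<le> \<bar>acov h 0\<bar> + (s + s)"
      by (intro add_mono part order_refl) (auto simp: inj_on_def)
    finally show ?thesis by (simp add: acov_abs_sum_def s_def)
  qed
  then have "(\<Sum>i\<in>R. \<Sum>j\<in>R. acov h ((i - j) + (j - i))) \<le> (\<Sum>i\<in>R. acov_abs_sum h)"
    by (intro sum_mono)
  then show ?thesis by (simp add: csum_sq[OF assms])
qed

text \<open>Enlarging the range by one index adds one diagonal term and twice the lags from 1 to
  \<open>b\<close>. These increments converge to the long-run variance, and so do their
  averages.\<close>

lemma csum_sq_asymp:
  assumes "id_dominated h"
  shows "(\<lambda>b. expectation (\<lambda>\<omega>. (csum h {1..b} \<omega>)\<^sup>2) / real b) \<longlonglongrightarrow> acov_sum h"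
proof -
  define V where "V b = (\<Sum>i\<in>{1..b}. \<Sum>j\<in>{1..b}. acov h ((i - j) + (j - i)))" for b
  define d where "d b = acov h 0 + 2 * (\<Sum>k<b. acov h (k + 1))" for b
  have V_Suc: "V (Suc b) = V b + d b" for b
  proof -
    have shift: "(\<Sum>i\<in>{1..b}. acov h (Suc b - i)) = (\<Sum>k<b. acov h (k + 1))"
      by (rule sum.reindex_bij_witness[of _ "\<lambda>k. b - k" "\<lambda>i. b - i"]) (auto simp: Suc_diff_le)
    have "V (Suc b) = V b + (\<Sum>i\<in>{1..b}. acov h ((i - Suc b) + (Suc b - i))) + (\<Sum>j\<in>{1..b}. acov h ((Suc b - j) + (j - Suc b))) + acov h 0"
      unfolding V_def by (simp add: sum.distrib)
    also have "(\<Sum>i\<in>{1..b}. acov h ((i - Suc b) + (Suc b - i))) = (\<Sum>i\<in>{1..b}. acov h (Suc b - i))"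
      by (intro sum.cong) auto
    also have "(\<Sum>i\<in>{1..b}. acov h ((Suc b - i) + (i - Suc b))) = (\<Sum>i\<in>{1..b}. acov h (Suc b - i))"
      by (intro sum.cong) auto
    finally show ?thesis unfolding shift d_def by simp
  qed
  have V: "V b = (\<Sum>k<b. d k)" for b
    by (induction b) (simp_all add: V_Suc, simp add: V_def)
  have "d \<longlonglongrightarrow> acov_sum h"
    unfolding d_def[abs_def] acov_sum_def
    by (intro tendsto_intros summable_LIMSEQ acov_summable[OF assms])
  then have "(\<lambda>b. V b / real b) \<longlonglongrightarrow> acov_sum h"
    unfolding V by (rule cesaro_mean)
  moreover have "V b = expectation (\<lambda>\<omega>. (csum h {1..b} \<omega>)\<^sup>2)" for b
    unfolding V_def by (subst csum_sq[OF assms]) auto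
  ultimately show ?thesis by simp
qed

end

section \<open>Characteristic functions of block sums\<close>

lemma norm_iexp_diff_le: "cmod (iexp x - iexp y) \<le> \<bar>x - y\<bar>"
proof -
  have "iexp x - iexp y = iexp y * (iexp (x - y) - 1)"
    by (simp add: algebra_simps exp_add[symmetric])
  then have "cmod (iexp x - iexp y) = cmod (iexp (x - y) - 1)"
    by (simp add: norm_mult)
  also have "\<dots> \<le> \<bar>x - y\<bar>"
    using iexp_approx1[of "x - y" 0] by simp
  finally show ?thesis .
qed

text \<open>A quadratic error is small enough to be incurred once per block, since the number of
  blocks times \<open>x\<close> stays bounded while \<open>x\<close> tends to 0.\<close>

lemma abs_one_minus_exp_minus_le:
  fixes x :: real
  assumes "0 \<le> x"
  shows "\<bar>(1 - x) - exp (- x)\<bar> \<le> x\<^sup>2"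
proof -
  have "exp (- x) \<le> 1 / (1 + x)"
    using assms exp_ge_add_one_self[of x] by (simp add: exp_minus field_simps)
  also have "\<dots> \<le> 1 - x + x\<^sup>2"
    using assms by (simp add: field_simps power2_eq_square power3_eq_cube)
  finally show ?thesis using exp_ge_add_one_self[of "- x"] by simp
qed

text \<open>The scheme of both limit passages: the inner limit in \<open>p\<close> leaves an error
  \<open>e s\<close>, where \<open>s\<close> is the block ratio in one use and the truncation level
  in the other.\<close>

lemma tendsto_zero_iterated:
  fixes a :: "nat \<Rightarrow> real"
  assumes nonneg: "\<And>p. a p \<ge> 0"
    and le: "\<And>s. \<forall>\<^sub>F p in sequentially. a p \<le> H s p"
    and H: "\<And>s. H s \<longlonglongrightarrow> e s" and e: "e \<longlonglongrightarrow> (0 :: real)"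
  shows "a \<longlonglongrightarrow> 0"
proof (rule LIMSEQ_I)
  fix \<epsilon> :: real assume "\<epsilon> > 0"
  then have "\<forall>\<^sub>F s in sequentially. e s < \<epsilon>" using order_tendstoD(2)[OF e] by blast
  then obtain s where "e s < \<epsilon>" by (auto simp: eventually_sequentially)
  then have "\<forall>\<^sub>F p in sequentially. H s p < \<epsilon>" using order_tendstoD(2)[OF H] by blast
  with le[of s] have "\<forall>\<^sub>F p in sequentially. norm (a p - 0) < \<epsilon>"
    by eventually_elim (use nonneg in auto)
  then show "\<exists>no. \<forall>n\<ge>no. norm (a n - 0) < \<epsilon>" by (simp add: eventually_sequentially)
qed

context stationary_mixing
begin

lemma csum_measurable [measurable]:
  assumes "id_dominated h"
  shows "csum h R \<in> borel_measurable M"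
proof -
  have [measurable]: "h \<in> borel_measurable borel" using assms by (simp add: id_dominated_def)
  show ?thesis unfolding csum_def[abs_def] by measurable
qed

lemma csum_measurable_gen:
  assumes "id_dominated h" "R \<subseteq> J"
  shows "csum h R \<in> borel_measurable (gen J)"
proof -
  have [measurable]: "h \<in> borel_measurable borel" using assms by (simp add: id_dominated_def)
  show ?thesis
    unfolding csum_def[abs_def] by (rule block_measurable_gen[OF assms(2)]) measurable
qed

lemma char_csum_shift:
  assumes "id_dominated h"
  shows "expectation (\<lambda>\<omega>. iexp (\<tau> * csum h {i + 1..i + b} \<omega>)) = expectation (\<lambda>\<omega>. iexp (\<tau> * csum h {1..b} \<omega>))"
proof -
  have [measurable]: "h \<in> borel_measurable borel" using assms by (simp add: id_dominated_def)
  define F where "F x = iexp (\<tau> * (\<Sum>j\<in>{1..b}. h (x j) - mean h))" for x :: "nat \<Rightarrow> real"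
  have F: "F \<in> borel_measurable (Pi\<^sub>M {1..b} (\<lambda>_. borel))" unfolding F_def by measurable
  have "csum h {i + 1..i + b} \<omega> = (\<Sum>j\<in>{1..b}. h (U (j + i) \<omega>) - mean h)" for \<omega>
    unfolding csum_def
    by (rule sum.reindex_bij_witness[of _ "\<lambda>j. j + i" "\<lambda>j. j - i"]) auto
  then show ?thesis
    using integral_shift[OF F, of i] by (simp add: F_def csum_def)
qed

lemma iexp_integrable [simp]:
  assumes [measurable]: "f \<in> borel_measurable M"
  shows "integrable M (\<lambda>\<omega>. iexp (f \<omega>))"
  by (rule integrable_const_bound[where B = 1]) auto

text \<open>A non-integrable integrand has expectation 0 by convention, so the bound covers it as
  well.\<close>

lemma char_le_1: "cmod (expectation (\<lambda>\<omega>. iexp (f \<omega>))) \<le> 1"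
proof (cases "integrable M (\<lambda>\<omega>. iexp (f \<omega>))")
  case True
  have "cmod (expectation (\<lambda>\<omega>. iexp (f \<omega>))) \<le> expectation (\<lambda>\<omega>. cmod (iexp (f \<omega>)))"
    by (rule integral_norm_bound)
  then show ?thesis by (simp add: prob_space)
qed (simp add: not_integrable_integral_eq)

text \<open>Splitting off the last block costs one complex covariance. Consecutive blocks have
  endpoints at distance \<open>l + 1\<close>, and since characteristic functions have modulus at
  most 1 the costs simply add up.\<close>

lemma char_blocks:
  assumes h: "id_dominated h"
  shows "cmod (expectation (\<lambda>\<omega>. iexp (\<tau> * (\<Sum>i<k. csum h {i * (b + l) + 1..i * (b + l) + b} \<omega>))) - expectation (\<lambda>\<omega>. iexp (\<tau> * csum h {1..b} \<omega>)) ^ k)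
     \<le> real k * (16 * alpha_mix M U (l + 1))"
proof (induction k)
  case (Suc k)
  define B where "B i = csum h {i * (b + l) + 1..i * (b + l) + b}" for i
  note IH = Suc.IH[folded B_def]
  define \<psi> where "\<psi> = expectation (\<lambda>\<omega>. iexp (\<tau> * csum h {1..b} \<omega>))"
  have \<psi>: "expectation (\<lambda>\<omega>. iexp (\<tau> * B k \<omega>)) = \<psi>"
    unfolding B_def \<psi>_def by (rule char_csum_shift[OF h])
  define X where "X \<omega> = iexp (\<tau> * (\<Sum>i<k. B i \<omega>))" for \<omega>
  define Y where "Y \<omega> = iexp (\<tau> * B k \<omega>)" for \<omega>
  have XY: "iexp (\<tau> * (\<Sum>i<Suc k. B i \<omega>)) = X \<omega> * Y \<omega>" for \<omega>
    by (simp add: X_def Y_def distrib_left exp_add[symmetric])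
  have step: "cmod (expectation (\<lambda>\<omega>. X \<omega> * Y \<omega>) - expectation X * expectation Y) \<le> 16 * alpha_mix M U (l + 1)"
  proof (cases "k = 0")
    case True
    then have "X = (\<lambda>_. 1)" by (simp add: X_def[abs_def])
    then show ?thesis by (simp add: prob_space alpha_nonneg)
  next
    case False
    define q where "q = (k - 1) * (b + l) + b"
    define r where "r = k * (b + l) + b"
    have q: "q + (l + 1) = k * (b + l) + 1"
      using False by (cases k) (auto simp: q_def)
    show ?thesis
    \<comment> \<open>With empty blocks \<open>q\<close> may be 0, and the mixing bound requires a
      nonempty past; but then the new factor is constantly 1.\<close>
    proof (cases "b = 0")
      case True
      then have "Y = (\<lambda>_. 1)" by (simp add: Y_def[abs_def] B_def csum_def)
      then show ?thesis by (simp add: prob_space alpha_nonneg)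
    next
      case b: False
      have sub: "{i * (b + l) + 1..i * (b + l) + b} \<subseteq> {1..q}" if "i < k" for i
      proof -
        have "i * (b + l) \<le> (k - 1) * (b + l)" using that by (intro mult_right_mono) auto
        then show ?thesis by (auto simp: q_def)
      qed
      have [measurable]: "B i \<in> borel_measurable (gen {1..q})" if "i < k" for i
        unfolding B_def by (rule csum_measurable_gen[OF h sub[OF that]])
      have [measurable]: "B k \<in> borel_measurable (gen {q + (l + 1)..r})"
        unfolding B_def by (rule csum_measurable_gen[OF h]) (unfold q r_def, simp)
      show ?thesis
      proof (rule covariance_complex[OF subalgebra_gen subalgebra_gen])
        show "\<bar>prob (A \<inter> A') - prob A * prob A'\<bar> \<le> alpha_mix M U (l + 1)"
          if "A \<in> sets (gen {1..q})" "A' \<in> sets (gen {q + (l + 1)..r})" for A A'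
          by (rule alpha_dep_le_alpha_mix(4)[OF _ _ that]) (use b q in \<open>auto simp: q_def r_def\<close>)
        show "X \<in> borel_measurable (gen {1..q})" unfolding X_def[abs_def] by measurable
        show "Y \<in> borel_measurable (gen {q + (l + 1)..r})" unfolding Y_def[abs_def] by measurable
      qed (simp_all add: X_def Y_def)
    qed
  qed
  have "expectation (\<lambda>\<omega>. X \<omega> * Y \<omega>) - \<psi> ^ Suc k =
      (expectation (\<lambda>\<omega>. X \<omega> * Y \<omega>) - expectation X * expectation Y) + (expectation X - \<psi> ^ k) * \<psi>"
    using \<psi> by (simp add: Y_def[abs_def] algebra_simps)
  then have "cmod (expectation (\<lambda>\<omega>. X \<omega> * Y \<omega>) - \<psi> ^ Suc k) \<le>
      cmod (expectation (\<lambda>\<omega>. X \<omega> * Y \<omega>) - expectation X * expectation Y) + cmod (expectation X - \<psi> ^ k) * cmod \<psi>"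
    by (metis norm_triangle_ineq norm_mult)
  also have "\<dots> \<le> 16 * alpha_mix M U (l + 1) + real k * (16 * alpha_mix M U (l + 1)) * 1"
    using IH char_le_1[of "\<lambda>\<omega>. \<tau> * csum h {1..b} \<omega>"] alpha_nonneg[of "l + 1"]
    by (intro add_mono step mult_mono) (auto simp: X_def[abs_def] \<psi>_def)
  finally show ?case unfolding B_def[symmetric] XY \<psi>_def[symmetric] by (simp add: algebra_simps)
qed (simp add: prob_space)

lemma csum_expectation:
  assumes "id_dominated h" "0 \<notin> R"
  shows "expectation (csum h R) = 0" "integrable M (csum h R)"
proof -
  have R: "i \<ge> 1" if "i \<in> R" for i using that assms(2) by (cases i) auto
  show "integrable M (csum h R)"
    unfolding csum_def[abs_def] using id_dominated_integrable[OF assms(1) R] by auto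
  show "expectation (csum h R) = 0"
    unfolding csum_def[abs_def]
    using id_dominated_integrable[OF assms(1) R] mean_eq[OF assms(1) R] by (simp add: prob_space)
qed

text \<open>Boundedness enters here:
  \<open>\<bar>csum h {1..b} \<omega>\<bar> \<le> 2 * K * b\<close> trades one factor of the third
  absolute moment for the block length, leaving the variance.\<close>

lemma char_block_approx:
  fixes b :: nat
  assumes h: "id_dominated h" and K: "\<And>x. \<bar>h x\<bar> \<le> K"
  defines "V \<equiv> expectation (\<lambda>\<omega>. (csum h {1..b} \<omega>)\<^sup>2)"
  shows "cmod (expectation (\<lambda>\<omega>. iexp (\<tau> * csum h {1..b} \<omega>)) - of_real (1 - \<tau>\<^sup>2 * V / 2)) \<le> \<bar>\<tau>\<bar> ^ 3 * (2 * K * real b) * V / 6"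
proof -
  let ?X = "csum h {1..b}"
  have meas [measurable]: "?X \<in> borel_measurable M" by (rule csum_measurable[OF h])
  have int2: "integrable M (\<lambda>\<omega>. (?X \<omega>)\<^sup>2)" by (rule csum_sq[OF h]) auto
  have K0: "K \<ge> 0" using K[of 0] by simp
  have E0: "expectation ?X = 0" "integrable M ?X" using csum_expectation[OF h, of "{1..b}"] by auto
  have charX: "char (distr M borel ?X) \<tau> = expectation (\<lambda>\<omega>. iexp (\<tau> * ?X \<omega>))"
    unfolding char_def by (rule integral_distr[OF meas]) measurable
  have var: "variance ?X = V" unfolding E0(1) V_def by simp
  have "\<bar>mean h\<bar> \<le> K"
    unfolding mean_def using id_dominated_integrable[OF h, of 1] K
    by (intro integral_abs_bound[THEN order_trans] integral_le_const) auto
  then have b: "\<bar>?X \<omega>\<bar> \<le> 2 * K * real b" for \<omega>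
  proof -
    have "\<bar>?X \<omega>\<bar> \<le> (\<Sum>j\<in>{1..b}. 2 * K)"
      unfolding csum_def
    proof (intro order_trans[OF sum_abs] sum_mono)
      fix j
      show "\<bar>h (U j \<omega>) - mean h\<bar> \<le> 2 * K"
        using K[of "U j \<omega>"] \<open>\<bar>mean h\<bar> \<le> K\<close> by linarith
    qed
    then show ?thesis by (simp add: mult.commute)
  qed
  have "cmod (char (distr M borel ?X) \<tau> - of_real (1 - \<tau>\<^sup>2 * V / 2)) \<le>
      (\<tau>\<^sup>2 / 6) * expectation (\<lambda>\<omega>. min (6 * (?X \<omega>)\<^sup>2) (\<bar>\<tau>\<bar> * \<bar>?X \<omega>\<bar> ^ 3))"
    using char_approx3'[OF meas E0(2) int2 E0(1) var refl, of \<tau>] by simp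
  also have "expectation (\<lambda>\<omega>. min (6 * (?X \<omega>)\<^sup>2) (\<bar>\<tau>\<bar> * \<bar>?X \<omega>\<bar> ^ 3)) \<le> expectation (\<lambda>\<omega>. \<bar>\<tau>\<bar> * (2 * K * real b) * (?X \<omega>)\<^sup>2)"
  proof (rule integral_mono)
    show "integrable M (\<lambda>\<omega>. min (6 * (?X \<omega>)\<^sup>2) (\<bar>\<tau>\<bar> * \<bar>?X \<omega>\<bar> ^ 3))"
      by (rule Bochner_Integration.integrable_bound[where f = "\<lambda>\<omega>. 6 * (?X \<omega>)\<^sup>2"]) (use int2 in \<open>auto simp del: One_nat_def\<close>)
    show "min (6 * (?X \<omega>)\<^sup>2) (\<bar>\<tau>\<bar> * \<bar>?X \<omega>\<bar> ^ 3) \<le> \<bar>\<tau>\<bar> * (2 * K * real b) * (?X \<omega>)\<^sup>2" for \<omega>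
    proof -
      have "\<bar>?X \<omega>\<bar> ^ 3 = \<bar>?X \<omega>\<bar> * (?X \<omega>)\<^sup>2" by (simp add: power3_eq_cube power2_eq_square flip: abs_mult)
      also have "\<dots> \<le> (2 * K * real b) * (?X \<omega>)\<^sup>2" by (intro mult_right_mono b) auto
      finally have "\<bar>\<tau>\<bar> * \<bar>?X \<omega>\<bar> ^ 3 \<le> \<bar>\<tau>\<bar> * ((2 * K * real b) * (?X \<omega>)\<^sup>2)" by (intro mult_left_mono) auto
      then show ?thesis by (simp add: mult.assoc min.coboundedI2)
    qed
  qed (use int2 in simp)
  also have "\<tau>\<^sup>2 / 6 * \<dots> = \<bar>\<tau>\<bar> ^ 3 * (2 * K * real b) * V / 6"
    by (simp add: V_def power3_eq_cube power2_eq_square flip: abs_mult)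
  finally show ?thesis
    unfolding charX by (simp add: mult_left_mono)
qed

text \<open>Jensen's inequality, in the form that the variance of the absolute value is
  nonnegative.\<close>

lemma expectation_abs_csum:
  assumes h: "id_dominated h" and fin: "finite R" "0 \<notin> R"
  shows "expectation (\<lambda>\<omega>. \<bar>csum h R \<omega>\<bar>) \<le> sqrt (real (card R) * acov_abs_sum h)"
proof (rule real_le_rsqrt)
  have "(expectation (\<lambda>\<omega>. \<bar>csum h R \<omega>\<bar>))\<^sup>2 \<le> expectation (\<lambda>\<omega>. \<bar>csum h R \<omega>\<bar>\<^sup>2)"
    using variance_positive[of "\<lambda>\<omega>. \<bar>csum h R \<omega>\<bar>"] variance_eq[of "\<lambda>\<omega>. \<bar>csum h R \<omega>\<bar>"]
      csum_expectation(2)[OF h fin(2)] csum_sq(1)[OF h fin] by simp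
  also have "\<dots> \<le> real (card R) * acov_abs_sum h"
    using csum_sq_bound[OF h fin] by simp
  finally show "(expectation (\<lambda>\<omega>. \<bar>csum h R \<omega>\<bar>))\<^sup>2 \<le> real (card R) * acov_abs_sum h" .
qed

text \<open>Because \<open>iexp\<close> is 1-Lipschitz, dropping indices costs the mean absolute
  value of their centred sum, of the order of the square root of their number.\<close>

lemma char_remove_indices:
  assumes h: "id_dominated h" and "R' \<subseteq> R" "finite R" "0 \<notin> R"
  shows "cmod (expectation (\<lambda>\<omega>. iexp (\<tau> * csum h R \<omega>)) - expectation (\<lambda>\<omega>. iexp (\<tau> * csum h R' \<omega>)))
      \<le> \<bar>\<tau>\<bar> * sqrt (real (card R - card R') * acov_abs_sum h)"
proof -
  let ?D = "csum h (R - R')"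
  have fin: "finite (R - R')" "0 \<notin> R - R'" using assms by auto
  have D: "csum h R \<omega> - csum h R' \<omega> = ?D \<omega>" for \<omega>
    using sum.subset_diff[OF assms(2,3), of "\<lambda>j. h (U j \<omega>) - mean h"] by (simp add: csum_def)
  note [measurable] = csum_measurable[OF h]
  have "cmod (expectation (\<lambda>\<omega>. iexp (\<tau> * csum h R \<omega>)) - expectation (\<lambda>\<omega>. iexp (\<tau> * csum h R' \<omega>)))
     = cmod (expectation (\<lambda>\<omega>. iexp (\<tau> * csum h R \<omega>) - iexp (\<tau> * csum h R' \<omega>)))"
    by (subst Bochner_Integration.integral_diff) (auto intro!: iexp_integrable simp del: of_real_mult)
  also have "\<dots> \<le> expectation (\<lambda>\<omega>. cmod (iexp (\<tau> * csum h R \<omega>) - iexp (\<tau> * csum h R' \<omega>)))"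
    by (rule integral_norm_bound)
  also have "\<dots> \<le> expectation (\<lambda>\<omega>. \<bar>\<tau>\<bar> * \<bar>?D \<omega>\<bar>)"
  proof (rule integral_mono)
    show "cmod (iexp (\<tau> * csum h R \<omega>) - iexp (\<tau> * csum h R' \<omega>)) \<le> \<bar>\<tau>\<bar> * \<bar>?D \<omega>\<bar>" for \<omega>
      using norm_iexp_diff_le[of "\<tau> * csum h R \<omega>" "\<tau> * csum h R' \<omega>"]
      by (simp add: right_diff_distrib[symmetric] D abs_mult del: of_real_mult)
    show "integrable M (\<lambda>\<omega>. cmod (iexp (\<tau> * csum h R \<omega>) - iexp (\<tau> * csum h R' \<omega>)))"
      by (intro integrable_norm Bochner_Integration.integrable_diff iexp_integrable) measurable
  qed (use csum_expectation(2)[OF h fin(2)] in auto)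
  also have "\<dots> = \<bar>\<tau>\<bar> * expectation (\<lambda>\<omega>. \<bar>?D \<omega>\<bar>)" by simp
  also have "expectation (\<lambda>\<omega>. \<bar>?D \<omega>\<bar>) \<le> sqrt (real (card R - card R') * acov_abs_sum h)"
    using expectation_abs_csum[OF h fin] assms(2,3) by (simp add: card_Diff_subset finite_subset)
  finally show ?thesis by (simp add: mult_left_mono)
qed

text \<open>The four summands are the prices of dropping gaps and remainder, of making blocks
  independent, of the Taylor expansion of one block, and of replacing \<open>(1 - x) ^ k\<close> by
  an exponential. The premise on \<open>\<tau>\<close> gives \<open>0 \<le> 1 - x \<le> 1\<close>,
  so that differences of powers grow at most linearly in \<open>k\<close>.\<close>

lemma char_csum_bound:
  fixes b k l p :: nat
  assumes h: "id_dominated h" and K: "\<And>x. \<bar>h x\<bar> \<le> K" and kp: "k * (b + l) \<le> p"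
  defines "V \<equiv> expectation (\<lambda>\<omega>. (csum h {1..b} \<omega>)\<^sup>2)"
  assumes x: "\<tau>\<^sup>2 * V / 2 \<le> 1"
  shows "cmod (expectation (\<lambda>\<omega>. iexp (\<tau> * csum h {1..p} \<omega>)) - of_real (exp (- (real k * (\<tau>\<^sup>2 * V / 2))))) \<le>
     \<bar>\<tau>\<bar> * sqrt (real (p - k * b) * acov_abs_sum h) + real k * (16 * alpha_mix M U (l + 1)) +
     real k * (\<bar>\<tau>\<bar> ^ 3 * (2 * K * real b) * V / 6) + real k * (\<tau>\<^sup>2 * V / 2)\<^sup>2"
proof -
  define B where "B i = {i * (b + l) + 1..i * (b + l) + b}" for i :: nat
  define R where "R = (\<Union>i<k. B i)"
  define \<psi> where "\<psi> = expectation (\<lambda>\<omega>. iexp (\<tau> * csum h {1..b} \<omega>))"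
  define x where "x = \<tau>\<^sup>2 * V / 2"
  have V0: "V \<ge> 0" unfolding V_def by simp
  have x01: "0 \<le> x" "x \<le> 1" using x V0 by (simp_all add: x_def)
  have disj: "disjoint_family_on B {..<k}"
  proof (unfold disjoint_family_on_def, intro ballI impI)
    fix i j :: nat assume "i \<noteq> j"
    have "B i \<inter> B j = {}" if "i < j" for i j
    proof -
      have "(i + 1) * (b + l) \<le> j * (b + l)" using that by (intro mult_right_mono) auto
      then show ?thesis by (auto simp: B_def)
    qed
    from this[of i j] this[of j i] show "B i \<inter> B j = {}" using \<open>i \<noteq> j\<close> by (cases i j rule: linorder_cases) auto
  qed
  have R_sub: "R \<subseteq> {1..p}"
  proof
    fix j assume "j \<in> R"
    then obtain i where i: "i < k" "j \<in> B i" by (auto simp: R_def)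
    have "(i + 1) * (b + l) \<le> k * (b + l)" using i(1) by (intro mult_right_mono) auto
    then show "j \<in> {1..p}" using i kp by (auto simp: B_def)
  qed
  have card_R: "card R = k * b"
    unfolding R_def using disj by (subst card_UN_disjoint) (auto simp: disjoint_family_on_def B_def)
  have "csum h R \<omega> = (\<Sum>i<k. csum h (B i) \<omega>)" for \<omega>
    unfolding csum_def R_def using disj by (subst sum.UNION_disjoint) (auto simp: disjoint_family_on_def B_def)
  then have blocks: "cmod (expectation (\<lambda>\<omega>. iexp (\<tau> * csum h R \<omega>)) - \<psi> ^ k) \<le> real k * (16 * alpha_mix M U (l + 1))"
    using char_blocks[OF h, of \<tau> b l k] by (simp add: B_def \<psi>_def)
  have rem: "cmod (expectation (\<lambda>\<omega>. iexp (\<tau> * csum h {1..p} \<omega>)) - expectation (\<lambda>\<omega>. iexp (\<tau> * csum h R \<omega>)))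
      \<le> \<bar>\<tau>\<bar> * sqrt (real (p - k * b) * acov_abs_sum h)"
    using char_remove_indices[OF h R_sub, of \<tau>] by (simp add: card_R)
  have psi1: "cmod \<psi> \<le> 1" unfolding \<psi>_def by (rule char_le_1)
  have "cmod (\<psi> ^ k - of_real (1 - x) ^ k) \<le> real k * cmod (\<psi> - of_real (1 - x))"
    using x01 by (intro norm_power_diff) (auto simp: psi1 simp del: of_real_diff)
  also have "\<dots> \<le> real k * (\<bar>\<tau>\<bar> ^ 3 * (2 * K * real b) * V / 6)"
    using char_block_approx[OF h K, where \<tau> = \<tau> and b = b] by (intro mult_left_mono) (simp_all add: \<psi>_def V_def x_def)
  finally have gauss: "cmod (\<psi> ^ k - of_real (1 - x) ^ k) \<le> real k * (\<bar>\<tau>\<bar> ^ 3 * (2 * K * real b) * V / 6)" .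
  have "cmod (of_real (1 - x) ^ k - of_real (exp (- (real k * x)))) = \<bar>(1 - x) ^ k - exp (- x) ^ k\<bar>"
    by (simp add: exp_of_nat_mult[symmetric] flip: of_real_power of_real_diff del: of_real_diff of_real_power)
  also have "\<dots> \<le> real k * \<bar>(1 - x) - exp (- x)\<bar>"
    using norm_power_diff[of "1 - x" "exp (- x)" k] x01 by simp
  also have "\<dots> \<le> real k * x\<^sup>2"
    by (intro mult_left_mono abs_one_minus_exp_minus_le x01) auto
  finally have ex: "cmod (of_real (1 - x) ^ k - of_real (exp (- (real k * x)))) \<le> real k * x\<^sup>2" .
  have tri: "cmod (a - e) \<le> cmod (a - b) + cmod (b - c) + cmod (c - d) + cmod (d - e)" for a b c d e
    using norm_triangle_ineq[of "a - b" "b - e"] norm_triangle_ineq[of "b - c" "c - e"] norm_triangle_ineq[of "c - d" "d - e"]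
    by simp
  show ?thesis
    using tri[of "expectation (\<lambda>\<omega>. iexp (\<tau> * csum h {1..p} \<omega>))" "of_real (exp (- (real k * x)))" "expectation (\<lambda>\<omega>. iexp (\<tau> * csum h R \<omega>))" "\<psi> ^ k" "of_real (1 - x) ^ k"]
      rem blocks gauss ex unfolding x_def[symmetric] by linarith
qed

text \<open>Bernstein's blocks for bounded variables: big blocks of length \<open>b = S l\<close> are separated by gaps
  of length \<open>l\<close>, where \<open>l\<close> is about \<open>sqrt p / S\<^sup>2\<close>. First \<open>p\<close> tends to infinity with \<open>S\<close> fixed; the error
  that remains vanishes as \<open>S\<close> tends to infinity. This works because summability and monotonicity
  of the mixing coefficients force \<open>l * \<alpha>(l)\<close> to tend to 0.\<close>

lemma char_bounded_limit:
  assumes h: "id_dominated h" and K: "\<And>x. \<bar>h x\<bar> \<le> K"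
  shows "(\<lambda>p. expectation (\<lambda>\<omega>. iexp (t / sqrt (real p) * csum h {1..p} \<omega>)))
    \<longlonglongrightarrow> of_real (exp (- (t\<^sup>2 * acov_sum h / 2)))"
proof -
  define C where "C = acov_abs_sum h"
  define \<sigma>2 where "\<sigma>2 = acov_sum h"
  define V where "V b = expectation (\<lambda>\<omega>. (csum h {1..b} \<omega>)\<^sup>2)" for b
  define S where "S s = real (Suc s)" for s
  \<comment> \<open>Two demands meet here. There are about \<open>p / ((S + 1) * l)\<close> blocks,
    so decoupling costs a multiple of \<open>p / l^2\<close> times
    \<open>l * \<alpha>(l + 1)\<close>, which vanishes if \<open>l\<close> is at least of order
    \<open>sqrt p\<close>. The Taylor error is of order \<open>b / sqrt p\<close>, which this choice
    makes about \<open>1 / S\<close>.\<close>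
  define l where "l s p = nat \<lfloor>sqrt (real p) / (S s)\<^sup>2\<rfloor>" for s p
  define b where "b s p = Suc s * l s p" for s p
  define k where "k s p = p div (b s p + l s p)" for s p
  \<comment> \<open>Quantities in which every error has a limit: \<open>u\<close> is the rescaled
    gap, \<open>w\<close> the fraction of indices in complete periods, \<open>v\<close> the block
    variance per index, \<open>x\<close> the quadratic term of one block, and \<open>c\<close> the
    share of a period taken by its big block.\<close>
  define u where "u s p = real (l s p) / sqrt (real p)" for s p
  define w where "w s p = real (k s p * (b s p + l s p)) / real p" for s p
  define v where "v s p = V (b s p) / real (b s p)" for s p
  define x where "x s p = (t / sqrt (real p))\<^sup>2 * V (b s p) / 2" for s p
  define a where "a s p = real (l s p) * alpha_mix M U (l s p + 1)" for s p
  define c where "c s = S s / (S s + 1)" for s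
  have S: "S s > 0" for s by (simp add: S_def)
  have b_l: "real (b s p) = S s * real (l s p)" "real (b s p + l s p) = (S s + 1) * real (l s p)" for s p
    by (simp_all add: b_def S_def algebra_simps)
  have sqrt_inf: "filterlim (\<lambda>p. sqrt (real p)) at_top sequentially"
    by real_asymp
  have u: "u s \<longlonglongrightarrow> 1 / (S s)\<^sup>2" for s
  proof (rule tendsto_sandwich)
    show "(\<lambda>p. 1 / (S s)\<^sup>2 - 1 / sqrt (real p)) \<longlonglongrightarrow> 1 / (S s)\<^sup>2"
      using tendsto_diff[OF tendsto_const tendsto_divide_0[OF tendsto_const filterlim_at_top_imp_at_infinity[OF sqrt_inf]]]
      by fastforce
    show "\<forall>\<^sub>F p in sequentially. 1 / (S s)\<^sup>2 - 1 / sqrt (real p) \<le> u s p"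
    proof (rule eventually_mono[OF eventually_gt_at_top[of 0]])
      fix p :: nat assume "p > 0"
      have "sqrt (real p) / (S s)\<^sup>2 - 1 \<le> real (l s p)" unfolding l_def by linarith
      then have "(sqrt (real p) / (S s)\<^sup>2 - 1) / sqrt (real p) \<le> u s p"
        unfolding u_def by (intro divide_right_mono) auto
      then show "1 / (S s)\<^sup>2 - 1 / sqrt (real p) \<le> u s p"
        using \<open>p > 0\<close> by (simp add: diff_divide_distrib)
    qed
    show "\<forall>\<^sub>F p in sequentially. u s p \<le> 1 / (S s)\<^sup>2"
    proof (rule eventually_mono[OF eventually_gt_at_top[of 0]])
      fix p :: nat assume "p > 0"
      have "0 \<le> sqrt (real p) / (S s)\<^sup>2" by simp
      then have "real (l s p) \<le> sqrt (real p) / (S s)\<^sup>2" unfolding l_def by linarith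
      then have "u s p \<le> (sqrt (real p) / (S s)\<^sup>2) / sqrt (real p)"
        unfolding u_def by (intro divide_right_mono) auto
      then show "u s p \<le> 1 / (S s)\<^sup>2" using \<open>p > 0\<close> by simp
    qed
  qed simp
  have l_inf: "filterlim (l s) at_top sequentially" for s
  proof -
    have "filterlim (\<lambda>p. u s p * sqrt (real p)) at_top sequentially"
      by (rule filterlim_tendsto_pos_mult_at_top[OF u _ sqrt_inf]) (use S[of s] in auto)
    then have "filterlim (\<lambda>p. real (l s p)) at_top sequentially"
    proof (rule filterlim_cong[THEN iffD1, rotated -1, OF _ refl refl])
      show "\<forall>\<^sub>F p in sequentially. u s p * sqrt (real p) = real (l s p)"
        using eventually_gt_at_top[of 0] by eventually_elim (simp add: u_def)
    qed
    then show ?thesis by (simp add: filterlim_sequentially_iff_filterlim_real)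
  qed
  have b_inf: "filterlim (b s) at_top sequentially" for s
    by (rule filterlim_at_top_mono[OF l_inf[of s]]) (simp add: b_def)
  have l_pos: "\<forall>\<^sub>F p in sequentially. l s p > 0 \<and> p > 0" for s
    using eventually_compose_filterlim[OF eventually_gt_at_top[of 0] l_inf[of s]] eventually_gt_at_top[of 0]
    by eventually_elim simp
  have v: "v s \<longlonglongrightarrow> \<sigma>2" for s
    using filterlim_compose[OF csum_sq_asymp[OF h] b_inf] by (simp add: v_def[abs_def] V_def \<sigma>2_def)
  have a: "a s \<longlonglongrightarrow> 0" for s
    using filterlim_compose[OF alpha_little_o l_inf] by (simp add: a_def[abs_def])
  have invsqrt: "(\<lambda>p. 1 / sqrt (real p)) \<longlonglongrightarrow> 0" by real_asymp
  \<comment> \<open>Rounding down to complete periods loses fewer than \<open>b + l\<close> indices,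
    a number of order \<open>sqrt p\<close>.\<close>
  have w: "w s \<longlonglongrightarrow> 1" for s
  proof (rule tendsto_sandwich)
    have "(\<lambda>p. 1 - (S s + 1) * u s p * (1 / sqrt (real p))) \<longlonglongrightarrow> 1 - (S s + 1) * (1 / (S s)\<^sup>2) * 0"
      by (intro tendsto_intros u invsqrt)
    then show "(\<lambda>p. 1 - (S s + 1) * u s p * (1 / sqrt (real p))) \<longlonglongrightarrow> 1" by simp
    show "\<forall>\<^sub>F p in sequentially. 1 - (S s + 1) * u s p * (1 / sqrt (real p)) \<le> w s p"
      using l_pos[of s]
    proof eventually_elim
      case (elim p)
      have "p - (b s p + l s p) \<le> k s p * (b s p + l s p)"
        using elim mod_less_divisor[of "b s p + l s p" p] div_mult_mod_eq[of p "b s p + l s p"] unfolding k_def by linarith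
      then have "real p - real (b s p + l s p) \<le> real (k s p * (b s p + l s p))" by linarith
      then have "(real p - real (b s p + l s p)) / real p \<le> w s p"
        unfolding w_def by (intro divide_right_mono) auto
      moreover have "(real p - real (b s p + l s p)) / real p = 1 - (S s + 1) * u s p * (1 / sqrt (real p))"
        using elim unfolding b_l by (simp add: u_def diff_divide_distrib)
      ultimately show ?case by simp
    qed
    show "\<forall>\<^sub>F p in sequentially. w s p \<le> 1"
    proof (rule always_eventually, rule allI)
      fix p
      have "k s p * (b s p + l s p) \<le> p" by (simp add: k_def)
      then have "real (k s p * (b s p + l s p)) \<le> real p" by (simp only: of_nat_le_iff)
      then show "w s p \<le> 1" unfolding w_def by (cases "p = 0") (auto simp: divide_le_eq)
    qed
  qed simp
  have x_eq: "x s p = t\<^sup>2 / 2 * v s p * S s * u s p * (1 / sqrt (real p))" if "l s p > 0" "p > 0" for s p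
  proof -
    have "V (b s p) = v s p * (S s * (u s p * sqrt (real p)))"
      using that S[of s] by (simp add: v_def b_l u_def)
    then show ?thesis using that by (simp add: x_def power_divide field_simps)
  qed
  have x: "x s \<longlonglongrightarrow> 0" for s
  proof -
    have "(\<lambda>p. t\<^sup>2 / 2 * v s p * S s * u s p * (1 / sqrt (real p))) \<longlonglongrightarrow> t\<^sup>2 / 2 * \<sigma>2 * S s * (1 / (S s)\<^sup>2) * 0"
      by (intro tendsto_intros u v invsqrt)
    then have lim0: "(\<lambda>p. t\<^sup>2 / 2 * v s p * S s * u s p * (1 / sqrt (real p))) \<longlonglongrightarrow> 0" by simp
    show ?thesis
      by (rule Lim_transform_eventually[OF lim0]) (use l_pos[of s] in eventually_elim, simp add: x_eq)
  qed
  \<comment> \<open>The first four summands are those of \<open>char_csum_bound\<close> in the new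
    quantities; the fifth compares the variance captured by the big blocks with
    \<open>\<sigma>2\<close>. In the limit \<open>e\<close> the decoupling and exponential errors
    are 0.\<close>
  define H where "H s p = \<bar>t\<bar> * sqrt ((1 - w s p * c s) * C) + 16 * (w s p / ((S s + 1) * (u s p)\<^sup>2)) * a s p +
     \<bar>t\<bar> ^ 3 * (K / 3) * (w s p * c s) * (v s p * (S s * u s p)) + w s p * c s * v s p * (t\<^sup>2 / 2) * x s p +
     \<bar>exp (- (t\<^sup>2 / 2 * (w s p * c s) * v s p)) - exp (- (t\<^sup>2 * \<sigma>2 / 2))\<bar>" for s p
  define e where "e s = \<bar>t\<bar> * sqrt ((1 - 1 * c s) * C) + 0 +
     \<bar>t\<bar> ^ 3 * (K / 3) * (1 * c s) * (\<sigma>2 * (S s * (1 / (S s)\<^sup>2))) + 0 +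
     \<bar>exp (- (t\<^sup>2 / 2 * (1 * c s) * \<sigma>2)) - exp (- (t\<^sup>2 * \<sigma>2 / 2))\<bar>" for s
  have "(\<lambda>p. cmod (expectation (\<lambda>\<omega>. iexp (t / sqrt (real p) * csum h {1..p} \<omega>)) - of_real (exp (- (t\<^sup>2 * \<sigma>2 / 2))))) \<longlonglongrightarrow> 0"
  proof (rule tendsto_zero_iterated)
    show "H s \<longlonglongrightarrow> e s" for s
    proof -
      have "H s \<longlonglongrightarrow> \<bar>t\<bar> * sqrt ((1 - 1 * c s) * C) + 16 * (1 / ((S s + 1) * (1 / (S s)\<^sup>2)\<^sup>2)) * 0 +
         \<bar>t\<bar> ^ 3 * (K / 3) * (1 * c s) * (\<sigma>2 * (S s * (1 / (S s)\<^sup>2))) + 1 * c s * \<sigma>2 * (t\<^sup>2 / 2) * 0 +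
         \<bar>exp (- (t\<^sup>2 / 2 * (1 * c s) * \<sigma>2)) - exp (- (t\<^sup>2 * \<sigma>2 / 2))\<bar>"
        unfolding H_def[abs_def] using S[of s] by (intro tendsto_intros u w v x a) auto
      then show ?thesis unfolding e_def mult_zero_right .
    qed
    \<comment> \<open>The surviving errors are governed by the share \<open>1 - c\<close> of the
      gaps and by the relative block length \<open>S * (1 / S^2)\<close>; both vanish as
      \<open>S\<close> grows.\<close>
    have cS: "c \<longlonglongrightarrow> 1" "(\<lambda>s. S s * (1 / (S s)\<^sup>2)) \<longlonglongrightarrow> 0"
      unfolding c_def[abs_def] S_def by real_asymp+
    have "e \<longlonglongrightarrow> \<bar>t\<bar> * sqrt ((1 - 1 * 1) * C) + 0 + \<bar>t\<bar> ^ 3 * (K / 3) * (1 * 1) * (\<sigma>2 * 0) + 0 +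
       \<bar>exp (- (t\<^sup>2 / 2 * (1 * 1) * \<sigma>2)) - exp (- (t\<^sup>2 * \<sigma>2 / 2))\<bar>"
      unfolding e_def[abs_def] by (intro tendsto_intros cS)
    then show "e \<longlonglongrightarrow> 0" by simp
    show "\<forall>\<^sub>F p in sequentially. cmod (expectation (\<lambda>\<omega>. iexp (t / sqrt (real p) * csum h {1..p} \<omega>)) - of_real (exp (- (t\<^sup>2 * \<sigma>2 / 2)))) \<le> H s p" for s
      using l_pos[of s] order_tendstoD(2)[OF x[of s], of 1, simplified]
    proof eventually_elim
      case (elim p)
      let ?\<tau> = "t / sqrt (real p)"
      have p: "real p > 0" "real (l s p) > 0" using elim by auto
      have le: "k s p * (b s p + l s p) \<le> p" by (simp add: k_def)
      have wp: "w s p * real p = real (k s p) * ((S s + 1) * real (l s p))"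
        using p unfolding w_def of_nat_mult b_l by simp
      \<comment> \<open>The number of indices kept in big blocks; through it the bound turns into
        the first four summands of \<open>H\<close> by exact identities.\<close>
      have kb: "real (k s p * b s p) = w s p * c s * real p"
      proof -
        have cS1: "c s * (S s + 1) = S s" using S[of s] by (simp add: c_def)
        have "w s p * c s * real p = (w s p * real p) * c s" by simp
        also have "\<dots> = real (k s p) * real (l s p) * (c s * (S s + 1))" unfolding wp by (simp only: mult_ac)
        finally show ?thesis unfolding cS1 of_nat_mult b_l by (simp only: mult_ac)
      qed
      have "k s p * b s p \<le> p" using le by (simp add: distrib_left)
      then have "real (p - k s p * b s p) = (1 - w s p * c s) * real p"
        by (simp only: of_nat_diff kb) (simp add: algebra_simps)
      then have T1: "\<bar>?\<tau>\<bar> * sqrt (real (p - k s p * b s p) * C) = \<bar>t\<bar> * sqrt ((1 - w s p * c s) * C)"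
        using p by (simp add: real_sqrt_mult)
      have T2: "real (k s p) * (16 * alpha_mix M U (l s p + 1)) = 16 * (w s p / ((S s + 1) * (u s p)\<^sup>2)) * a s p"
      proof -
        have "real (k s p) = w s p * real p / ((S s + 1) * real (l s p))"
          unfolding wp using p S[of s] by simp
        moreover have "(u s p)\<^sup>2 = (real (l s p))\<^sup>2 / real p" by (simp add: u_def power_divide)
        ultimately show ?thesis
          using p S[of s] by (simp add: a_def power2_eq_square)
      qed
      have Vv: "V (b s p) = v s p * real (b s p)" and bu: "real (b s p) = S s * (u s p * sqrt (real p))"
        using p S[of s] by (simp_all add: v_def b_l u_def)
      have T3: "real (k s p) * (\<bar>?\<tau>\<bar> ^ 3 * (2 * K * real (b s p)) * V (b s p) / 6) =
          \<bar>t\<bar> ^ 3 * (K / 3) * (w s p * c s) * (v s p * (S s * u s p))"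
      proof -
        have "real (k s p) * (\<bar>?\<tau>\<bar> ^ 3 * (2 * K * real (b s p)) * V (b s p) / 6) =
          \<bar>t\<bar> ^ 3 * (K / 3) * (real (k s p * b s p) / real p) * (V (b s p) / sqrt (real p))"
          using p by (simp add: power_divide power3_eq_cube mult_ac)
        also have "real (k s p * b s p) / real p = w s p * c s" using p by (simp only: kb) simp
        also have "V (b s p) / sqrt (real p) = v s p * (S s * u s p)" using p by (simp add: Vv bu)
        finally show ?thesis .
      qed
      have kx: "real (k s p) * x s p = t\<^sup>2 / 2 * (w s p * c s) * v s p"
      proof -
        have "real (k s p) * x s p = t\<^sup>2 / 2 * (real (k s p * b s p) / real p) * v s p"
          using p by (simp add: x_def Vv power_divide mult_ac)
        also have "real (k s p * b s p) / real p = w s p * c s" using p by (simp only: kb) simp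
        finally show ?thesis .
      qed
      have T4: "real (k s p) * (x s p)\<^sup>2 = w s p * c s * v s p * (t\<^sup>2 / 2) * x s p"
        unfolding power2_eq_square[of "x s p"] mult.assoc[symmetric] kx by simp
      have "cmod (expectation (\<lambda>\<omega>. iexp (?\<tau> * csum h {1..p} \<omega>)) - of_real (exp (- (real (k s p) * x s p)))) \<le>
          \<bar>?\<tau>\<bar> * sqrt (real (p - k s p * b s p) * C) + real (k s p) * (16 * alpha_mix M U (l s p + 1)) +
          real (k s p) * (\<bar>?\<tau>\<bar> ^ 3 * (2 * K * real (b s p)) * V (b s p) / 6) + real (k s p) * (x s p)\<^sup>2"
        using char_csum_bound[OF h K le, of ?\<tau>] elim unfolding x_def V_def C_def by simp
      moreover have "cmod (of_real (exp (- (real (k s p) * x s p))) - of_real (exp (- (t\<^sup>2 * \<sigma>2 / 2)))) =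
          \<bar>exp (- (t\<^sup>2 / 2 * (w s p * c s) * v s p)) - exp (- (t\<^sup>2 * \<sigma>2 / 2))\<bar>"
        unfolding kx by (simp only: of_real_diff[symmetric] norm_of_real)
      ultimately show ?case
        unfolding T1 T2 T3 T4 H_def
        using norm_triangle_ineq[of "expectation (\<lambda>\<omega>. iexp (?\<tau> * csum h {1..p} \<omega>)) - of_real (exp (- (real (k s p) * x s p)))"
            "of_real (exp (- (real (k s p) * x s p))) - of_real (exp (- (t\<^sup>2 * \<sigma>2 / 2)))"]
        by simp
    qed
  qed simp
  then show ?thesis
    by (simp add: \<sigma>2_def tendsto_norm_zero_iff LIM_zero_iff)
qed

section \<open>Removing the truncation\<close>

lemma acov_tendsto:
  assumes hN: "\<And>N :: nat. id_dominated (H N)" and h: "id_dominated h" and lim: "\<And>x. (\<lambda>N. H N x) \<longlonglongrightarrow> h x"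
  shows "(\<lambda>N. acov (H N) k) \<longlonglongrightarrow> acov h k"
proof -
  have [measurable]: "H N \<in> borel_measurable borel" "h \<in> borel_measurable borel" for N
    using hN h by (auto simp: id_dominated_def)
  have le: "\<bar>H N x\<bar> \<le> \<bar>x\<bar>" for N x using hN by (auto simp: id_dominated_def)
  have id: "id_dominated (\<lambda>x. x)" by (simp add: id_dominated_def)
  have "(\<lambda>N. mean (H N)) \<longlonglongrightarrow> mean h"
    unfolding mean_def
  proof (rule integral_dominated_convergence)
    show "integrable M (\<lambda>\<omega>. \<bar>U 1 \<omega>\<bar>)" using id_dominated_integrable[OF id, of 1] by simp
  qed (use lim le in auto)
  moreover have "(\<lambda>N. expectation (\<lambda>\<omega>. H N (U 1 \<omega>) * H N (U (1 + k) \<omega>))) \<longlonglongrightarrow> expectation (\<lambda>\<omega>. h (U 1 \<omega>) * h (U (1 + k) \<omega>))"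
  proof (rule integral_dominated_convergence)
    show "integrable M (\<lambda>\<omega>. \<bar>U 1 \<omega> * U (1 + k) \<omega>\<bar>)"
      using product_integrable[OF id id, of 1 "1 + k"] by simp
    show "AE \<omega> in M. norm (H N (U 1 \<omega>) * H N (U (1 + k) \<omega>)) \<le> \<bar>U 1 \<omega> * U (1 + k) \<omega>\<bar>" for N
      using le by (auto simp: abs_mult intro!: mult_mono)
    show "AE \<omega> in M. (\<lambda>N. H N (U 1 \<omega>) * H N (U (1 + k) \<omega>)) \<longlonglongrightarrow> h (U 1 \<omega>) * h (U (1 + k) \<omega>)"
      by (intro AE_I2 tendsto_mult lim)
  qed measurable
  ultimately show ?thesis
    unfolding acov_def by (intro tendsto_intros)
qed

text \<open>Tannery's theorem: the mixing bound on the autocovariances does not depend on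
  \<open>N\<close>, so limit and sum over the lags may be interchanged.\<close>

lemma acov_sums_tendsto:
  assumes hN: "\<And>N :: nat. id_dominated (H N)" and h: "id_dominated h" and lim: "\<And>x. (\<lambda>N. H N x) \<longlonglongrightarrow> h x"
  shows "(\<lambda>N. acov_sum (H N)) \<longlonglongrightarrow> acov_sum h" and "(\<lambda>N. acov_abs_sum (H N)) \<longlonglongrightarrow> acov_abs_sum h"
proof -
  note ac = acov_tendsto[OF hN h lim]
  \<comment> \<open>Stated for \<open>f\<close> so that the identity and the absolute value are
    treated at once.\<close>
  have bound: "\<forall>\<^sub>F (k, N) in at_top \<times>\<^sub>F sequentially. norm (f (acov (H N) (k + 1))) \<le> mixing_const * alpha_mix M U (k + 1) powr (\<delta> / (2 + \<delta>))"
    if "\<And>y. \<bar>f y\<bar> = \<bar>y\<bar>" for f :: "real \<Rightarrow> real"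
    using acov_bound[OF hN] that by (intro always_eventually) auto
  have "(\<lambda>N. \<Sum>k. acov (H N) (k + 1)) \<longlonglongrightarrow> (\<Sum>k. acov h (k + 1))"
    using tannerys_theorem[where a = "\<lambda>k N. acov (H N) (k + 1)", OF ac bound[of "\<lambda>y. y"] mixing_bound_summable] by simp
  then show "(\<lambda>N. acov_sum (H N)) \<longlonglongrightarrow> acov_sum h"
    unfolding acov_sum_def by (intro tendsto_intros ac)
  have "(\<lambda>N. \<Sum>k. \<bar>acov (H N) (k + 1)\<bar>) \<longlonglongrightarrow> (\<Sum>k. \<bar>acov h (k + 1)\<bar>)"
    using tannerys_theorem[where a = "\<lambda>k N. \<bar>acov (H N) (k + 1)\<bar>", OF tendsto_rabs[OF ac] bound[of abs] mixing_bound_summable] by simp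
  then show "(\<lambda>N. acov_abs_sum (H N)) \<longlonglongrightarrow> acov_abs_sum h"
    unfolding acov_abs_sum_def by (intro tendsto_intros ac)
qed

definition clip :: "nat \<Rightarrow> real \<Rightarrow> real" where
  "clip N x = max (- real N) (min (real N) x)"

text \<open>The function 0 is included as the limit of the remainders.\<close>

lemma id_dominated_clip: "id_dominated (clip N)" "id_dominated (\<lambda>x. x - clip N x)" "id_dominated (\<lambda>x. x)" "id_dominated (\<lambda>x. 0)"
  by (auto simp: id_dominated_def clip_def[abs_def])

lemma clip_tendsto: "(\<lambda>N. clip N x) \<longlonglongrightarrow> x"
proof (rule tendsto_eventually)
  obtain n where "\<bar>x\<bar> \<le> real n" using real_arch_simple by blast
  then show "\<forall>\<^sub>F N in sequentially. clip N x = x"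
    by (intro eventually_sequentiallyI[of n]) (auto simp: clip_def)
qed

text \<open>Replacing the sum by its truncated version costs at most
  \<open>\<bar>t\<bar> * sqrt (acov_abs_sum ...)\<close> of the remainder for every
  \<open>p > 0\<close>: the factor \<open>sqrt p\<close> from the second moment cancels the
  normalisation. The other errors are the bounded case and the change of the long-run
  variance.\<close>

lemma char_limit:
  "(\<lambda>p. expectation (\<lambda>\<omega>. iexp (t / sqrt (real p) * csum (\<lambda>x. x) {1..p} \<omega>)))
    \<longlonglongrightarrow> of_real (exp (- (t\<^sup>2 * acov_sum (\<lambda>x. x) / 2)))"
proof -
  let ?E = "\<lambda>h p. expectation (\<lambda>\<omega>. iexp (t / sqrt (real p) * csum h {1..p} \<omega>))"
  let ?g = "\<lambda>h. complex_of_real (exp (- (t\<^sup>2 * acov_sum h / 2)))"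
  let ?r = "\<lambda>N x. x - clip N x"
  define H where "H N p = \<bar>t\<bar> * sqrt (acov_abs_sum (?r N)) + cmod (?E (clip N) p - ?g (clip N)) + cmod (?g (clip N) - ?g (\<lambda>x. x))" for N p
  define e where "e N = \<bar>t\<bar> * sqrt (acov_abs_sum (?r N)) + 0 + cmod (?g (clip N) - ?g (\<lambda>x. x))" for N
  have "(\<lambda>p. cmod (?E (\<lambda>x. x) p - ?g (\<lambda>x. x))) \<longlonglongrightarrow> 0"
  proof (rule tendsto_zero_iterated)
    have "(\<lambda>p. ?E (clip N) p) \<longlonglongrightarrow> ?g (clip N)" for N
      by (rule char_bounded_limit[OF id_dominated_clip(1), where K = "real N"]) (auto simp: clip_def)
    then have "(\<lambda>p. cmod (?E (clip N) p - ?g (clip N))) \<longlonglongrightarrow> 0" for N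
      by (intro tendsto_norm_zero LIM_zero)
    then show "H N \<longlonglongrightarrow> e N" for N
      unfolding H_def[abs_def] e_def by (intro tendsto_add tendsto_const)
    have "(\<lambda>N. ?r N x) \<longlonglongrightarrow> 0" for x
      using tendsto_diff[OF tendsto_const clip_tendsto[of x], of x] by simp
    then have "(\<lambda>N. acov_abs_sum (?r N)) \<longlonglongrightarrow> acov_abs_sum (\<lambda>x. 0)"
      by (intro acov_sums_tendsto id_dominated_clip)
    moreover have "acov_abs_sum (\<lambda>x. 0) = 0" by (simp add: acov_abs_sum_def acov_def mean_def)
    moreover have "(\<lambda>N. ?g (clip N) - ?g (\<lambda>x. x)) \<longlonglongrightarrow> ?g (\<lambda>x. x) - ?g (\<lambda>x. x)"
      by (intro tendsto_intros acov_sums_tendsto id_dominated_clip clip_tendsto) simp_all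
    ultimately have "e \<longlonglongrightarrow> \<bar>t\<bar> * sqrt 0 + 0 + cmod (?g (\<lambda>x. x) - ?g (\<lambda>x. x))"
      unfolding e_def[abs_def] by (intro tendsto_add tendsto_mult tendsto_const tendsto_real_sqrt tendsto_norm) simp_all
    then show "e \<longlonglongrightarrow> 0" by simp
    show "\<forall>\<^sub>F p in sequentially. cmod (?E (\<lambda>x. x) p - ?g (\<lambda>x. x)) \<le> H N p" for N
      using eventually_gt_at_top[of 0]
    proof eventually_elim
      case (elim p)
      let ?\<tau> = "t / sqrt (real p)"
      note [measurable] = csum_measurable[OF id_dominated_clip(1)] csum_measurable[OF id_dominated_clip(2)] csum_measurable[OF id_dominated_clip(3)]
      have "mean (?r N) = mean (\<lambda>x. x) - mean (clip N)"
        unfolding mean_def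
        using id_dominated_integrable[OF id_dominated_clip(1), of 1] id_dominated_integrable[OF id_dominated_clip(3), of 1] by simp
      then have split: "csum (\<lambda>x. x) R \<omega> - csum (clip N) R \<omega> = csum (?r N) R \<omega>" for R \<omega>
        unfolding csum_def sum_subtractf[symmetric] by (intro sum.cong refl) simp
      have R: "finite {1..p}" "0 \<notin> {1..p}" by auto
      have "cmod (?E (\<lambda>x. x) p - ?E (clip N) p) = cmod (expectation (\<lambda>\<omega>. iexp (?\<tau> * csum (\<lambda>x. x) {1..p} \<omega>) - iexp (?\<tau> * csum (clip N) {1..p} \<omega>)))"
        by (subst Bochner_Integration.integral_diff) (auto intro!: iexp_integrable simp del: of_real_mult of_real_divide)
      also have "\<dots> \<le> expectation (\<lambda>\<omega>. cmod (iexp (?\<tau> * csum (\<lambda>x. x) {1..p} \<omega>) - iexp (?\<tau> * csum (clip N) {1..p} \<omega>)))"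
        by (rule integral_norm_bound)
      also have "\<dots> \<le> expectation (\<lambda>\<omega>. \<bar>?\<tau>\<bar> * \<bar>csum (?r N) {1..p} \<omega>\<bar>)"
      proof (rule integral_mono)
        show "cmod (iexp (?\<tau> * csum (\<lambda>x. x) {1..p} \<omega>) - iexp (?\<tau> * csum (clip N) {1..p} \<omega>)) \<le> \<bar>?\<tau>\<bar> * \<bar>csum (?r N) {1..p} \<omega>\<bar>" for \<omega>
          using norm_iexp_diff_le[of "?\<tau> * csum (\<lambda>x. x) {1..p} \<omega>" "?\<tau> * csum (clip N) {1..p} \<omega>"]
          by (simp only: right_diff_distrib[symmetric] split abs_mult)
        show "integrable M (\<lambda>\<omega>. cmod (iexp (?\<tau> * csum (\<lambda>x. x) {1..p} \<omega>) - iexp (?\<tau> * csum (clip N) {1..p} \<omega>)))"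
          by (intro integrable_norm Bochner_Integration.integrable_diff iexp_integrable) measurable
      qed (use csum_expectation(2)[OF id_dominated_clip(2) R(2)] in auto)
      also have "\<dots> = \<bar>?\<tau>\<bar> * expectation (\<lambda>\<omega>. \<bar>csum (?r N) {1..p} \<omega>\<bar>)" by simp
      also have "\<dots> \<le> \<bar>?\<tau>\<bar> * sqrt (real (card {1..p}) * acov_abs_sum (?r N))"
        by (intro mult_left_mono expectation_abs_csum id_dominated_clip R) simp
      also have "\<dots> = \<bar>t\<bar> * sqrt (acov_abs_sum (?r N))"
        using elim by (simp add: real_sqrt_mult)
      finally show ?case
        unfolding H_def
        using norm_triangle_ineq[of "?E (\<lambda>x. x) p - ?E (clip N) p" "?E (clip N) p - ?g (\<lambda>x. x)"]
          norm_triangle_ineq[of "?E (clip N) p - ?g (clip N)" "?g (clip N) - ?g (\<lambda>x. x)"] by simp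
    qed
  qed simp
  then show ?thesis
    by (simp only: tendsto_norm_zero_iff LIM_zero_iff)
qed

text \<open>Evaluating the preceding limit at \<open>t\<close> divided by the long-run standard
  deviation gives \<open>exp (- t^2 / 2)\<close>, and Levy's continuity theorem applies.\<close>

theorem central_limit_theorem_mixing:
  assumes "acov_sum (\<lambda>x. x) > 0"
  shows "weak_conv_m
     (\<lambda>p. distr M borel (\<lambda>\<omega>. ((\<Sum>j\<in>{1..p}. U j \<omega>) - real p * mean (\<lambda>x. x)) / (sqrt (acov_sum (\<lambda>x. x)) * sqrt (real p))))
     std_normal_distribution"
proof (rule levy_continuity)
  let ?s = "sqrt (acov_sum (\<lambda>x. x))"
  let ?X = "\<lambda>p \<omega>. ((\<Sum>j\<in>{1..p}. U j \<omega>) - real p * mean (\<lambda>x. x)) / (?s * sqrt (real p))"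
  show "real_distribution (distr M borel (?X p))" for p
    by (rule real_distribution_distr) measurable
  show "real_distribution std_normal_distribution" by (rule real_dist_normal_dist)
  fix t
  have X: "t * ?X p \<omega> = t / ?s / sqrt (real p) * csum (\<lambda>x. x) {1..p} \<omega>" for p \<omega>
    by (simp add: csum_def sum_subtractf)
  have "char (distr M borel (?X p)) t = expectation (\<lambda>\<omega>. iexp (t / ?s / sqrt (real p) * csum (\<lambda>x. x) {1..p} \<omega>))" for p
  proof -
    have "char (distr M borel (?X p)) t = expectation (\<lambda>\<omega>. iexp (t * ?X p \<omega>))"
      unfolding char_def by (rule integral_distr) measurable
    then show ?thesis unfolding X .
  qed
  moreover have "(t / ?s)\<^sup>2 * acov_sum (\<lambda>x. x) / 2 = t\<^sup>2 / 2"
    using assms by (simp add: power_divide)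
  ultimately show "(\<lambda>p. char (distr M borel (?X p)) t) \<longlonglongrightarrow> char std_normal_distribution t"
    using char_limit[of "t / ?s"] by (simp add: char_std_normal_distribution)
qed

end

section \<open>Asymptotic normality\<close>

text \<open>The defining condition is tested on the \<open>j\<close>-th unit vector; positive
  definiteness excludes the degenerate branch.\<close>

lemma gaussian_proc_coordinate:
  assumes "gaussian_proc M Y mu S" "pos_def_cov S" "j \<ge> 1"
  shows "S j j > 0" and "distributed M lborel (Y j) (\<lambda>x. ennreal (normal_density (mu j) (sqrt (S j j)) x))"
proof -
  let ?c = "\<lambda>i. if i = j then 1 else 0 :: real"
  have sums: "(\<Sum>i\<in>{1..j}. ?c i * f i) = f j" for f :: "nat \<Rightarrow> real"
    using assms(3) by (simp add: if_distrib[of "\<lambda>x. x * _"] sum.delta cong: if_cong)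
  have v: "(\<Sum>i\<in>{1..j}. \<Sum>k\<in>{1..j}. ?c i * ?c k * S i k) = S j j"
    by (simp only: mult.assoc sum_distrib_left[symmetric] sums)
  show pos: "S j j > 0"
    using assms(2,3) unfolding pos_def_cov_def v[symmetric] by (elim conjE allE[of _ j] allE[of _ ?c] impE) auto
  show "distributed M lborel (Y j) (\<lambda>x. ennreal (normal_density (mu j) (sqrt (S j j)) x))"
    using assms(1) pos unfolding gaussian_proc_def Let_def
    by (elim conjE allE[of _ j] allE[of _ ?c]) (simp only: sums v if_True)
qed

theorem theorem1:
  fixes M :: "'a measure"
    and X :: "nat \<Rightarrow> nat \<Rightarrow> 'a \<Rightarrow> real"
    and n :: nat
    and mu0 :: "nat \<Rightarrow> real"
    and Sig :: "nat \<Rightarrow> nat \<Rightarrow> real"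
    and gam :: "nat \<Rightarrow> real"
  defines "U \<equiv> Ustat X n mu0"
    and "tau1 \<equiv> sqrt (m2 n - (m1 n)\<^sup>2 + 2 * (\<Sum>k. gam (k + 1)))"
  assumes "prob_space M"
    and "n \<ge> 2"
    and "pos_def_cov Sig"
    and H0: "\<forall>i\<in>{1..n}. gaussian_proc M (X i) mu0 Sig"
    and indep: "prob_space.indep_vars M (\<lambda>_. Pi\<^sub>M UNIV (\<lambda>_. borel)) (\<lambda>i \<omega>. \<lambda>j. X i j \<omega>) {1..n}"
    and "stationary_seq M U"
    and C1: "\<forall>r\<ge>1. alpha_mix M U (r + 1) \<le> alpha_mix M U r"
    and C1': "(\<lambda>r. alpha_mix M U r) \<longlonglongrightarrow> 0"
    and C2: "\<exists>\<delta>>0. summable (\<lambda>r. alpha_mix M U (r + 1) powr (\<delta> / (2 + \<delta>)))"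
    and C2': "\<forall>k. (\<lambda>p. (\<Sum>j\<in>{1..p - k}. cov M (U j) (U (j + k))) / real (p - k)) \<longlonglongrightarrow> gam k"
    and "m2 n - (m1 n)\<^sup>2 + 2 * (\<Sum>k. gam (k + 1)) > 0"
  shows "weak_conv_m
           (\<lambda>p. distr M borel (\<lambda>\<omega>. (T1stat X n mu0 p \<omega> - real p * m1 n) / (tau1 * sqrt (real p))))
           std_normal_distribution"
proof -
  interpret prob_space M by fact
  have [measurable]: "X i j \<in> borel_measurable M" if "i \<in> {1..n}" for i j
    using H0 that by (auto simp: gaussian_proc_def)
  have U_meas: "U j \<in> borel_measurable M" for j
    unfolding U_def Ustat_def[abs_def] tstat_def svar_def xbar_def by measurable
  have ind: "indep_vars (\<lambda>_. borel) (\<lambda>i. X i j) {1..n}" for j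
    using indep_vars_compose2[OF indep, of "\<lambda>_ x. x j" "\<lambda>_. borel"] by simp
  \<comment> \<open>All observations share \<open>Sig\<close>, so the first one suffices to obtain
    positive standard deviations.\<close>
  have "1 \<in> {1..n}" using \<open>n \<ge> 2\<close> by simp
  note H = gaussian_proc_coordinate[OF H0[rule_format] \<open>pos_def_cov Sig\<close>]
  have sd: "sqrt (Sig j j) > 0" if "j \<ge> 1" for j
    using H(1)[OF \<open>1 \<in> {1..n}\<close> that] by simp
  note moments = Ustat_moments[where ?mu0.0 = mu0, OF \<open>n \<ge> 2\<close> sd ind H(2) U_meas[unfolded U_def]]
  obtain \<delta> where \<delta>: "\<delta> > 0" "summable (\<lambda>r. alpha_mix M U (r + 1) powr (\<delta> / (2 + \<delta>)))"
    using C2 by blast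
  interpret stationary_mixing M U \<delta>
  proof
    \<comment> \<open>The value of \<open>\<delta>\<close> comes from the mixing condition; the
      exponential moment of the statistic makes any value acceptable.\<close>
    show "integrable M (\<lambda>\<omega>. \<bar>U 1 \<omega>\<bar> powr (2 + \<delta>))"
      unfolding U_def using \<delta>(1) by (intro moments(3)) auto
  qed (use U_meas \<open>stationary_seq M U\<close> \<delta> C1 in auto)
  note id = id_dominated_clip(3)
  have mean_id: "mean (\<lambda>x. x) = m1 n"
    unfolding mean_def unfolding U_def by (rule moments(1)) auto
  have acov0: "acov (\<lambda>x. x) 0 = m2 n - (m1 n)\<^sup>2"
  proof -
    have "expectation (\<lambda>\<omega>. (Ustat X n mu0 1 \<omega>)\<^sup>2) = m2 n"
      by (rule moments(2)) auto
    then have "expectation (\<lambda>\<omega>. U 1 \<omega> * U (1 + 0) \<omega>) = m2 n"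
      unfolding U_def by (simp add: power2_eq_square)
    then show ?thesis by (simp only: acov_def mean_id)
  qed
  have cov_eq: "cov M (U j) (U (j + k)) = acov (\<lambda>x. x) k" if "j \<ge> 1" for j k
    using product_expectation[OF id that, of "j + k"] mean_eq[OF id that] mean_eq[OF id, of "j + k"] that
    by (simp add: cov_def)
  \<comment> \<open>As soon as \<open>p > k\<close>, the average consists of equal terms by
    stationarity, so the assumed limit must be their common value.\<close>
  have gam: "gam k = acov (\<lambda>x. x) k" for k
  proof (rule LIMSEQ_unique[OF C2'[rule_format, of k]])
    have "\<forall>\<^sub>F p in sequentially. (\<Sum>j\<in>{1..p - k}. cov M (U j) (U (j + k))) / real (p - k) = acov (\<lambda>x. x) k"
      using eventually_gt_at_top[of k]
    proof eventually_elim
      case (elim p)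
      have "(\<Sum>j\<in>{1..p - k}. cov M (U j) (U (j + k))) = (\<Sum>j\<in>{1..p - k}. acov (\<lambda>x. x) k)"
        by (intro sum.cong refl cov_eq) auto
      then show ?case using elim by simp
    qed
    then show "(\<lambda>p. (\<Sum>j\<in>{1..p - k}. cov M (U j) (U (j + k))) / real (p - k)) \<longlonglongrightarrow> acov (\<lambda>x. x) k"
      by (rule tendsto_eventually)
  qed
  \<comment> \<open>The lag 0 term of the long-run variance is \<open>m2 n - (m1 n)^2\<close>, so
    \<open>tau1\<close> is the standard deviation of the limit theorem.\<close>
  have total: "m2 n - (m1 n)\<^sup>2 + 2 * (\<Sum>k. gam (k + 1)) = acov_sum (\<lambda>x. x)"
    by (simp add: acov_sum_def acov0 gam)
  show ?thesis
    using central_limit_theorem_mixing assms(13)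
    unfolding tau1_def total T1stat_def U_def[symmetric] mean_id by blast
qed

end
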